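(* The natural correspondence of basis elements (sending the basis element of $\mathcal X^{DD}$, resp. $\widetilde{\mathcal X}^{DD}$, with a given name $z_j$, $x_j$ or $y_j$ to $m\otimes k_{\mathbf y}$, where $m$ is the basis element of $\mathcal X^{DA}$, resp. $\widetilde{\mathcal X}^{DA}$, with the same name and $\mathbf I_{\mathbf y}$ is the right idempotent of $m$) gives isomorphisms $\mathcal X^{DD}\cong\mathcal X^{DA}\boxtimes\mathcal K$ and $\widetilde{\mathcal X}^{DD}\cong\widetilde{\mathcal X}^{DA}\boxtimes\mathcal K$ of $DD$ bimodules over $(\mathcal B(2),\mathcal B^!(2))$.
   Context: Let $\mathbb F=\mathbb F_2$. **Algebras.** $\mathcal B(2)$ is the $\mathbb F$-path algebra of the following quiver modulo relations. Vertices: all subsets $\mathbf x\subset\{0,1,2\}$. For $i\in\{1,2\}$: an arrow $R_i$ from $\mathbf x$ to $(\mathbf x\setminus\{i-1\})\cup\{i\}$ whenever $\mathbf x\cap\{i-1,i\}=\{i-1\}$; an arrow $L_i$ from $\mathbf x$ to $(\mathbf x\setminus\{i\})\cup\{i-1\}$ whenever $\mathbf x\cap\{i-1,i\}=\{i\}$; a loop $U_i$ at every $\mathbf x$. Paths are multiplied left to right: an arrow from $\mathbf x$ to $\mathbf y$ lies in $\mathbf I_{\mathbf x}\mathcal B(2)\mathbf I_{\mathbf y}$, where $\mathbf I_{\mathbf x}$ is the trivial path at $\mathbf x$. Relations, wherever composable: $U_i$ commutes with all labels; $R_iL_i=U_i$; $L_iR_i=U_i$; $R_1R_2=0$; $L_2L_1=0$;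 $U_i=0$ at $\mathbf x$ if $\mathbf x\cap\{i-1,i\}=\varnothing$. The differential is zero. $\mathcal B^!(2)$ is defined in the same way with additional loops $C_1,C_2$ at every vertex, $C_i^2=0$, $C_i$ commuting with all labels, and differential $\partial(C_i)=U_i$ (zero on the other generators, Leibniz rule). $\mathcal I(2)$ is the span of the $\mathbf I_{\mathbf x}$; $\mathcal B(2,k)$ is the summand with $|\mathbf x|=k$, $0\le k\le3$. Write $A=\{0\},B=\{1\},C=\{2\},AB=\{0,1\}$, etc. Gradings (homological; Alexander in $\mathbb Z\langle\tau_1,\beta_1,\tau_2,\beta_2\rangle$): in $\mathcal B(2)$, $R_i:(0;\tau_i)$, $L_i:(0;\beta_i)$, $U_i:(0;\tau_i+\beta_i)$; in $\mathcal B^!(2)$, $R_i:(1;-\beta_i)$, $L_i:(1;-\tau_i)$, $U_i:(2;-\tau_i-\beta_i)$, $C_i:(1;-\tau_i-\beta_i)$. Basis of $\mathcal B(2)$ used to specify $DA$ operations ($i,j\ge0$): $k=0$: $\mathbf I_\varnothing$. $k=1$: $A$ to $A$: $U_1^i$; $A$ to $B$: $R_1U_1^i$; $B$ to $A$: $L_1U_1^i$; $B$ to $B$: $\mathbf I_B,U_1^{i+1},U_2^{i+1}$; $B$ to $C$: $R_2U_2^i$; $C$ to $B$: $L_2U_2^i$; $C$ to $C$: $U_2^i$. $k=2$: $pU_1^iU_2^j$ with $p$ an idempotent, $R_2$ ($AB$ to $AC$), $R_2R_1$ ($AB$ to $BC$), $L_2$ ($AC$ to $AB$), $R_1$ ($AC$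 to $BC$), $L_1L_2$ ($BC$ to $AB$), $L_1$ ($BC$ to $AC$). $k=3$: $U_1^iU_2^j$. **$DD$ bimodules.** A $DD$ bimodule over $(\mathcal B(2),\mathcal B^!(2))$ is a $\mathbb Z\oplus\mathbb Z^4$-graded left $\mathcal I(2)\otimes\mathcal I(2)$-module $X$ with an $\mathcal I(2)\otimes\mathcal I(2)$-linear map $\delta^1:X\to(\mathcal B(2)\otimes\mathcal B^!(2))\otimes_{\mathcal I(2)\otimes\mathcal I(2)}X$ preserving Alexander degree, raising homological degree by $1$, and satisfying $(\partial\otimes\mathrm{id})\delta^1+(\mu\otimes\mathrm{id})(\mathrm{id}\otimes\delta^1)\delta^1=0$. **The bimodule $\mathcal K$ and the box product.** $\mathcal K$ is the $DD$ bimodule over $(\mathcal B(2),\mathcal B^!(2))$ with $\mathbb F$-basis $k_{\mathbf x}$, $\mathbf x\subset\{0,1,2\}$, all in degree $0$, where $k_{\mathbf x}$ has first idempotent $\mathbf I_{\mathbf x}$ and second idempotent $\mathbf I_{\mathbf x'}$, $\mathbf x'=\{0,1,2\}\setminus\mathbf x$, and $$\delta^1(k_{\mathbf x})=\sum_{\mathbf y}\Big((\mathbf I_{\mathbf x}\otimes\mathbf I_{\mathbf x'})\cdot\sum_{i=1}^2(L_i\otimes R_i+R_i\otimes L_i+U_i\otimes C_i)\cdot(\mathbf I_{\mathbf y}\otimes\mathbf I_{\mathbf y'})\Big)\otimes k_{\mathbf y},$$ where labels denote sums of all arrows with that label. Let $\delta^0=\mathrm{id}$ and let $\delta^j:\mathcal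 K\to(\mathcal B(2)\otimes\mathcal B^!(2))^{\otimes j}\otimes\mathcal K$ be the $j$-fold iterate of $\delta^1$ (without multiplying). A $DA$ bimodule $X$ over $(\mathcal B(2),\mathcal B(2))$ is a graded $(\mathcal I(2),\mathcal I(2))$-bimodule with operations $\delta^1_i:X\otimes\mathcal B(2)^{\otimes(i-1)}\to\mathcal B(2)\otimes X$ satisfying the $A_\infty$-type $DA$ relations. If $\delta^1_j=0$ for large $j$, $X\boxtimes\mathcal K$ is the $DD$ bimodule $X\otimes_{\mathcal I(2)}\mathcal K$ with degree of $m\otimes k_{\mathbf y}$ the sum of the degrees, first idempotent the left idempotent of $m$, second idempotent the second idempotent of $k_{\mathbf y}$, and operation $\delta^{\boxtimes}=\sum_{j\ge1}$ (apply $\delta^{j-1}$ to $\mathcal K$, giving terms $(a_1\otimes b_1)\otimes\cdots\otimes(a_{j-1}\otimes b_{j-1})\otimes k$; apply $\delta^1_j$ to $m\otimes a_1\otimes\cdots\otimes a_{j-1}$, giving terms $a\otimes m'$; output $(a\otimes b_1\cdots b_{j-1})\otimes(m'\otimes k)$). **$\mathcal X^{DA}$ and $\mathcal X^{DD}$.** Both have bases with the following names and types; "$(\mathbf x|\mathbf y)$" means that in $\mathcal X^{DA}$ the element has left idempotent $\mathbf I_{\mathbf x}$ and right idempotent $\mathbf I_{\mathbf y}$, while in $\mathcal X^{DD}$ the element of the same name has first idempotent $\mathbf I_{\mathbf x}$ and second idempotent $\mathbf I_{\mathbf y'}$ with $\mathbf y'=\{0,1,2\}\setminus\mathbf y$: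 * $z_1=S^-_t,z_2=S^-_b,z_3=S^+_b,z_4=S^+_t$, all $(\varnothing|\varnothing)$; * $x_1=S^-_t\,(A|A)$, $x_2=S^-_t\,(C|C)$, $x_3=W_t\,(B|A)$, $x_4=S^-_b\,(A|A)$, $x_5=S^-_b\,(C|C)$, $x_6=E_b\,(B|C)$, $x_7=W_b\,(B|A)$, $x_8=S^+_b\,(A|A)$, $x_9=S^+_b\,(C|C)$, $x_{10}=E_t\,(B|C)$, $x_{11}=S^+_t\,(A|A)$, $x_{12}=S^+_t\,(C|C)$; * $y_1=S^-_t\,(AC|AC)$, $y_2=W_t\,(BC|AC)$, $y_3=S^-_b\,(AC|AC)$, $y_4=E_b\,(AB|AC)$, $y_5=W_b\,(BC|AC)$, $y_6=S^+_b\,(AC|AC)$, $y_7=E_t\,(AB|AC)$, $y_8=S^+_t\,(AC|AC)$. Degrees by type (homological; Alexander), in both: $S^-_t:(1;0)$, $W_t:(0;\beta_1)$, $S^-_b:(0;\tau_2+\beta_2)$, $E_b:(0;\tau_2)$, $W_b:(-1;\tau_2+\beta_1+\beta_2)$, $S^+_b:(-1;\tau_2+\beta_2)$, $E_t:(-1;\tau_1+\tau_2+\beta_1)$, $S^+_t:(-2;\tau_1+\tau_2+\beta_1+\beta_2)$. *Operations on $\mathcal X^{DA}$* (on basis inputs; values not listed are zero; a coefficient $1$ is the appropriate idempotent). $\delta^1_2(x\otimes\mathbf I')=\mathbf I\otimes x$ for $\mathbf I,\mathbf I'$ the idempotents of $x$, and no other nonzero operation has an idempotent input or is a $\delta^1_2$.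 $\delta^1_1$: $z_3\mapsto z_2$; $x_3\mapsto L_1x_1$; $x_5\mapsto U_2x_2$; $x_6\mapsto R_2x_2$; $x_7\mapsto U_2x_3+L_1x_4$; $x_8\mapsto x_4$; $x_9\mapsto x_5+L_2x_6$; $x_{10}\mapsto U_1x_6$; $x_{11}\mapsto R_1x_7+U_1x_8$; $x_{12}\mapsto L_2x_{10}$; $y_2\mapsto L_1y_1$; $y_3\mapsto U_2y_1$; $y_4\mapsto R_2y_1$; $y_5\mapsto U_2y_2+L_1y_3$; $y_6\mapsto y_3+L_2y_4$; $y_7\mapsto R_2R_1y_2+U_1y_4$; $y_8\mapsto R_1y_5+U_1y_6+L_2y_7$. $\delta^1_3$, inputs $(R_1,R_2)$: $x_1\mapsto R_1x_6$; $x_3\mapsto x_{10}$; $x_7\mapsto R_2x_{12}$. Inputs $(L_2,L_1)$: $x_2\mapsto L_2x_3$; $x_5\mapsto L_2x_7$; $x_6\mapsto x_7+L_1x_8$; $x_{10}\mapsto L_1x_{11}$. Inputs any pair in $P=\{(U_1,U_2),(L_2U_1,R_2),(R_1,L_1U_2)\}$: $y_1\mapsto R_1U_2y_2+L_2U_1y_4$; $y_2\mapsto L_1L_2y_7$; $y_3\mapsto R_1U_2y_5+U_1U_2y_6$; $y_4\mapsto R_2R_1y_5+R_2U_1y_6$; $y_5\mapsto L_1U_2y_8$; $y_7\mapsto R_2U_1y_8$. $\delta^1_4$, inputs $(R_1,U_2,L_1)$: $x_1\mapsto R_1x_7+U_1x_8$; $x_3\mapsto L_1x_{11}$; $y_1\mapsto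 R_1y_5+U_1y_6$; $y_2\mapsto L_1y_8$. Inputs $(L_2,U_1,R_2)$: $x_2\mapsto L_2x_{10}$; $x_5\mapsto U_2x_{12}$; $x_6\mapsto R_2x_{12}$; $y_1\mapsto L_2y_7$; $y_3\mapsto U_2y_8$; $y_4\mapsto R_2y_8$. $\delta^1_5$, inputs $(p_1,p_2,q_1,q_2)$ with $(p_1,p_2),(q_1,q_2)\in P$: $y_1\mapsto U_1U_2y_8$. *Operation on $\mathcal X^{DD}$* (zero on basis elements not listed): $z_3\mapsto(1\otimes1)z_2$; $x_1\mapsto(R_1\otimes L_1L_2)x_6+(R_1\otimes U_1C_2)x_7+(U_1\otimes U_1C_2)x_8$; $x_2\mapsto(L_2\otimes R_2R_1)x_3+(L_2\otimes C_1U_2)x_{10}$; $x_3\mapsto(L_1\otimes1)x_1+(1\otimes L_1L_2)x_{10}+(L_1\otimes U_1C_2)x_{11}$; $x_5\mapsto(U_2\otimes1)x_2+(L_2\otimes R_2R_1)x_7+(U_2\otimes C_1U_2)x_{12}$; $x_6\mapsto(R_2\otimes1)x_2+(1\otimes R_2R_1)x_7+(L_1\otimes R_2R_1)x_8+(R_2\otimes C_1U_2)x_{12}$; $x_7\mapsto(U_2\otimes1)x_3+(L_1\otimes1)x_4+(R_2\otimes L_1L_2)x_{12}$; $x_8\mapsto(1\otimes1)x_4$; $x_9\mapsto(1\otimes1)x_5+(L_2\otimes1)x_6$; $x_{10}\mapsto(U_1\otimes1)x_6+(L_1\otimes R_2R_1)x_{11}$; $x_{11}\mapsto(R_1\otimes1)x_7+(U_1\otimes1)x_8$;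 $x_{12}\mapsto(L_2\otimes1)x_{10}$; $y_1\mapsto(R_1U_2\otimes C_1C_2)y_2+(L_2U_1\otimes C_1C_2)y_4+(R_1\otimes U_1C_2)y_5+(U_1\otimes U_1C_2)y_6+(L_2\otimes C_1U_2)y_7$; $y_2\mapsto(L_1\otimes1)y_1+(L_1L_2\otimes C_1C_2)y_7+(L_1\otimes U_1C_2)y_8$; $y_3\mapsto(U_2\otimes1)y_1+(R_1U_2\otimes C_1C_2)y_5+(U_1U_2\otimes C_1C_2)y_6+(U_2\otimes C_1U_2)y_8$; $y_4\mapsto(R_2\otimes1)y_1+(R_2R_1\otimes C_1C_2)y_5+(R_2U_1\otimes C_1C_2)y_6+(R_2\otimes C_1U_2)y_8$; $y_5\mapsto(U_2\otimes1)y_2+(L_1\otimes1)y_3+(L_1U_2\otimes C_1C_2)y_8$; $y_6\mapsto(1\otimes1)y_3+(L_2\otimes1)y_4$; $y_7\mapsto(R_2R_1\otimes1)y_2+(U_1\otimes1)y_4+(R_2U_1\otimes C_1C_2)y_8$; $y_8\mapsto(R_1\otimes1)y_5+(U_1\otimes1)y_6+(L_2\otimes1)y_7$. **Simplified versions.** $\widetilde{\mathcal X}^{DA}$ and $\widetilde{\mathcal X}^{DD}$ have basis $z_1,z_4$; $x_1,x_2,x_3,x_6,x_7,x_{10},x_{11},x_{12}$; $y_1,y_2,y_4,y_5,y_7,y_8$ (same idempotents and degrees). Their operations are obtained from those above by deleting all terms starting from or ending at a deleted basis element ($z_2,z_3,x_4,x_5,x_8,x_9,y_3,y_6$), and adding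 the single new term $L_1L_2\otimes y_4$ to $\delta^1_1(y_5)$ in $\widetilde{\mathcal X}^{DA}$, respectively $(L_1L_2\otimes1)\otimes y_4$ to $\delta^1(y_5)$ in $\widetilde{\mathcal X}^{DD}$. *)

theory Defs
  imports Complex_Main "HOL-Library.Poly_Mapping" "HOL-Library.Z2" "HOL-Library.Product_Plus"
begin

section \<open>Linear algebra over the field with two elements\<close>

class f2_space = ab_group_add +
  assumes f2_add_self: "x + x = 0"
begin

lemma f2_minus: "- x = x"
  by (metis f2_add_self minus_unique)

lemma f2_diff: "x - y = x + y"
  by (simp only: diff_conv_add_uminus f2_minus)

lemma f2_add_telescope: "a + b = (a + c) + (c + b)"
proof -
  have "(a + c) + (c + b) = a + ((c + c) + b)" by (simp only: add.assoc)
  then show ?thesis by (simp add: f2_add_self)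
qed

end

instance bit :: f2_space
  by standard simp

instance poly_mapping :: (type, f2_space) f2_space
  by standard (simp add: poly_mapping_eq_iff plus_poly_mapping.rep_eq f2_add_self fun_eq_iff)

definition f2_scale :: "bit \<Rightarrow> 'a::f2_space \<Rightarrow> 'a" where
  "f2_scale c x = (if c = 1 then x else 0)"

global_interpretation F2: vector_space "f2_scale :: bit \<Rightarrow> 'a::f2_space \<Rightarrow> 'a"
proof
  fix a b :: bit and x :: 'a
  show "f2_scale (a + b) x = f2_scale a x + f2_scale b x"
    by (cases a; cases b) (simp_all add: f2_scale_def f2_add_self)
qed (auto simp: f2_scale_def)

text \<open>\<^typ>\<open>'k \<Rightarrow>\<^sub>0 bit\<close> is the free vector space on \<^typ>\<open>'k\<close>; the linear extension of a map
  \<open>f\<close> defined on the basis is\<close>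

definition lin :: "('k \<Rightarrow> 'v::f2_space) \<Rightarrow> ('k \<Rightarrow>\<^sub>0 bit) \<Rightarrow> 'v" where
  "lin f p = (\<Sum>k\<in>Poly_Mapping.keys p. f k)"

abbreviation gen :: "'k \<Rightarrow> 'k \<Rightarrow>\<^sub>0 bit" where
  "gen k \<equiv> Poly_Mapping.single k 1"

lemma lin_zero [simp]: "lin f 0 = 0"
  by (simp add: lin_def)

lemma lin_gen [simp]: "lin f (gen k) = f k"
  by (simp add: lin_def)

lemma lin_superset:
  assumes "finite A" "Poly_Mapping.keys p \<subseteq> A"
  shows "lin f p = (\<Sum>k\<in>A. f2_scale (Poly_Mapping.lookup p k) (f k))"
proof -
  have "(\<Sum>k\<in>A. f2_scale (Poly_Mapping.lookup p k) (f k))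
      = (\<Sum>k\<in>Poly_Mapping.keys p. f2_scale (Poly_Mapping.lookup p k) (f k))"
    using assms by (intro sum.mono_neutral_right) (auto simp: in_keys_iff f2_scale_def)
  also have "\<dots> = lin f p"
    unfolding lin_def by (intro sum.cong) (auto simp: in_keys_iff f2_scale_def)
  finally show ?thesis by simp
qed

lemma lin_add: "lin f (p + q) = lin f p + lin f q"
proof -
  let ?A = "Poly_Mapping.keys p \<union> Poly_Mapping.keys q"
  have A: "finite ?A" "Poly_Mapping.keys p \<subseteq> ?A" "Poly_Mapping.keys q \<subseteq> ?A"
    "Poly_Mapping.keys (p + q) \<subseteq> ?A"
    using Poly_Mapping.keys_add[of p q] by auto
  show ?thesis
    unfolding lin_superset[OF A(1) A(2)] lin_superset[OF A(1) A(3)] lin_superset[OF A(1) A(4)]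
      lookup_add F2.scale_left_distrib sum.distrib ..
qed

lemma free_induct [case_names zero gen add]:
  fixes p :: "'k \<Rightarrow>\<^sub>0 bit"
  assumes "P 0" "\<And>k. P (gen k)" "\<And>p q. P p \<Longrightarrow> P q \<Longrightarrow> P (p + q)"
  shows "P p"
proof (induction p rule: Poly_Mapping.update_induct)
  case const
  then show ?case by (rule assms(1))
next
  case (update p k b)
  then have b: "b = 1" by (simp only: bit_not_zero_iff)
  have "Poly_Mapping.update k b p = p + gen k"
    using update(1) unfolding b
    by (intro poly_mapping_eqI) (auto simp: lookup_update lookup_add lookup_single in_keys_iff when_def)
  moreover have "P (p + gen k)" by (rule assms(3)[OF update.IH assms(2)])
  ultimately show ?case by (simp only:)
qed

lemma lin_add_fun: "lin (\<lambda>k. f k + g k) p = lin f p + lin g p"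
  by (simp add: lin_def sum.distrib)

lemma lin_const_zero [simp]: "lin (\<lambda>k. 0) p = 0"
  by (simp add: lin_def)

lemma lin_additive_comp:
  assumes "F 0 = 0" "\<And>p q. F (p + q) = F p + F q"
  shows "F (lin f p) = lin (\<lambda>k. F (f k)) p"
  by (induction p rule: free_induct) (simp_all add: assms lin_add)

lemma span_additive:
  assumes "x \<in> F2.span S" "F 0 = 0" "\<And>p q. F (p + q) = F p + F q" "\<And>s. s \<in> S \<Longrightarrow> F s \<in> F2.span T"
  shows "F x \<in> F2.span T"
  using assms(1)
proof (induction x rule: F2.span_induct_alt)
  case base
  then show ?case using assms(2) by (simp add: F2.span_zero)
next
  case (step c x y)
  have "f2_scale c x = 0 \<or> f2_scale c x = x" by (simp add: f2_scale_def)
  then show ?case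
    using assms(3) assms(4)[OF step(1)] step by (metis F2.span_add add_0)
qed

class f2_algebra = f2_space + ring + monoid_mult

class f2_dga = f2_algebra +
  fixes dif :: "'a \<Rightarrow> 'a"
  assumes dif_add: "dif (x + y) = dif x + dif y"
    and dif_mult: "dif (x * y) = dif x * y + x * dif y"
    and dif_dif: "dif (dif x) = 0"
begin

lemma dif_zero [simp]: "dif 0 = 0"
  using dif_add[of 0 0] by simp

end


section \<open>Tensor products over the field with two elements\<close>

definition tensor_rels :: "('a::f2_space \<times> 'b::f2_space \<Rightarrow>\<^sub>0 bit) set" where
  "tensor_rels =
     {gen (a + a', b) - gen (a, b) - gen (a', b) |a a' b. True} \<union>
     {gen (a, b + b') - gen (a, b) - gen (a, b') |a b b'. True}"

definition tensor_eq ::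
    "('a::f2_space \<times> 'b::f2_space \<Rightarrow>\<^sub>0 bit) \<Rightarrow> ('a \<times> 'b \<Rightarrow>\<^sub>0 bit) \<Rightarrow> bool" where
  "tensor_eq p q \<longleftrightarrow> p - q \<in> F2.span tensor_rels"

lemma equivp_span_diff: "equivp (\<lambda>p q. p - q \<in> F2.span S)"
proof (intro equivpI reflpI sympI transpI)
  fix x y z :: 'a
  show "x - x \<in> F2.span S" by (simp add: F2.span_zero)
  show "y - x \<in> F2.span S" if "x - y \<in> F2.span S"
    using F2.span_neg[OF that] by simp
  show "x - z \<in> F2.span S" if "x - y \<in> F2.span S" "y - z \<in> F2.span S"
    using F2.span_add[OF that] by simp
qed

quotient_type (overloaded) ('a, 'b) tensor = "'a::f2_space \<times> 'b::f2_space \<Rightarrow>\<^sub>0 bit" / tensor_eq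
  unfolding tensor_eq_def[abs_def] by (rule equivp_span_diff)

lift_definition tens :: "'a::f2_space \<Rightarrow> 'b::f2_space \<Rightarrow> ('a, 'b) tensor"  (infixl "\<otimes>" 70)
  is "\<lambda>a b. gen (a, b)" .

text \<open>The linear map on the tensor product induced by a biadditive map \<open>f\<close>.  (It is evaluated on
  an arbitrary representative, hence meaningful only for biadditive \<open>f\<close>.)\<close>

definition tensor_lift ::
    "('a::f2_space \<Rightarrow> 'b::f2_space \<Rightarrow> 'c::f2_space) \<Rightarrow> ('a, 'b) tensor \<Rightarrow> 'c" where
  "tensor_lift f t = lin (\<lambda>(a, b). f a b) (rep_tensor t)"

lemma tensor_rels_left: "gen (a + a', b) + gen (a, b) + gen (a', b) \<in> F2.span tensor_rels"
  by (rule F2.span_base, unfold tensor_rels_def f2_diff) blast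

lemma tensor_rels_right: "gen (a, b + b') + gen (a, b) + gen (a, b') \<in> F2.span tensor_rels"
  by (rule F2.span_base, unfold tensor_rels_def f2_diff) blast

lemma tensor_rels_cases:
  assumes "r \<in> tensor_rels"
  obtains a a' b where "r = gen (a + a', b) + gen (a, b) + gen (a', b)"
  | a b b' where "r = gen (a, b + b') + gen (a, b) + gen (a, b')"
  using assms unfolding tensor_rels_def f2_diff by blast

instantiation tensor :: (f2_space, f2_space) f2_space
begin

lift_definition zero_tensor :: "('a, 'b) tensor" is 0 .

lift_definition plus_tensor :: "('a, 'b) tensor \<Rightarrow> ('a, 'b) tensor \<Rightarrow> ('a, 'b) tensor" is "(+)"
  unfolding tensor_eq_def f2_diff
  by (drule (1) F2.span_add) (simp only: ac_simps)

lift_definition minus_tensor :: "('a, 'b) tensor \<Rightarrow> ('a, 'b) tensor \<Rightarrow> ('a, 'b) tensor" is "(-)"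
  unfolding tensor_eq_def f2_diff
  by (drule (1) F2.span_add) (simp only: ac_simps)

lift_definition uminus_tensor :: "('a, 'b) tensor \<Rightarrow> ('a, 'b) tensor" is uminus
  unfolding tensor_eq_def by (simp add: f2_minus)

instance
  by standard
     (transfer, simp add: equivp_reflp[OF tensor_equivp] algebra_simps f2_add_self)+

end

definition raw_tensor_mult ::
    "('a::f2_algebra \<times> 'b::f2_algebra \<Rightarrow>\<^sub>0 bit) \<Rightarrow> ('a \<times> 'b \<Rightarrow>\<^sub>0 bit) \<Rightarrow> ('a \<times> 'b \<Rightarrow>\<^sub>0 bit)" where
  "raw_tensor_mult p q = lin (\<lambda>(a, b). lin (\<lambda>(a', b'). gen (a * a', b * b')) q) p"

definition raw_tensor_dif ::
    "('a::f2_dga \<times> 'b::f2_dga \<Rightarrow>\<^sub>0 bit) \<Rightarrow> ('a \<times> 'b \<Rightarrow>\<^sub>0 bit)" where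
  "raw_tensor_dif p = lin (\<lambda>(a, b). gen (dif a, b) + gen (a, dif b)) p"

lemma raw_tensor_mult_zero [simp]: "raw_tensor_mult 0 q = 0" "raw_tensor_mult p 0 = 0"
  unfolding raw_tensor_mult_def case_prod_unfold by simp_all

lemma raw_tensor_mult_add_left:
    "raw_tensor_mult (p + p') q = raw_tensor_mult p q + raw_tensor_mult p' q"
  by (simp add: raw_tensor_mult_def lin_add)

lemma raw_tensor_mult_add_right:
    "raw_tensor_mult p (q + q') = raw_tensor_mult p q + raw_tensor_mult p q'"
  unfolding raw_tensor_mult_def case_prod_unfold lin_add lin_add_fun ..

lemma raw_tensor_mult_gen [simp]:
    "raw_tensor_mult (gen (a, b)) (gen (a', b')) = gen (a * a', b * b')"
  by (simp add: raw_tensor_mult_def)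

lemma raw_tensor_mult_assoc:
    "raw_tensor_mult (raw_tensor_mult p q) r = raw_tensor_mult p (raw_tensor_mult q r)"
proof (induction p rule: free_induct)
  case (gen k)
  show ?case
  proof (induction q rule: free_induct)
    case (gen l)
    show ?case
      by (induction r rule: free_induct)
         (cases k; cases l; auto simp: raw_tensor_mult_add_right mult.assoc)+
  qed (simp_all add: raw_tensor_mult_add_left raw_tensor_mult_add_right)
qed (simp_all add: raw_tensor_mult_add_left)

lemma raw_tensor_mult_one: "raw_tensor_mult (gen (1, 1)) p = p" "raw_tensor_mult p (gen (1, 1)) = p"
  by (induction p rule: free_induct)
     (auto simp: raw_tensor_mult_add_left raw_tensor_mult_add_right)

lemma raw_tensor_mult_span_left:
  assumes "x \<in> F2.span tensor_rels"
  shows "raw_tensor_mult x q \<in> F2.span tensor_rels"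
proof (induction q rule: free_induct)
  case (gen k)
  obtain a b where k: "k = (a, b)" by fastforce
  show ?case
  proof (rule span_additive[OF assms])
    fix r :: "'a \<times> 'b \<Rightarrow>\<^sub>0 bit" assume "r \<in> tensor_rels"
    then show "raw_tensor_mult r (gen k) \<in> F2.span tensor_rels"
      by (cases rule: tensor_rels_cases)
         (simp_all add: k raw_tensor_mult_add_left distrib_right tensor_rels_left tensor_rels_right)
  qed (simp_all add: raw_tensor_mult_add_left)
qed (simp_all add: F2.span_zero F2.span_add raw_tensor_mult_add_right)

lemma raw_tensor_mult_span_right:
  assumes "x \<in> F2.span tensor_rels"
  shows "raw_tensor_mult q x \<in> F2.span tensor_rels"
proof (induction q rule: free_induct)
  case (gen k)
  obtain a b where k: "k = (a, b)" by fastforce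
  show ?case
  proof (rule span_additive[OF assms])
    fix r :: "'a \<times> 'b \<Rightarrow>\<^sub>0 bit" assume "r \<in> tensor_rels"
    then show "raw_tensor_mult (gen k) r \<in> F2.span tensor_rels"
      by (cases rule: tensor_rels_cases)
         (simp_all add: k raw_tensor_mult_add_right distrib_left tensor_rels_left tensor_rels_right)
  qed (simp_all add: raw_tensor_mult_add_right)
qed (simp_all add: F2.span_zero F2.span_add raw_tensor_mult_add_left)

lemma raw_tensor_dif_add: "raw_tensor_dif (p + q) = raw_tensor_dif p + raw_tensor_dif q"
  by (simp add: raw_tensor_dif_def lin_add)

lemma raw_tensor_dif_zero [simp]: "raw_tensor_dif 0 = 0"
  by (simp add: raw_tensor_dif_def)

lemma raw_tensor_dif_gen [simp]: "raw_tensor_dif (gen (a, b)) = gen (dif a, b) + gen (a, dif b)"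
  by (simp add: raw_tensor_dif_def)

lemma raw_tensor_dif_span:
  assumes "x \<in> F2.span tensor_rels"
  shows "raw_tensor_dif x \<in> F2.span tensor_rels"
proof (rule span_additive[OF assms])
  fix r :: "'a \<times> 'b \<Rightarrow>\<^sub>0 bit" assume "r \<in> tensor_rels"
  then show "raw_tensor_dif r \<in> F2.span tensor_rels"
  proof (cases rule: tensor_rels_cases)
    case (1 a a' b)
    have "raw_tensor_dif r = (gen (dif a + dif a', b) + gen (dif a, b) + gen (dif a', b)) +
        (gen (a + a', dif b) + gen (a, dif b) + gen (a', dif b))"
      by (simp add: 1 raw_tensor_dif_add dif_add algebra_simps)
    then show ?thesis by (simp only: F2.span_add tensor_rels_left)
  next
    case (2 a b b')
    have "raw_tensor_dif r = (gen (dif a, b + b') + gen (dif a, b) + gen (dif a, b')) +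
        (gen (a, dif b + dif b') + gen (a, dif b) + gen (a, dif b'))"
      by (simp add: 2 raw_tensor_dif_add dif_add algebra_simps)
    then show ?thesis by (simp only: F2.span_add tensor_rels_right)
  qed
qed (simp_all add: raw_tensor_dif_add)

lemma tensor_eqI: "p + q \<in> F2.span tensor_rels \<Longrightarrow> tensor_eq p q"
  by (simp add: tensor_eq_def f2_diff)

instantiation tensor :: (f2_algebra, f2_algebra) f2_algebra
begin

lift_definition one_tensor :: "('a, 'b) tensor" is "gen (1, 1)" .

lift_definition times_tensor :: "('a, 'b) tensor \<Rightarrow> ('a, 'b) tensor \<Rightarrow> ('a, 'b) tensor"
  is raw_tensor_mult
proof -
  fix p p' q q' :: "'a \<times> 'b \<Rightarrow>\<^sub>0 bit"
  assume "tensor_eq p p'" "tensor_eq q q'"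
  then have *: "p + p' \<in> F2.span tensor_rels" "q + q' \<in> F2.span tensor_rels"
    by (simp_all add: tensor_eq_def f2_diff)
  have "raw_tensor_mult p q + raw_tensor_mult p' q' =
      raw_tensor_mult (p + p') q + raw_tensor_mult p' (q + q')"
    unfolding raw_tensor_mult_add_left raw_tensor_mult_add_right by (rule f2_add_telescope)
  then show "tensor_eq (raw_tensor_mult p q) (raw_tensor_mult p' q')"
    by (simp add: tensor_eqI * F2.span_add raw_tensor_mult_span_left raw_tensor_mult_span_right)
qed

instance
  by standard
     (transfer, simp add: equivp_reflp[OF tensor_equivp] raw_tensor_mult_assoc
        raw_tensor_mult_one raw_tensor_mult_add_left raw_tensor_mult_add_right)+

end

lemma tens_mult: "(a \<otimes> b) * (a' \<otimes> b') = (a * a') \<otimes> (b * b')"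
  by transfer (simp add: equivp_reflp[OF tensor_equivp])

lemma tens_add_left: "(a + a') \<otimes> b = a \<otimes> b + a' \<otimes> b"
  by transfer (rule tensor_eqI, simp only: tensor_rels_left flip: add.assoc)

lemma tens_add_right: "a \<otimes> (b + b') = a \<otimes> b + a \<otimes> b'"
  by transfer (rule tensor_eqI, simp only: tensor_rels_right flip: add.assoc)

lemma raw_tensor_dif_mult:
    "raw_tensor_dif (raw_tensor_mult p q) + (raw_tensor_mult (raw_tensor_dif p) q +
       raw_tensor_mult p (raw_tensor_dif q)) \<in> F2.span tensor_rels"
    (is "?E p q \<in> _")
proof (induction p rule: free_induct)
  case (gen k)
  obtain a b where k: "k = (a, b)" by fastforce
  show ?case
  proof (induction q rule: free_induct)
    case (gen l)
    obtain c d where l: "l = (c, d)" by fastforce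
    have "?E (gen k) (gen l) =
        (gen (dif a * c + a * dif c, b * d) + gen (dif a * c, b * d) + gen (a * dif c, b * d)) +
        (gen (a * c, dif b * d + b * dif d) + gen (a * c, dif b * d) + gen (a * c, b * dif d))"
      by (simp add: k l raw_tensor_mult_add_left raw_tensor_mult_add_right dif_mult algebra_simps)
    then show ?case by (simp only: F2.span_add tensor_rels_left tensor_rels_right)
  next
    case (add p q)
    have "?E (gen k) (p + q) = ?E (gen k) p + ?E (gen k) q"
      by (simp add: raw_tensor_mult_add_right raw_tensor_dif_add algebra_simps)
    then show ?case using add by (simp only: F2.span_add)
  qed (simp add: F2.span_zero)
next
  case (add p p')
  have "?E (p + p') q = ?E p q + ?E p' q"
    by (simp add: raw_tensor_mult_add_left raw_tensor_dif_add algebra_simps)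
  then show ?case using add by (simp only: F2.span_add)
qed (simp add: F2.span_zero)

lemma tensor_rels_zero: "gen (0, b) \<in> F2.span tensor_rels" "gen (a, 0) \<in> F2.span tensor_rels"
  using tensor_rels_left[of 0 0 b] tensor_rels_right[of a 0 0]
  by (simp_all add: f2_add_self)

lemma raw_tensor_dif_dif: "raw_tensor_dif (raw_tensor_dif p) \<in> F2.span tensor_rels"
proof (induction p rule: free_induct)
  case (gen k)
  obtain a b where k: "k = (a, b)" by fastforce
  have "raw_tensor_dif (raw_tensor_dif (gen k)) =
      gen (0, b) + gen (a, 0) + (gen (dif a, dif b) + gen (dif a, dif b))"
    by (simp add: k raw_tensor_dif_add dif_dif del: f2_add_self)
  then show ?case
    by (simp add: f2_add_self F2.span_add tensor_rels_zero)
qed (simp_all add: F2.span_zero F2.span_add raw_tensor_dif_add)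

instantiation tensor :: (f2_dga, f2_dga) f2_dga
begin

lift_definition dif_tensor :: "('a, 'b) tensor \<Rightarrow> ('a, 'b) tensor" is raw_tensor_dif
proof -
  fix p q :: "'a \<times> 'b \<Rightarrow>\<^sub>0 bit"
  assume "tensor_eq p q"
  then have "p + q \<in> F2.span tensor_rels" by (simp add: tensor_eq_def f2_diff)
  from raw_tensor_dif_span[OF this] show "tensor_eq (raw_tensor_dif p) (raw_tensor_dif q)"
    by (simp add: tensor_eqI raw_tensor_dif_add)
qed

instance
proof
  fix x y :: "('a, 'b) tensor"
  show "dif (x + y) = dif x + dif y"
    by transfer (simp add: raw_tensor_dif_add equivp_reflp[OF tensor_equivp])
  show "dif (x * y) = dif x * y + x * dif y"
    by transfer (rule tensor_eqI, rule raw_tensor_dif_mult)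
  show "dif (dif x) = 0"
    by transfer (simp add: tensor_eqI raw_tensor_dif_dif)
qed

end

lemma tens_dif: "dif (a \<otimes> b) = dif a \<otimes> b + a \<otimes> dif b"
  by transfer (simp add: equivp_reflp[OF tensor_equivp])


section \<open>Path algebras of quivers with relations\<close>

text \<open>All quivers below have the subsets of \<open>{0, 1, 2}\<close> as vertices, and at most one arrow with a
  given label starts at a given vertex; \<open>target l x\<close> is its end point, if it exists.\<close>

datatype pt = P0 | P1 | P2

type_synonym vertex = "pt set"

lemma UNIV_pt: "UNIV = {P0, P1, P2}"
  using pt.exhaust by auto

instance pt :: finite
  by standard (simp add: UNIV_pt)

text \<open>A degree \<open>(h, t1, b1, t2, b2)\<close> stands for homological degree \<open>h\<close> and Alexander degree
  \<open>t1 \<tau>\<^sub>1 + b1 \<beta>\<^sub>1 + t2 \<tau>\<^sub>2 + b2 \<beta>\<^sub>2\<close>.\<close>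

type_synonym degree = "int \<times> int \<times> int \<times> int \<times> int"

text \<open>A pair \<open>(x, ws)\<close> in \<open>relators\<close> stands for the relation saying that the sum of the paths which
  start at \<open>x\<close> and have the label sequences listed in \<open>ws\<close> vanishes.  The differential of a
  generator is either zero (\<open>None\<close>) or another generator.\<close>

class quiver =
  fixes target :: "'a \<Rightarrow> vertex \<Rightarrow> vertex option"
    and relators :: "(vertex \<times> 'a list list) set"
    and label_dif :: "'a \<Rightarrow> 'a option"
    and label_degree :: "'a \<Rightarrow> degree"
  assumes target_label_dif: "label_dif l = Some l' \<Longrightarrow> target l' x = target l x"
    and label_dif_dif: "label_dif l = Some l' \<Longrightarrow> label_dif l' = None"

primrec path_end :: "vertex \<Rightarrow> 'l::quiver list \<Rightarrow> vertex option" where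
  "path_end x [] = Some x"
| "path_end x (l # ls) = (case target l x of None \<Rightarrow> None | Some y \<Rightarrow> path_end y ls)"

typedef (overloaded) 'l path = "{(x, ls :: 'l::quiver list). path_end x ls \<noteq> None}"
  morphisms path_data Path
  by (rule exI[of _ "({}, [])"]) simp

type_synonym 'l path_algebra = "'l path \<Rightarrow>\<^sub>0 bit"

definition path :: "vertex \<Rightarrow> 'l::quiver list \<Rightarrow> 'l path_algebra" where
  "path x ls = (if path_end x ls = None then 0 else gen (Path (x, ls)))"

definition concat_paths :: "'l::quiver path \<Rightarrow> 'l path \<Rightarrow> 'l path_algebra" where
  "concat_paths p q =
     (case (path_data p, path_data q) of ((x, ls), (y, ms)) \<Rightarrow>
        if path_end x ls = Some y then path x (ls @ ms) else 0)"

definition path_mult :: "'l::quiver path_algebra \<Rightarrow> 'l path_algebra \<Rightarrow> 'l path_algebra" where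
  "path_mult p q = lin (\<lambda>s. lin (\<lambda>t. concat_paths s t) q) p"

definition path_one :: "'l::quiver path_algebra" where
  "path_one = (\<Sum>x\<in>UNIV. path x [])"

text \<open>The derivation of the path algebra extending \<open>label_dif\<close>.\<close>

definition path_dif :: "'l::quiver path_algebra \<Rightarrow> 'l path_algebra" where
  "path_dif = lin (\<lambda>s. case path_data s of (x, ls) \<Rightarrow>
     (\<Sum>k<length ls. (case label_dif (ls ! k) of None \<Rightarrow> 0 | Some l \<Rightarrow> path x (ls[k := l]))))"

definition relations :: "'l::quiver path_algebra set" where
  "relations = {(\<Sum>w\<leftarrow>ws. path x w) |x ws. (x, ws) \<in> relators}"

definition relation_ideal :: "'l::quiver path_algebra set" where
  "relation_ideal = F2.span {path_mult (path_mult p r) q |p r q. r \<in> relations}"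

class dg_quiver = quiver +
  assumes path_dif_relations: "r \<in> relations \<Longrightarrow> path_dif r \<in> relation_ideal"

lemma path_data_cases:
  obtains x ls y where "p = Path (x, ls)" "path_end x ls = Some y" "path_data p = (x, ls)"
  using path_data[of p] path_data_inverse[of p] by auto

lemma path_induct [case_names zero path add]:
  fixes p :: "'l::quiver path_algebra"
  assumes "P 0" "\<And>x ls y. path_end x ls = Some y \<Longrightarrow> P (path x ls)"
    "\<And>p q. P p \<Longrightarrow> P q \<Longrightarrow> P (p + q)"
  shows "P p"
proof (induction p rule: free_induct)
  case (gen k)
  obtain x ls y where k: "k = Path (x, ls)" "path_end x ls = Some y"
    by (rule path_data_cases)
  then have "gen k = path x ls" by (simp add: path_def)
  then show ?case using assms(2)[OF k(2)] by simp
qed (fact assms(1), rule assms(3))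

lemma path_end_append:
  "path_end x (ls @ ms) = (case path_end x ls of None \<Rightarrow> None | Some y \<Rightarrow> path_end y ms)"
  by (induction ls arbitrary: x) (auto split: option.split)

lemma path_data_Path: "path_end x ls = Some y \<Longrightarrow> path_data (Path (x, ls)) = (x, ls)"
  by (simp add: Path_inverse)

lemma path_mult_zero [simp]: "path_mult 0 q = 0" "path_mult p 0 = 0"
  by (simp_all add: path_mult_def)

lemma path_mult_add_left: "path_mult (p + p') q = path_mult p q + path_mult p' q"
  by (simp add: path_mult_def lin_add)

lemma path_mult_add_right: "path_mult p (q + q') = path_mult p q + path_mult p q'"
  by (simp add: path_mult_def lin_add lin_add_fun)

lemma path_mult_sum_left: "path_mult (\<Sum>i\<in>I. f i) q = (\<Sum>i\<in>I. path_mult (f i) q)"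
  by (induction I rule: infinite_finite_induct) (simp_all add: path_mult_add_left)

lemma path_mult_sum_right: "path_mult p (\<Sum>i\<in>I. f i) = (\<Sum>i\<in>I. path_mult p (f i))"
  by (induction I rule: infinite_finite_induct) (simp_all add: path_mult_add_right)

lemma path_mult_path:
  "path_mult (path x ls) (path y ms) = (if path_end x ls = Some y then path x (ls @ ms) else 0)"
proof (cases "path_end x ls = None \<or> path_end y ms = None")
  case True
  then show ?thesis by (auto simp: path_def path_end_append split: option.split)
next
  case False
  then obtain x' y' where "path_end x ls = Some x'" "path_end y ms = Some y'" by auto
  then show ?thesis
    by (simp add: path_def[of x ls] path_def[of y ms] path_mult_def concat_paths_def path_data_Path)
qed

lemma path_mult_assoc: "path_mult (path_mult p q) r = path_mult p (path_mult q r)"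
proof (induction p rule: path_induct)
  case p: (path x ls x')
  show ?case
  proof (induction q rule: path_induct)
    case q: (path y ms y')
    show ?case
    proof (induction r rule: path_induct)
      case r: (path z ns z')
      from p q r show ?case by (simp add: path_mult_path path_end_append)
    qed (simp_all add: path_mult_add_right)
  qed (simp_all add: path_mult_add_left path_mult_add_right)
qed (simp_all add: path_mult_add_left)

lemma path_mult_one: "path_mult path_one p = p" "path_mult p path_one = p"
proof (induction p rule: path_induct)
  case (path x ls y)
  {
    case 1
    show ?case by (simp add: path_one_def path_mult_sum_left path_mult_path)
  next
    case 2
    from path show ?case by (simp add: path_one_def path_mult_sum_right path_mult_path)
  }
qed (simp_all add: path_mult_add_left path_mult_add_right)

lemma path_dif_zero [simp]: "path_dif 0 = 0"
  by (simp add: path_dif_def)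

lemma path_dif_add: "path_dif (p + q) = path_dif p + path_dif q"
  by (simp add: path_dif_def lin_add)

lemma path_dif_path:
  assumes "path_end x ls = Some y"
  shows "path_dif (path x ls) =
    (\<Sum>k<length ls. case label_dif (ls ! k) of None \<Rightarrow> 0 | Some l \<Rightarrow> path x (ls[k := l]))"
  using assms by (simp add: path_dif_def path_def[of x ls] path_data_Path)

lemma path_end_update:
  assumes "k < length ls" "label_dif (ls ! k) = Some l"
  shows "path_end x (ls[k := l]) = path_end x ls"
  using assms
proof (induction ls arbitrary: x k)
  case (Cons m ls)
  then show ?case
    by (cases k) (auto simp: target_label_dif split: option.split)
qed simp

lemma sum_lessThan_add:
  fixes f :: "nat \<Rightarrow> 'v::comm_monoid_add"
  shows "(\<Sum>k<m + n. f k) = (\<Sum>k<m. f k) + (\<Sum>k<n. f (m + k))"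
  by (induction n) (simp_all add: add.assoc)

lemma path_dif_mult: "path_dif (path_mult p q) = path_mult (path_dif p) q + path_mult p (path_dif q)"
proof (induction p rule: path_induct)
  case p: (path x ls x')
  show ?case
  proof (induction q rule: path_induct)
    case q: (path y ms y')
    have L: "path_mult (path_dif (path x ls)) (path y ms) =
        (\<Sum>k<length ls. case label_dif (ls ! k) of None \<Rightarrow> 0 |
           Some l \<Rightarrow> if x' = y then path x (ls[k := l] @ ms) else 0)"
      unfolding path_dif_path[OF p] path_mult_sum_left
      using p by (intro sum.cong) (auto simp: path_mult_path path_end_update split: option.split)
    have R: "path_mult (path x ls) (path_dif (path y ms)) =
        (\<Sum>k<length ms. case label_dif (ms ! k) of None \<Rightarrow> 0 |
           Some l \<Rightarrow> if x' = y then path x (ls @ ms[k := l]) else 0)"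
      unfolding path_dif_path[OF q] path_mult_sum_right
      using p by (intro sum.cong) (auto simp: path_mult_path split: option.split)
    show ?case
    proof (cases "x' = y")
      case True
      then have "path_end x (ls @ ms) = Some y'" using p q by (simp add: path_end_append)
      then have "path_dif (path x (ls @ ms)) =
          (\<Sum>k<length ls + length ms. case label_dif ((ls @ ms) ! k) of None \<Rightarrow> 0 |
             Some l \<Rightarrow> path x ((ls @ ms)[k := l]))"
        by (simp add: path_dif_path)
      also have "\<dots> = (\<Sum>k<length ls. case label_dif (ls ! k) of None \<Rightarrow> 0 |
             Some l \<Rightarrow> path x (ls[k := l] @ ms)) +
          (\<Sum>k<length ms. case label_dif (ms ! k) of None \<Rightarrow> 0 |
             Some l \<Rightarrow> path x (ls @ ms[k := l]))"
        unfolding sum_lessThan_add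
        by (intro arg_cong2[where f = plus] sum.cong) (simp_all add: nth_append list_update_append split: option.split)
      finally show ?thesis
        unfolding L R if_P[OF True] using p True by (simp add: path_mult_path)
    next
      case False
      have *: "(\<Sum>k<n. case g k of None \<Rightarrow> 0 | Some l \<Rightarrow> 0) = (0 :: 'a path_algebra)"
        for n and g :: "nat \<Rightarrow> 'a option"
        by (intro sum.neutral ballI) (simp split: option.split)
      show ?thesis
        unfolding L R if_not_P[OF False] * using p False by (simp add: path_mult_path)
    qed
  qed (simp_all add: path_mult_add_left path_mult_add_right path_dif_add algebra_simps)
qed (simp_all add: path_mult_add_left path_mult_add_right path_dif_add algebra_simps)

lemma path_dif_dif: "path_dif (path_dif p) = 0"
proof (induction p rule: path_induct)
  case (path x ls y)
  then show ?case
  proof (induction ls arbitrary: x)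
    case Nil
    then show ?case by (simp add: path_dif_path)
  next
    case (Cons l ls)
    then obtain z where z: "target l x = Some z" "path_end z ls = Some y"
      by (auto split: option.splits)
    have "path x (l # ls) = path_mult (path x [l]) (path z ls)"
      using z by (simp add: path_mult_path)
    moreover have "path_dif (path_dif (path x [l])) = 0"
    proof (cases "label_dif l")
      case None
      then show ?thesis using z by (simp add: path_dif_path)
    next
      case (Some l')
      then have "path_dif (path x [l]) = path x [l']" using z by (simp add: path_dif_path)
      moreover have "path_end x [l'] = Some z" using z target_label_dif[OF Some] by simp
      ultimately show ?thesis using label_dif_dif[OF Some] by (simp add: path_dif_path)
    qed
    ultimately show ?case
      using Cons.IH[OF z(2)]
      by (simp add: path_dif_mult path_dif_add f2_add_self)
  qed
qed (simp_all add: path_dif_add)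

lemma relation_ideal_mult_left:
  assumes "x \<in> relation_ideal" shows "path_mult p x \<in> relation_ideal"
  unfolding relation_ideal_def
proof (rule span_additive[OF assms[unfolded relation_ideal_def]])
  fix s :: "'a path_algebra" assume "s \<in> {path_mult (path_mult p r) q |p r q. r \<in> relations}"
  then obtain p' r q where "s = path_mult (path_mult p' r) q" "r \<in> relations" by auto
  then have "path_mult p s = path_mult (path_mult (path_mult p p') r) q" "r \<in> relations"
    by (simp_all only: path_mult_assoc)
  then show "path_mult p s \<in> F2.span {path_mult (path_mult p r) q |p r q. r \<in> relations}"
    by (intro F2.span_base) blast
qed (simp_all add: path_mult_add_right)

lemma relation_ideal_mult_right:
  assumes "x \<in> relation_ideal" shows "path_mult x q \<in> relation_ideal"
  unfolding relation_ideal_def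
proof (rule span_additive[OF assms[unfolded relation_ideal_def]])
  fix s :: "'a path_algebra" assume "s \<in> {path_mult (path_mult p r) q |p r q. r \<in> relations}"
  then obtain p r q' where "s = path_mult (path_mult p r) q'" "r \<in> relations" by auto
  then show "path_mult s q \<in> F2.span {path_mult (path_mult p r) q |p r q. r \<in> relations}"
    by (intro F2.span_base) (use path_mult_assoc[of "path_mult p r" q' q] in blast)
qed (simp_all add: path_mult_add_left)

lemma relation_ideal_add: "x \<in> relation_ideal \<Longrightarrow> y \<in> relation_ideal \<Longrightarrow> x + y \<in> relation_ideal"
  unfolding relation_ideal_def by (rule F2.span_add)

lemma relations_ideal: "r \<in> relations \<Longrightarrow> r \<in> relation_ideal"
  unfolding relation_ideal_def
  by (intro F2.span_base CollectI exI[of _ path_one] exI[of _ r]) (simp add: path_mult_one)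

lemma path_dif_ideal:
  fixes x :: "'l::dg_quiver path_algebra"
  assumes "x \<in> relation_ideal" shows "path_dif x \<in> relation_ideal"
  unfolding relation_ideal_def
proof (rule span_additive[OF assms[unfolded relation_ideal_def]])
  fix s :: "'l path_algebra" assume "s \<in> {path_mult (path_mult p r) q |p r q. r \<in> relations}"
  then obtain p r q where s: "s = path_mult (path_mult p r) q" and r: "r \<in> relations" by auto
  note I = relation_ideal_mult_left relation_ideal_mult_right relation_ideal_add
  have "path_dif s \<in> relation_ideal"
    unfolding s path_dif_mult path_mult_add_left
    by (intro I path_dif_relations[OF r] relations_ideal[OF r])
  then show "path_dif s \<in> F2.span {path_mult (path_mult p r) q |p r q. r \<in> relations}"
    by (simp only: relation_ideal_def)
qed (simp_all add: path_dif_add)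

definition quotient_eq :: "'l::quiver path_algebra \<Rightarrow> 'l path_algebra \<Rightarrow> bool" where
  "quotient_eq p q \<longleftrightarrow> p - q \<in> relation_ideal"

quotient_type (overloaded) 'l quiver_algebra = "'l::quiver path_algebra" / quotient_eq
  unfolding quotient_eq_def[abs_def] relation_ideal_def by (rule equivp_span_diff)

lemma quotient_eqI: "p + q \<in> relation_ideal \<Longrightarrow> quotient_eq p q"
  by (simp add: quotient_eq_def f2_diff)

lemma quotient_eqD: "quotient_eq p q \<Longrightarrow> p + q \<in> relation_ideal"
  by (simp add: quotient_eq_def f2_diff)

instantiation quiver_algebra :: (quiver) f2_algebra
begin

lift_definition zero_quiver_algebra :: "'a quiver_algebra" is 0 .

lift_definition one_quiver_algebra :: "'a quiver_algebra" is path_one .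

lift_definition plus_quiver_algebra :: "'a quiver_algebra \<Rightarrow> 'a quiver_algebra \<Rightarrow> 'a quiver_algebra"
  is "(+)"
  unfolding quotient_eq_def f2_diff
  by (drule (1) relation_ideal_add) (simp only: ac_simps)

lift_definition minus_quiver_algebra :: "'a quiver_algebra \<Rightarrow> 'a quiver_algebra \<Rightarrow> 'a quiver_algebra"
  is "(-)"
  unfolding quotient_eq_def f2_diff
  by (drule (1) relation_ideal_add) (simp only: ac_simps)

lift_definition uminus_quiver_algebra :: "'a quiver_algebra \<Rightarrow> 'a quiver_algebra" is uminus
  unfolding quotient_eq_def by (simp add: f2_minus)

lift_definition times_quiver_algebra :: "'a quiver_algebra \<Rightarrow> 'a quiver_algebra \<Rightarrow> 'a quiver_algebra"
  is path_mult
proof (rule quotient_eqI)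
  fix p p' q q' :: "'a path_algebra"
  assume *: "quotient_eq p p'" "quotient_eq q q'"
  have "path_mult p q + path_mult p' q' = path_mult (p + p') q + path_mult p' (q + q')"
    unfolding path_mult_add_left path_mult_add_right by (rule f2_add_telescope)
  also have "\<dots> \<in> relation_ideal"
    by (intro relation_ideal_add relation_ideal_mult_left relation_ideal_mult_right quotient_eqD *)
  finally show "path_mult p q + path_mult p' q' \<in> relation_ideal" .
qed

instance
  by standard
     (transfer, simp add: equivp_reflp[OF quiver_algebra_equivp] algebra_simps f2_add_self
        path_mult_assoc path_mult_one path_mult_add_left path_mult_add_right)+

end

instantiation quiver_algebra :: (dg_quiver) f2_dga
begin

lift_definition dif_quiver_algebra :: "'a quiver_algebra \<Rightarrow> 'a quiver_algebra" is path_dif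
  using path_dif_ideal by (metis quotient_eqI quotient_eqD path_dif_add)

instance
  by standard
     (transfer, simp add: equivp_reflp[OF quiver_algebra_equivp] path_dif_add path_dif_mult
        path_dif_dif)+

end

lift_definition path_class :: "vertex \<Rightarrow> 'l::quiver list \<Rightarrow> 'l quiver_algebra" is path .

abbreviation idem :: "vertex \<Rightarrow> 'l::quiver quiver_algebra" where
  "idem x \<equiv> path_class x []"

text \<open>The sum of all arrows with a given label (\<^const>\<open>path_class\<close> is zero if there is no such arrow
  at \<open>x\<close>), and products of such sums; the empty product is \<open>1\<close>.\<close>

definition label_sum :: "'l::quiver \<Rightarrow> 'l quiver_algebra" where
  "label_sum l = (\<Sum>x\<in>UNIV. path_class x [l])"

definition word :: "'l::quiver list \<Rightarrow> 'l quiver_algebra" where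
  "word ls = prod_list (map label_sum ls)"


section \<open>The algebras \<open>B(2)\<close> and \<open>B\<^sup>!(2)\<close>\<close>

datatype idx = One | Two

lemma UNIV_idx: "UNIV = {One, Two}"
  using idx.exhaust by auto

instance idx :: finite
  by standard (simp add: UNIV_idx)

text \<open>\<open>lo i\<close> and \<open>hi i\<close> are the elements \<open>i - 1\<close> and \<open>i\<close> of \<open>{0, 1, 2}\<close>.\<close>

primrec lo :: "idx \<Rightarrow> pt" where "lo One = P0" | "lo Two = P1"
primrec hi :: "idx \<Rightarrow> pt" where "hi One = P1" | "hi Two = P2"

datatype b_label = R idx | L idx | U idx

datatype s_label = Old b_label | C idx

primrec b_target :: "b_label \<Rightarrow> vertex \<Rightarrow> vertex option" where
  "b_target (R i) x = (if x \<inter> {lo i, hi i} = {lo i} then Some (insert (hi i) (x - {lo i})) else None)"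
| "b_target (L i) x = (if x \<inter> {lo i, hi i} = {hi i} then Some (insert (lo i) (x - {hi i})) else None)"
| "b_target (U i) x = Some x"

primrec s_target :: "s_label \<Rightarrow> vertex \<Rightarrow> vertex option" where
  "s_target (Old l) x = b_target l x"
| "s_target (C i) x = Some x"

text \<open>The relations common to both algebras, for a label type into which \<^typ>\<open>b_label\<close> is
  embedded by \<open>e\<close> and whose arrows are described by \<open>tgt\<close>.\<close>

definition common_relators ::
    "(b_label \<Rightarrow> 'l) \<Rightarrow> ('l \<Rightarrow> vertex \<Rightarrow> vertex option) \<Rightarrow> (vertex \<times> 'l list list) set" where
  "common_relators e tgt =
     {(x, [[e (U i), l], [l, e (U i)]]) |x i l. tgt l x \<noteq> None} \<union>
     {(x, [[e (R i), e (L i)], [e (U i)]]) |x i. tgt (e (R i)) x \<noteq> None} \<union>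
     {(x, [[e (L i), e (R i)], [e (U i)]]) |x i. tgt (e (L i)) x \<noteq> None} \<union>
     {(x, [[e (R One), e (R Two)]]) |x. True} \<union>
     {(x, [[e (L Two), e (L One)]]) |x. True} \<union>
     {(x, [[e (U i)]]) |x i. x \<inter> {lo i, hi i} = {}}"

definition s_relators :: "(vertex \<times> s_label list list) set" where
  "s_relators = common_relators Old s_target \<union>
     {(x, [[C i, C i]]) |x i. True} \<union>
     {(x, [[C i, l], [l, C i]]) |x i l. s_target l x \<noteq> None}"

primrec s_label_dif :: "s_label \<Rightarrow> s_label option" where
  "s_label_dif (Old l) = None"
| "s_label_dif (C i) = Some (Old (U i))"

text \<open>The generators \<open>\<tau>\<^sub>i\<close> and \<open>\<beta>\<^sub>i\<close> of the Alexander grading group, in homological degree 0.\<close>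

primrec \<tau> :: "idx \<Rightarrow> degree" where
  "\<tau> One = (0, 1, 0, 0, 0)" | "\<tau> Two = (0, 0, 0, 1, 0)"
primrec \<beta> :: "idx \<Rightarrow> degree" where
  "\<beta> One = (0, 0, 1, 0, 0)" | "\<beta> Two = (0, 0, 0, 0, 1)"

definition hdeg :: "int \<Rightarrow> degree" where
  "hdeg n = (n, 0, 0, 0, 0)"

primrec b_degree :: "b_label \<Rightarrow> degree" where
  "b_degree (R i) = \<tau> i"
| "b_degree (L i) = \<beta> i"
| "b_degree (U i) = \<tau> i + \<beta> i"

primrec s_degree_old :: "b_label \<Rightarrow> degree" where
  "s_degree_old (R i) = hdeg 1 - \<beta> i"
| "s_degree_old (L i) = hdeg 1 - \<tau> i"
| "s_degree_old (U i) = hdeg 2 - \<tau> i - \<beta> i"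

primrec s_degree :: "s_label \<Rightarrow> degree" where
  "s_degree (Old l) = s_degree_old l"
| "s_degree (C i) = hdeg 1 - \<tau> i - \<beta> i"

instantiation b_label :: quiver
begin
definition target_b_label :: "b_label \<Rightarrow> vertex \<Rightarrow> vertex option" where "target_b_label = b_target"
definition relators_b_label :: "(vertex \<times> b_label list list) set" where
  "relators_b_label = common_relators (\<lambda>l. l) b_target"
definition label_dif_b_label :: "b_label \<Rightarrow> b_label option" where "label_dif_b_label l = None"
definition label_degree_b_label :: "b_label \<Rightarrow> degree" where "label_degree_b_label = b_degree"
instance by standard (simp_all add: label_dif_b_label_def)
end

instantiation s_label :: quiver
begin
definition target_s_label :: "s_label \<Rightarrow> vertex \<Rightarrow> vertex option" where "target_s_label = s_target"
definition relators_s_label :: "(vertex \<times> s_label list list) set" where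
  "relators_s_label = s_relators"
definition label_dif_s_label :: "s_label \<Rightarrow> s_label option" where "label_dif_s_label = s_label_dif"
definition label_degree_s_label :: "s_label \<Rightarrow> degree" where "label_degree_s_label = s_degree"
instance
proof
  fix l l' :: s_label and x
  assume "label_dif l = Some l'"
  then obtain i where "l = C i" "l' = Old (U i)"
    by (cases l) (simp_all add: label_dif_s_label_def)
  then show "target l' x = target l x" "label_dif l' = None"
    by (simp_all add: target_s_label_def label_dif_s_label_def)
qed
end

lemma relation_ideal_zero [simp]: "0 \<in> relation_ideal"
  by (simp add: relation_ideal_def F2.span_zero)

lemma path_undefined: "path_end x ls = None \<Longrightarrow> path x ls = 0"
  by (simp add: path_def)

instance b_label :: dg_quiver
proof
  have "path_dif p = 0" for p :: "b_label path_algebra"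
    by (induction p rule: path_induct)
       (simp_all add: path_dif_add path_dif_path label_dif_b_label_def)
  then show "path_dif r \<in> relation_ideal" for r :: "b_label path_algebra" by simp
qed

lemma relatorsI:
  assumes "(x, ws) \<in> relators" "p = (\<Sum>w\<leftarrow>ws. path x w)"
  shows "p \<in> relation_ideal"
  using assms by (intro relations_ideal) (auto simp: relations_def)

lemma path_dif_1:
  "path_dif (path x [l]) = (case label_dif l of None \<Rightarrow> 0 | Some l' \<Rightarrow> path x [l'])"
proof (cases "path_end x [l]")
  case None
  then show ?thesis
    by (auto simp: path_def target_label_dif split: option.split)
next
  case (Some y)
  show ?thesis
    unfolding path_dif_path[OF Some] by (simp add: lessThan_Suc split: option.split)
qed

lemma path_dif_2:
  "path_dif (path x [l, m]) =
    (case label_dif l of None \<Rightarrow> 0 | Some l' \<Rightarrow> path x [l', m]) +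
    (case label_dif m of None \<Rightarrow> 0 | Some m' \<Rightarrow> path x [l, m'])"
proof (cases "path_end x [l, m]")
  case None
  then show ?thesis
    by (auto simp: path_def target_label_dif split: option.splits)
next
  case (Some y)
  show ?thesis
    unfolding path_dif_path[OF Some] by (simp add: lessThan_Suc add.commute split: option.split)
qed

instance s_label :: dg_quiver
proof
  fix r :: "s_label path_algebra"
  assume "r \<in> relations"
  then obtain x ws where r: "r = (\<Sum>w\<leftarrow>ws. path x w)" and ws: "(x, ws) \<in> s_relators"
    by (auto simp: relations_def relators_s_label_def)
  have commute: "path x [Old (U i), l] + path x [l, Old (U i)] \<in> relation_ideal" for i l
  proof (cases "s_target l x")
    case None
    then show ?thesis by (simp add: path_def target_s_label_def)
  next
    case (Some y)
    then show ?thesis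
      by (intro relatorsI[of x "[[Old (U i), l], [l, Old (U i)]]"])
         (auto simp: relators_s_label_def s_relators_def common_relators_def)
  qed
  note D = r path_dif_add path_dif_1 path_dif_2 label_dif_s_label_def
  consider
      (common) i l where "ws = [[Old (U i), l], [l, Old (U i)]]"
    | (square) i where "ws = [[C i, C i]]"
    | (commute) i l where "ws = [[C i, l], [l, C i]]"
    | (old) "\<forall>w\<in>set ws. (\<exists>l. w = [Old l]) \<or> (\<exists>l m. w = [Old l, Old m])"
    using ws unfolding s_relators_def common_relators_def by (simp only: Un_iff) auto
  then show "path_dif r \<in> relation_ideal"
  proof cases
    case common
    then show ?thesis using commute[of i] by (cases l) (simp_all add: D)
  next
    case square
    then show ?thesis using commute[of i "C i"] by (simp add: D)
  next
    case commute: (commute i l)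
    show ?thesis
    proof (cases l)
      case (Old m)
      then show ?thesis using \<open>\<And>i l. path x [Old (U i), l] + _ \<in> _\<close>[of i l] commute
        by (simp add: D)
    next
      case (C j)
      then have "path_dif r = (path x [Old (U i), l] + path x [l, Old (U i)]) +
          (path x [Old (U j), C i] + path x [C i, Old (U j)])"
        using commute by (simp add: D ac_simps)
      then show ?thesis
        using \<open>\<And>i l. path x [Old (U i), l] + _ \<in> _\<close> by (simp only: relation_ideal_add)
    qed
  next
    case old
    then have "path_dif r = 0"
      unfolding r by (induction ws) (auto simp: D(2-))
    then show ?thesis by simp
  qed
qed

type_synonym B2 = "b_label quiver_algebra"
type_synonym B2_dual = "s_label quiver_algebra"
type_synonym BB = "(B2, B2_dual) tensor"

text \<open>The homogeneous part of degree \<open>g\<close> of \<open>B(2) \<otimes> B\<^sup>!(2)\<close>.\<close>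

definition path_degree :: "'l::quiver list \<Rightarrow> degree" where
  "path_degree ls = (\<Sum>l\<leftarrow>ls. label_degree l)"

definition homogeneous :: "degree \<Rightarrow> BB set" where
  "homogeneous g =
     F2.span {path_class x ls \<otimes> path_class y ms |x ls y ms. path_degree ls + path_degree ms = g}"


section \<open>\<open>DD\<close> bimodules, \<open>DA\<close> bimodules and the box tensor product\<close>

text \<open>A \<open>DD\<close> bimodule over \<open>(B(2), B\<^sup>!(2))\<close> is given by a finite homogeneous basis compatible with the
  idempotents (\<open>dd_idem1\<close> and \<open>dd_idem2\<close> record the idempotents of the basis elements) and the
  matrix of \<open>\<delta>\<^sup>1\<close>: \<open>\<delta>\<^sup>1(x) = \<Sum>y. dd_coef x y \<otimes> y\<close>, where \<open>dd_coef x y\<close> lies in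
  \<open>(I\<^sub>x\<^sub>1 \<otimes> I\<^sub>x\<^sub>2) (B(2) \<otimes> B\<^sup>!(2)) (I\<^sub>y\<^sub>1 \<otimes> I\<^sub>y\<^sub>2)\<close>.\<close>

record 'g dd =
  dd_gens :: "'g set"
  dd_idem1 :: "'g \<Rightarrow> vertex"
  dd_idem2 :: "'g \<Rightarrow> vertex"
  dd_degree :: "'g \<Rightarrow> degree"
  dd_coef :: "'g \<Rightarrow> 'g \<Rightarrow> BB"

abbreviation dd_idem :: "'g dd \<Rightarrow> 'g \<Rightarrow> BB" where
  "dd_idem X x \<equiv> idem (dd_idem1 X x) \<otimes> idem (dd_idem2 X x)"

definition dd_bimodule :: "'g dd \<Rightarrow> bool" where
  "dd_bimodule X \<longleftrightarrow>
     finite (dd_gens X) \<and>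
     (\<forall>x\<in>dd_gens X. \<forall>y\<in>dd_gens X.
        dd_idem X x * dd_coef X x y * dd_idem X y = dd_coef X x y \<and>
        dd_coef X x y \<in> homogeneous (dd_degree X x + hdeg 1 - dd_degree X y) \<and>
        dif (dd_coef X x y) + (\<Sum>z\<in>dd_gens X. dd_coef X x z * dd_coef X z y) = 0)"

text \<open>The linear extension of a map \<open>\<phi>\<close> between the bases is an isomorphism of \<open>DD\<close> bimodules: a
  bijective \<open>I(2) \<otimes> I(2)\<close>-linear map which preserves degrees and satisfies
  \<open>\<delta>\<^sup>1 \<circ> \<phi> = (id \<otimes> \<phi>) \<circ> \<delta>\<^sup>1\<close>.\<close>

definition dd_isomorphism :: "'g dd \<Rightarrow> 'h dd \<Rightarrow> ('g \<Rightarrow> 'h) \<Rightarrow> bool" where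
  "dd_isomorphism X Y \<phi> \<longleftrightarrow>
     dd_bimodule X \<and> dd_bimodule Y \<and>
     bij_betw \<phi> (dd_gens X) (dd_gens Y) \<and>
     (\<forall>x\<in>dd_gens X. dd_idem1 Y (\<phi> x) = dd_idem1 X x \<and> dd_idem2 Y (\<phi> x) = dd_idem2 X x \<and>
        dd_degree Y (\<phi> x) = dd_degree X x) \<and>
     (\<forall>x\<in>dd_gens X. \<forall>y\<in>dd_gens X. dd_coef Y (\<phi> x) (\<phi> y) = dd_coef X x y)"

text \<open>The data of a \<open>DA\<close> bimodule over \<open>(B(2), B(2))\<close>, again in terms of a basis:
  \<open>\<delta>\<^sup>1\<^sub>j (x \<otimes> a\<^sub>1 \<otimes> \<dots> \<otimes> a\<^bsub>j-1\<^esub>) = \<Sum>y. da_op x [a\<^sub>1, \<dots>, a\<^bsub>j-1\<^esub>] y \<otimes> y\<close>.  The \<open>DA\<close> relations do not enter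
  the definition of the box tensor product with a \<open>DD\<close> bimodule.\<close>

record 'g da =
  da_gens :: "'g set"
  da_left :: "'g \<Rightarrow> vertex"
  da_right :: "'g \<Rightarrow> vertex"
  da_degree :: "'g \<Rightarrow> degree"
  da_op :: "'g \<Rightarrow> B2 list \<Rightarrow> 'g \<Rightarrow> B2"

text \<open>The numbers \<open>j - 1\<close> of algebra inputs for which \<open>\<delta>\<^sup>1\<^sub>j\<close> does not vanish.\<close>

definition da_arities :: "'g da \<Rightarrow> nat set" where
  "da_arities X = {n. \<exists>x\<in>da_gens X. \<exists>y\<in>da_gens X. \<exists>as. length as = n \<and> da_op X x as y \<noteq> 0}"

text \<open>The matrix entry of the iterate \<open>\<delta>\<^sup>n\<close> of a \<open>DD\<close> bimodule from \<open>k\<close> to \<open>k'\<close> is the sum over all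
  chains \<open>k = k\<^sub>0, \<dots>, k\<^sub>n = k'\<close> of basis elements of the tensor products
  \<open>dd_coef k\<^sub>0 k\<^sub>1 \<otimes> \<dots> \<otimes> dd_coef k\<^bsub>n-1\<^esub> k\<^sub>n\<close>.\<close>

definition dd_chains :: "'k dd \<Rightarrow> nat \<Rightarrow> 'k \<Rightarrow> 'k \<Rightarrow> 'k list set" where
  "dd_chains K n k k' =
     {ks. length ks = Suc n \<and> set ks \<subseteq> dd_gens K \<and> hd ks = k \<and> last ks = k'}"

definition chain_coefs :: "'k dd \<Rightarrow> 'k list \<Rightarrow> BB list" where
  "chain_coefs K ks = map2 (dd_coef K) (butlast ks) (tl ks)"

text \<open>\<open>contract f [] b [t\<^sub>1, \<dots>, t\<^sub>n]\<close> is the value at \<open>t\<^sub>1 \<otimes> \<dots> \<otimes> t\<^sub>n\<close> of the linear map sending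
  \<open>(a\<^sub>1 \<otimes> b\<^sub>1) \<otimes> \<dots> \<otimes> (a\<^sub>n \<otimes> b\<^sub>n)\<close> to \<open>f [a\<^sub>1, \<dots>, a\<^sub>n] \<otimes> b b\<^sub>1 \<cdots> b\<^sub>n\<close>, for multilinear \<open>f\<close>.\<close>

primrec contract :: "(B2 list \<Rightarrow> B2) \<Rightarrow> B2 list \<Rightarrow> B2_dual \<Rightarrow> BB list \<Rightarrow> BB" where
  "contract f as b [] = f as \<otimes> b"
| "contract f as b (t # ts) = tensor_lift (\<lambda>a' b'. contract f (as @ [a']) (b * b') ts) t"

text \<open>The pairs \<open>(m, k)\<close> with matching idempotents form a basis of \<open>X \<otimes>\<^bsub>I(2)\<^esub> K\<close>.  The product is
  meaningful only if \<open>da_arities X\<close> is finite.  The initial factor \<^term>\<open>idem (dd_idem2 K k)\<close> is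
  the value of the empty product of elements of \<open>B\<^sup>!(2)\<close>, that is, of the term for \<open>\<delta>\<^sup>1\<^sub>1\<close>.\<close>

definition box :: "'g da \<Rightarrow> 'k dd \<Rightarrow> ('g \<times> 'k) dd"  (infixl "\<boxtimes>" 70) where
  "X \<boxtimes> K =
     \<lparr>dd_gens = {(m, k). m \<in> da_gens X \<and> k \<in> dd_gens K \<and> da_right X m = dd_idem1 K k},
      dd_idem1 = (\<lambda>(m, k). da_left X m),
      dd_idem2 = (\<lambda>(m, k). dd_idem2 K k),
      dd_degree = (\<lambda>(m, k). da_degree X m + dd_degree K k),
      dd_coef = (\<lambda>(m, k) (m', k').
        \<Sum>n\<in>da_arities X. \<Sum>ks\<in>dd_chains K n k k'.
          contract (\<lambda>as. da_op X m as m') [] (idem (dd_idem2 K k)) (chain_coefs K ks))\<rparr>"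

text \<open>The basis element \<open>k\<^sub>x\<close> is represented by the vertex \<open>x\<close> itself.\<close>

definition K_DD :: "vertex dd" where
  "K_DD =
     \<lparr>dd_gens = UNIV,
      dd_idem1 = (\<lambda>x. x),
      dd_idem2 = (\<lambda>x. - x),
      dd_degree = (\<lambda>x. 0),
      dd_coef = (\<lambda>x y. (idem x \<otimes> idem (- x)) *
        (\<Sum>i\<in>UNIV. label_sum (L i) \<otimes> label_sum (Old (R i)) + label_sum (R i) \<otimes> label_sum (Old (L i)) +
           label_sum (U i) \<otimes> label_sum (C i)) *
        (idem y \<otimes> idem (- y)))\<rparr>"


section \<open>The bimodules \<open>X\<^sup>D\<^sup>A\<close> and \<open>X\<^sup>D\<^sup>D\<close> and their simplified versions\<close>

abbreviation "vA \<equiv> {P0}"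
abbreviation "vB \<equiv> {P1}"
abbreviation "vC \<equiv> {P2}"
abbreviation "vAB \<equiv> {P0, P1}"
abbreviation "vAC \<equiv> {P0, P2}"
abbreviation "vBC \<equiv> {P1, P2}"
abbreviation "vABC \<equiv> {P0, P1, P2}"

abbreviation "R1 \<equiv> R One"
abbreviation "R2 \<equiv> R Two"
abbreviation "L1 \<equiv> L One"
abbreviation "L2 \<equiv> L Two"
abbreviation "U1 \<equiv> U One"
abbreviation "U2 \<equiv> U Two"

abbreviation "sR1 \<equiv> Old R1"
abbreviation "sR2 \<equiv> Old R2"
abbreviation "sL1 \<equiv> Old L1"
abbreviation "sL2 \<equiv> Old L2"
abbreviation "sU1 \<equiv> Old U1"
abbreviation "sU2 \<equiv> Old U2"
abbreviation "C1 \<equiv> C One"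
abbreviation "C2 \<equiv> C Two"

definition B2_basis :: "B2 set" where
  "B2_basis =
     {idem {}} \<union>
     {path_class vA (replicate i U1) |i. True} \<union>
     {path_class vA (R1 # replicate i U1) |i. True} \<union>
     {path_class vB (L1 # replicate i U1) |i. True} \<union>
     {idem vB} \<union>
     {path_class vB (replicate (i + 1) U1) |i. True} \<union>
     {path_class vB (replicate (i + 1) U2) |i. True} \<union>
     {path_class vB (R2 # replicate i U2) |i. True} \<union>
     {path_class vC (L2 # replicate i U2) |i. True} \<union>
     {path_class vC (replicate i U2) |i. True} \<union>
     {path_class x (p @ replicate i U1 @ replicate j U2) |x p i j.
        (x, p) \<in> {(vAB, []), (vAC, []), (vBC, []), (vAB, [R2]), (vAB, [R2, R1]), (vAC, [L2]),
                  (vAC, [R1]), (vBC, [L1, L2]), (vBC, [L1])}} \<union>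
     {path_class vABC (replicate i U1 @ replicate j U2) |i j. True}"

definition B2_coef :: "B2 \<Rightarrow> B2 \<Rightarrow> bit" where
  "B2_coef b a = F2.representation B2_basis a b"

datatype xgen = Z1 | Z2 | Z3 | Z4
  | X1 | X2 | X3 | X4 | X5 | X6 | X7 | X8 | X9 | X10 | X11 | X12
  | Y1 | Y2 | Y3 | Y4 | Y5 | Y6 | Y7 | Y8

datatype xtype = S_minus_t | W_t | S_minus_b | E_b | W_b | S_plus_b | E_t | S_plus_t

fun xdata :: "xgen \<Rightarrow> xtype \<times> vertex \<times> vertex" where
  "xdata Z1 = (S_minus_t, {}, {})"
| "xdata Z2 = (S_minus_b, {}, {})"
| "xdata Z3 = (S_plus_b, {}, {})"
| "xdata Z4 = (S_plus_t, {}, {})"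
| "xdata X1 = (S_minus_t, vA, vA)"
| "xdata X2 = (S_minus_t, vC, vC)"
| "xdata X3 = (W_t, vB, vA)"
| "xdata X4 = (S_minus_b, vA, vA)"
| "xdata X5 = (S_minus_b, vC, vC)"
| "xdata X6 = (E_b, vB, vC)"
| "xdata X7 = (W_b, vB, vA)"
| "xdata X8 = (S_plus_b, vA, vA)"
| "xdata X9 = (S_plus_b, vC, vC)"
| "xdata X10 = (E_t, vB, vC)"
| "xdata X11 = (S_plus_t, vA, vA)"
| "xdata X12 = (S_plus_t, vC, vC)"
| "xdata Y1 = (S_minus_t, vAC, vAC)"
| "xdata Y2 = (W_t, vBC, vAC)"
| "xdata Y3 = (S_minus_b, vAC, vAC)"
| "xdata Y4 = (E_b, vAB, vAC)"
| "xdata Y5 = (W_b, vBC, vAC)"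
| "xdata Y6 = (S_plus_b, vAC, vAC)"
| "xdata Y7 = (E_t, vAB, vAC)"
| "xdata Y8 = (S_plus_t, vAC, vAC)"

definition xleft :: "xgen \<Rightarrow> vertex" where "xleft x = fst (snd (xdata x))"
definition xright :: "xgen \<Rightarrow> vertex" where "xright x = snd (snd (xdata x))"

primrec type_degree :: "xtype \<Rightarrow> degree" where
  "type_degree S_minus_t = hdeg 1"
| "type_degree W_t = \<beta> One"
| "type_degree S_minus_b = \<tau> Two + \<beta> Two"
| "type_degree E_b = \<tau> Two"
| "type_degree W_b = hdeg (- 1) + \<tau> Two + \<beta> One + \<beta> Two"
| "type_degree S_plus_b = hdeg (- 1) + \<tau> Two + \<beta> Two"
| "type_degree E_t = hdeg (- 1) + \<tau> One + \<tau> Two + \<beta> One"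
| "type_degree S_plus_t = hdeg (- 2) + \<tau> One + \<tau> Two + \<beta> One + \<beta> Two"

definition xdegree :: "xgen \<Rightarrow> degree" where "xdegree x = type_degree (fst (xdata x))"

text \<open>An entry \<open>(x, ps, w, y)\<close> of the following table says that the operation with \<open>length ps\<close>
  algebra inputs sends \<open>x\<close> and the inputs \<open>ps\<close> to a sum containing the term \<open>w \<otimes> y\<close>.  Inputs are
  basis elements of \<open>B(2)\<close>; only their label sequences are listed, since the first one starts at the
  right idempotent of \<open>x\<close>, and every other one at the end of its predecessor.\<close>

type_synonym da_term = "xgen \<times> b_label list list \<times> b_label list \<times> xgen"

definition pairs_P :: "b_label list list list" where
  "pairs_P = [[[U1], [U2]], [[L2, U1], [R2]], [[R1], [L1, U2]]]"

definition da_terms :: "da_term list" where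
  "da_terms =
     map (\<lambda>(x, w, y). (x, [], w, y))
       [(Z3, [], Z2), (X3, [L1], X1), (X5, [U2], X2), (X6, [R2], X2), (X7, [U2], X3), (X7, [L1], X4),
        (X8, [], X4), (X9, [], X5), (X9, [L2], X6), (X10, [U1], X6), (X11, [R1], X7), (X11, [U1], X8),
        (X12, [L2], X10), (Y2, [L1], Y1), (Y3, [U2], Y1), (Y4, [R2], Y1), (Y5, [U2], Y2),
        (Y5, [L1], Y3), (Y6, [], Y3), (Y6, [L2], Y4), (Y7, [R2, R1], Y2), (Y7, [U1], Y4),
        (Y8, [R1], Y5), (Y8, [U1], Y6), (Y8, [L2], Y7)] @
     map (\<lambda>(x, w, y). (x, [[R1], [R2]], w, y))
       [(X1, [R1], X6), (X3, [], X10), (X7, [R2], X12)] @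
     map (\<lambda>(x, w, y). (x, [[L2], [L1]], w, y))
       [(X2, [L2], X3), (X5, [L2], X7), (X6, [], X7), (X6, [L1], X8), (X10, [L1], X11)] @
     concat (map (\<lambda>p. map (\<lambda>(x, w, y). (x, p, w, y))
       [(Y1, [R1, U2], Y2), (Y1, [L2, U1], Y4), (Y2, [L1, L2], Y7), (Y3, [R1, U2], Y5),
        (Y3, [U1, U2], Y6), (Y4, [R2, R1], Y5), (Y4, [R2, U1], Y6), (Y5, [L1, U2], Y8),
        (Y7, [R2, U1], Y8)]) pairs_P) @
     map (\<lambda>(x, w, y). (x, [[R1], [U2], [L1]], w, y))
       [(X1, [R1], X7), (X1, [U1], X8), (X3, [L1], X11), (Y1, [R1], Y5), (Y1, [U1], Y6),
        (Y2, [L1], Y8)] @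
     map (\<lambda>(x, w, y). (x, [[L2], [U1], [R2]], w, y))
       [(X2, [L2], X10), (X5, [U2], X12), (X6, [R2], X12), (Y1, [L2], Y7), (Y3, [U2], Y8),
        (Y4, [R2], Y8)] @
     concat (map (\<lambda>p. map (\<lambda>q. (Y1, p @ q, [U1, U2], Y8)) pairs_P) pairs_P)"

text \<open>\<open>input_coef v ps as\<close> is the coefficient in \<open>as\<close>, viewed as a tensor product of elements of
  \<open>B(2)\<close>, of the sequence of basis elements with labels \<open>ps\<close> that starts at the vertex \<open>v\<close>.\<close>

fun input_coef :: "vertex \<Rightarrow> b_label list list \<Rightarrow> B2 list \<Rightarrow> bit" where
  "input_coef v [] [] = 1"
| "input_coef v (p # ps) (a # as) =
     B2_coef (path_class v p) a * input_coef (the (path_end v p)) ps as"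
| "input_coef v _ _ = 0"

definition term_op :: "da_term \<Rightarrow> xgen \<Rightarrow> B2 list \<Rightarrow> xgen \<Rightarrow> B2" where
  "term_op = (\<lambda>(x, ps, w, y) x' as y'.
     if x' = x \<and> y' = y
     then f2_scale (input_coef (xright x) ps as) (idem (xleft x) * word w * idem (xleft y))
     else 0)"

text \<open>The additional entry \<open>(x, [[]], [], x)\<close> is the operation \<open>\<delta>\<^sup>1\<^sub>2(x \<otimes> I') = I \<otimes> x\<close>.\<close>

definition da_of_terms :: "xgen set \<Rightarrow> da_term list \<Rightarrow> xgen da" where
  "da_of_terms G ts =
     \<lparr>da_gens = G, da_left = xleft, da_right = xright, da_degree = xdegree,
      da_op = (\<lambda>x as y. \<Sum>t\<leftarrow>(x, [[]], [], x) # ts. term_op t x as y)\<rparr>"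

text \<open>An entry \<open>(x, v, w, y)\<close> of the following table stands for a term \<open>(v \<otimes> w) \<otimes> y\<close> of \<open>\<delta>\<^sup>1(x)\<close>.\<close>

type_synonym dd_term = "xgen \<times> b_label list \<times> s_label list \<times> xgen"

definition dd_terms :: "dd_term list" where
  "dd_terms =
     [(Z3, [], [], Z2),
      (X1, [R1], [sL1, sL2], X6), (X1, [R1], [sU1, C2], X7), (X1, [U1], [sU1, C2], X8),
      (X2, [L2], [sR2, sR1], X3), (X2, [L2], [C1, sU2], X10),
      (X3, [L1], [], X1), (X3, [], [sL1, sL2], X10), (X3, [L1], [sU1, C2], X11),
      (X5, [U2], [], X2), (X5, [L2], [sR2, sR1], X7), (X5, [U2], [C1, sU2], X12),
      (X6, [R2], [], X2), (X6, [], [sR2, sR1], X7), (X6, [L1], [sR2, sR1], X8),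
        (X6, [R2], [C1, sU2], X12),
      (X7, [U2], [], X3), (X7, [L1], [], X4), (X7, [R2], [sL1, sL2], X12),
      (X8, [], [], X4),
      (X9, [], [], X5), (X9, [L2], [], X6),
      (X10, [U1], [], X6), (X10, [L1], [sR2, sR1], X11),
      (X11, [R1], [], X7), (X11, [U1], [], X8),
      (X12, [L2], [], X10),
      (Y1, [R1, U2], [C1, C2], Y2), (Y1, [L2, U1], [C1, C2], Y4), (Y1, [R1], [sU1, C2], Y5),
        (Y1, [U1], [sU1, C2], Y6), (Y1, [L2], [C1, sU2], Y7),
      (Y2, [L1], [], Y1), (Y2, [L1, L2], [C1, C2], Y7), (Y2, [L1], [sU1, C2], Y8),
      (Y3, [U2], [], Y1), (Y3, [R1, U2], [C1, C2], Y5), (Y3, [U1, U2], [C1, C2], Y6),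
        (Y3, [U2], [C1, sU2], Y8),
      (Y4, [R2], [], Y1), (Y4, [R2, R1], [C1, C2], Y5), (Y4, [R2, U1], [C1, C2], Y6),
        (Y4, [R2], [C1, sU2], Y8),
      (Y5, [U2], [], Y2), (Y5, [L1], [], Y3), (Y5, [L1, U2], [C1, C2], Y8),
      (Y6, [], [], Y3), (Y6, [L2], [], Y4),
      (Y7, [R2, R1], [], Y2), (Y7, [U1], [], Y4), (Y7, [R2, U1], [C1, C2], Y8),
      (Y8, [R1], [], Y5), (Y8, [U1], [], Y6), (Y8, [L2], [], Y7)]"

definition dd_of_terms :: "xgen set \<Rightarrow> dd_term list \<Rightarrow> xgen dd" where
  "dd_of_terms G ts =
     \<lparr>dd_gens = G, dd_idem1 = xleft, dd_idem2 = (\<lambda>x. - xright x), dd_degree = xdegree,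
      dd_coef = (\<lambda>x' y'. \<Sum>(x, v, w, y)\<leftarrow>ts.
        if x' = x \<and> y' = y
        then (idem (xleft x) \<otimes> idem (- xright x)) * (word v \<otimes> word w) *
          (idem (xleft y) \<otimes> idem (- xright y))
        else 0)\<rparr>"

definition X_DA :: "xgen da" where
  "X_DA = da_of_terms UNIV da_terms"

definition X_DD :: "xgen dd" where
  "X_DD = dd_of_terms UNIV dd_terms"

definition deleted :: "xgen set" where
  "deleted = {Z2, Z3, X4, X5, X8, X9, Y3, Y6}"

definition X_DA_simplified :: "xgen da" where
  "X_DA_simplified = da_of_terms (- deleted)
     ((Y5, [], [L1, L2], Y4) # [(x, ps, w, y) \<leftarrow> da_terms. x \<notin> deleted \<and> y \<notin> deleted])"

definition X_DD_simplified :: "xgen dd" where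
  "X_DD_simplified = dd_of_terms (- deleted)
     ((Y5, [L1, L2], [], Y4) # [(x, v, w, y) \<leftarrow> dd_terms. x \<notin> deleted \<and> y \<notin> deleted])"

text \<open>The correspondence of basis elements: \<open>x\<close> is sent to \<open>x \<otimes> k\<^sub>y\<close> where \<open>I\<^sub>y\<close> is the right idempotent
  of \<open>x\<close>.\<close>

definition natural_map :: "xgen \<Rightarrow> xgen \<times> vertex" where
  "natural_map x = (x, xright x)"

end

theory Submission
  imports Defs
begin

text \<open>A path in \<open>B(2)\<close> is determined, up to equality in \<open>B(2)\<close>, by its starting vertex and two weights, and
  it is zero exactly for certain explicit weights; this makes \<open>B2_basis\<close> a basis.  Every term of the
  \<open>\<delta>\<^sup>1\<close> of \<open>K\<close> pairs a single label \<open>l\<close> with its dual label, so contracting an operation with \<open>K\<close> keeps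
  only the terms all of whose inputs are single labels, and replaces these inputs by their duals.
  Since \<open>B\<^sup>!(2)\<close> has the same normal forms with additional central square-zero factors \<open>C\<^sub>i\<close>, all remaining
  identities say that every normal form occurs an even number of times in an explicit list.\<close>

section \<open>Paths in quiver algebras\<close>

text \<open>Coefficients with respect to \<open>B2_basis\<close> are defined through
  \<open>representation\<close>, which is meaningful only for an independent set, so the inputs of
  an operation can be read off only once distinct normal forms in B(2) are known to be independent.
  Manipulating relations produces equalities and never this lower bound; it comes from a linear map
  on the path algebra that kills the relation ideal and still remembers vertex and weights. In
  \<open>B2_dual\<close> words occur only as outputs that have to cancel, and there equalities
  between words suffice.

  Over the field with two elements, two matrix entries agree if and only if their sum is zero.
  Comparing the two bimodules therefore has the same shape as the structure equation, and the single
  criterion \<open>cancels\<close> serves both. The structure equation itself is checked on the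
  \<open>DD\<close> tables; the box products inherit it along the bijection of bases.\<close>

lemma path_class_mult:
  "path_class x p * path_class y q = (if path_end x p = Some y then path_class x (p @ q) else 0)"
proof (cases "path_end x p = Some y")
  case True
  then have "path_class x p * path_class y q = path_class x (p @ q)"
    by transfer (simp add: path_mult_path equivp_reflp[OF quiver_algebra_equivp])
  with True show ?thesis by simp
next
  case False
  then have "path_class x p * path_class y q = 0"
    by transfer (simp add: path_mult_path equivp_reflp[OF quiver_algebra_equivp])
  with False show ?thesis by simp
qed

lemma path_class_append:
  "path_end x p = Some y \<Longrightarrow> path_class x (p @ q) = path_class x p * path_class y q"
  by (simp add: path_class_mult)

lemma path_class_Cons:
  "target l x = Some y \<Longrightarrow> path_class x (l # q) = path_class x [l] * path_class y q"
  by (simp add: path_class_mult)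

lemma path_class_undefined: "path_end x p = None \<Longrightarrow> path_class x p = 0"
  by transfer (simp add: path_undefined equivp_reflp[OF quiver_algebra_equivp])

lemma path_class_times_idem:
  "path_class x p * idem y = (if path_end x p = Some y then path_class x p else 0)"
  by (simp add: path_class_mult)

lemma path_class_times_label_sum: "path_class x p * label_sum l = path_class x (p @ [l])"
proof (cases "path_end x p")
  case None
  then show ?thesis
    by (simp add: label_sum_def sum_distrib_left path_class_mult path_class_undefined path_end_append)
qed (simp add: label_sum_def sum_distrib_left path_class_mult)

lemma path_class_times_word: "path_class x p * word w = path_class x (p @ w)"
  by (induction w arbitrary: p)
     (simp_all add: word_def mult.assoc[symmetric] path_class_times_label_sum)

lemma idem_word_idem:
  "idem x * word w * idem y = (if path_end x w = Some y then path_class x w else 0)"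
  by (simp add: path_class_times_word path_class_times_idem)

lemma path_class_relator:
  assumes "(x, ws) \<in> relators"
  shows "(\<Sum>w\<leftarrow>ws. path_class x w) = 0"
proof -
  have "(\<Sum>w\<leftarrow>ws. path_class x w) = abs_quiver_algebra (\<Sum>w\<leftarrow>ws. path x w)" for ws :: "'a list list"
    by (induction ws)
       (simp_all add: zero_quiver_algebra.abs_eq path_class.abs_eq plus_quiver_algebra.abs_eq)
  moreover have "quotient_eq (\<Sum>w\<leftarrow>ws. path x w) 0"
    using relatorsI[OF assms refl] by (intro quotient_eqI) simp
  ultimately show ?thesis
    by (simp add: zero_quiver_algebra.abs_eq quiver_algebra.abs_eq_iff)
qed

lemma f2_eqI: "x + y = 0 \<Longrightarrow> x = (y :: 'a::f2_space)"
  by (simp flip: f2_diff)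

text \<open>The condition \<open>target m = Some\<close> says that \<open>m\<close> is a loop at
  every vertex, as \<open>U i\<close> and \<open>C i\<close> are. Commutation relators exist only
  where \<open>l\<close> starts; elsewhere both sides are zero.\<close>

lemma label_sum_commute:
  assumes "target m = Some" and "target l y \<noteq> None \<Longrightarrow> (y, [[m, l], [l, m]]) \<in> relators"
  shows "label_sum m * path_class y [l] = path_class y [l] * label_sum m"
proof -
  have "path_class x [m] * path_class y [l] = (if x = y then path_class y [m, l] else 0)" for x
    using assms(1) by (simp add: path_class_mult)
  then have "label_sum m * path_class y [l] = path_class y [m, l]"
    by (simp add: label_sum_def sum_distrib_right)
  also have "\<dots> = path_class y [l, m]"
  proof (cases "target l y")
    case None
    then show ?thesis using assms(1) by (simp add: path_class_undefined)
  next
    case (Some z)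
    with assms(2) have "(y, [[m, l], [l, m]]) \<in> relators" by simp
    from path_class_relator[OF this] show ?thesis
      by - (rule f2_eqI, simp)
  qed
  also have "\<dots> = path_class y [l] * label_sum m"
    by (simp add: path_class_times_label_sum)
  finally show ?thesis .
qed

section \<open>The eight vertices and the arrows between them\<close>

lemma vertex_eq_iff:
  "(x :: vertex) = y \<longleftrightarrow> (P0 \<in> x \<longleftrightarrow> P0 \<in> y) \<and> (P1 \<in> x \<longleftrightarrow> P1 \<in> y) \<and> (P2 \<in> x \<longleftrightarrow> P2 \<in> y)"
  (is "_ \<longleftrightarrow> ?R")
proof
  show "x = y" if ?R
  proof (rule set_eqI)
    show "t \<in> x \<longleftrightarrow> t \<in> y" for t using that by (cases t) simp_all
  qed
qed simp

lemma vertex_cases: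
  fixes x :: vertex
  obtains "x = {}" | "x = vA" | "x = vB" | "x = vC" | "x = vAB" | "x = vAC" | "x = vBC" | "x = vABC"
  unfolding vertex_eq_iff by (cases "P0 \<in> x"; cases "P1 \<in> x"; cases "P2 \<in> x") simp_all

lemma vertex_distinct [simp]:
  "vA \<noteq> vB" "vA \<noteq> vC" "vA \<noteq> vAB" "vA \<noteq> vAC" "vA \<noteq> vBC" "vA \<noteq> vABC" "vB \<noteq> vA"
  "vB \<noteq> vC" "vB \<noteq> vAB" "vB \<noteq> vAC" "vB \<noteq> vBC" "vB \<noteq> vABC" "vC \<noteq> vA" "vC \<noteq> vB"
  "vC \<noteq> vAB" "vC \<noteq> vAC" "vC \<noteq> vBC" "vC \<noteq> vABC" "vAB \<noteq> vA" "vAB \<noteq> vB" "vAB \<noteq> vC"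
  "vAB \<noteq> vAC" "vAB \<noteq> vBC" "vAB \<noteq> vABC" "vAC \<noteq> vA" "vAC \<noteq> vB" "vAC \<noteq> vC" "vAC \<noteq> vAB"
  "vAC \<noteq> vBC" "vAC \<noteq> vABC" "vBC \<noteq> vA" "vBC \<noteq> vB" "vBC \<noteq> vC" "vBC \<noteq> vAB" "vBC \<noteq> vAC"
  "vBC \<noteq> vABC" "vABC \<noteq> vA" "vABC \<noteq> vB" "vABC \<noteq> vC" "vABC \<noteq> vAB" "vABC \<noteq> vAC" "vABC \<noteq> vBC"
  by (simp_all add: vertex_eq_iff)

lemma b_label_cases:
  obtains "l = R1" | "l = R2" | "l = L1" | "l = L2" | "l = U1" | "l = U2"
proof (cases l)
  case (R i)
  then show ?thesis using that by (cases i) simp_all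
next
  case (L i)
  then show ?thesis using that by (cases i) simp_all
next
  case (U i)
  then show ?thesis using that by (cases i) simp_all
qed

lemma b_target_table [simp]:
  "b_target R1 {} = None" "b_target L1 {} = None" "b_target R2 {} = None" "b_target L2 {} = None"
  "b_target R1 vA = Some vB" "b_target L1 vA = None" "b_target R2 vA = None" "b_target L2 vA = None"
  "b_target R1 vB = None" "b_target L1 vB = Some vA" "b_target R2 vB = Some vC" "b_target L2 vB = None"
  "b_target R1 vC = None" "b_target L1 vC = None" "b_target R2 vC = None" "b_target L2 vC = Some vB"
  "b_target R1 vAB = None" "b_target L1 vAB = None" "b_target R2 vAB = Some vAC" "b_target L2 vAB = None"
  "b_target R1 vAC = Some vBC" "b_target L1 vAC = None" "b_target R2 vAC = None" "b_target L2 vAC = Some vAB"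
  "b_target R1 vBC = None" "b_target L1 vBC = Some vAC" "b_target R2 vBC = None" "b_target L2 vBC = None"
  "b_target R1 vABC = None" "b_target L1 vABC = None" "b_target R2 vABC = None" "b_target L2 vABC = None"
  by (simp_all add: vertex_eq_iff)

declare b_target.simps(1,2) [simp del]

lemma target_b_label [simp]: "target l x = b_target l x"
  by (simp add: target_b_label_def)

lemma target_s_label [simp]: "target l x = s_target l x"
  by (simp add: target_s_label_def)

section \<open>Normal forms\<close>

text \<open>All relations preserve the weights, in which \<open>R\<^sub>i\<close> and \<open>L\<^sub>i\<close> count once and \<open>U\<^sub>i = R\<^sub>i L\<^sub>i\<close> counts
  twice.\<close>

primrec label_weight :: "idx \<Rightarrow> b_label \<Rightarrow> nat" where
  "label_weight i (R j) = (if i = j then 1 else 0)"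
| "label_weight i (L j) = (if i = j then 1 else 0)"
| "label_weight i (U j) = (if i = j then 2 else 0)"

definition weight :: "idx \<Rightarrow> b_label list \<Rightarrow> nat" where
  "weight i w = (\<Sum>l\<leftarrow>w. label_weight i l)"

lemma weight_simps [simp]:
  "weight i [] = 0" "weight i (l # w) = label_weight i l + weight i w"
  "weight i (v @ w) = weight i v + weight i w"
  by (simp_all add: weight_def)

lemma weight_replicate [simp]: "weight i (replicate k l) = k * label_weight i l"
  by (induction k) simp_all

text \<open>The loop \<open>U i\<close> dies at a vertex that misses both \<open>lo i\<close> and
  \<open>hi i\<close>, which accounts for \<open>{}\<close>, \<open>vA\<close> and
  \<open>vC\<close>; for \<open>vB\<close> see \<open>pc_vB_u_u\<close>. A vertex with at least two
  elements meets both pairs, and nothing vanishes there.\<close>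

definition vanishing :: "vertex \<Rightarrow> nat \<Rightarrow> nat \<Rightarrow> bool" where
  "vanishing x m n \<longleftrightarrow>
     x = {} \<and> (m > 0 \<or> n > 0) \<or> x = vA \<and> n > 0 \<or> x = vC \<and> m > 0 \<or> x = vB \<and> m > 0 \<and> n > 0"

lemma vanishing_mono: "vanishing x m n \<Longrightarrow> m \<le> m' \<Longrightarrow> n \<le> n' \<Longrightarrow> vanishing x m' n'"
  by (auto simp: vanishing_def)

lemma vanishing_table [simp]:
  "vanishing {} m n \<longleftrightarrow> m > 0 \<or> n > 0" "vanishing vA m n \<longleftrightarrow> n > 0" "vanishing vC m n \<longleftrightarrow> m > 0"
  "vanishing vB m n \<longleftrightarrow> m > 0 \<and> n > 0" "\<not> vanishing vAB m n" "\<not> vanishing vAC m n" "\<not> vanishing vBC m n"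
  "\<not> vanishing vABC m n"
  by (simp_all add: vanishing_def)

text \<open>The shortest path from \<open>x\<close> whose weights have the given parities (\<open>True\<close> for odd).  If there is
  none, the value is a word that is not a path from \<open>x\<close>.\<close>

definition core :: "vertex \<Rightarrow> bool \<Rightarrow> bool \<Rightarrow> b_label list" where
  "core x a b =
     (if a then
        if b then (if P0 \<in> x then [R2, R1] else [L1, L2]) else (if P0 \<in> x then [R1] else [L1])
      else
        if b then (if P2 \<in> x then [L2] else [R2]) else [])"

text \<open>Vanishing weights behave like a two-sided ideal: this is stability under prepending an
  arrow, while \<open>vanishing_mono\<close> is stability under appending.\<close>

lemma target_vanishing:
  assumes "b_target l x = Some y" "vanishing y m n"
  shows "vanishing x (label_weight One l + m) (label_weight Two l + n)"
  using assms by (cases x rule: vertex_cases; cases l rule: b_label_cases) auto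

lemma path_end_vanishing:
  "path_end x w = Some y \<Longrightarrow> vanishing y m n \<Longrightarrow> vanishing x (weight One w + m) (weight Two w + n)"
proof (induction w arbitrary: x)
  case (Cons l w)
  then obtain z where "b_target l x = Some z" "path_end z w = Some y" by (auto split: option.splits)
  with target_vanishing[OF this(1) Cons.IH[OF this(2) Cons.prems(2)]] show ?case
    by (simp add: add.assoc)
qed simp

section \<open>Consequences of the relations shared by both algebras\<close>

lemma common_relatorsI:
  "tgt l x \<noteq> None \<Longrightarrow> (x, [[e (U i), l], [l, e (U i)]]) \<in> common_relators e tgt"
  "tgt (e (R i)) x \<noteq> None \<Longrightarrow> (x, [[e (R i), e (L i)], [e (U i)]]) \<in> common_relators e tgt"
  "tgt (e (L i)) x \<noteq> None \<Longrightarrow> (x, [[e (L i), e (R i)], [e (U i)]]) \<in> common_relators e tgt"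
  "(x, [[e R1, e R2]]) \<in> common_relators e tgt"
  "(x, [[e L2, e L1]]) \<in> common_relators e tgt"
  "x \<inter> {lo i, hi i} = {} \<Longrightarrow> (x, [[e (U i)]]) \<in> common_relators e tgt"
  unfolding common_relators_def
  subgoal by (rule UnI1, rule UnI1, rule UnI1, rule UnI1, rule UnI1, rule CollectI, intro exI conjI, rule refl)
  subgoal by (rule UnI1, rule UnI1, rule UnI1, rule UnI1, rule UnI2, rule CollectI, intro exI conjI, rule refl)
  subgoal by (rule UnI1, rule UnI1, rule UnI1, rule UnI2, rule CollectI, intro exI conjI, rule refl)
  subgoal by (rule UnI1, rule UnI1, rule UnI2, rule CollectI, intro exI conjI, rule refl, rule TrueI)
  subgoal by (rule UnI1, rule UnI2, rule CollectI, intro exI conjI, rule refl, rule TrueI)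
  subgoal by (rule UnI2, rule CollectI, intro exI conjI, rule refl)
  done

text \<open>The labels R, L, U have the same arrows and relations in both algebras. The locale
  reduces words to normal form once, for the identity embedding into B(2) and for
  \<open>Old\<close>.\<close>

locale b_embedding =
  fixes e :: "b_label \<Rightarrow> 'l::quiver"
  assumes target_e [simp]: "target (e l) x = b_target l x"
    and common_relators: "common_relators e target \<subseteq> relators"
begin

lemma path_end_map [simp]: "path_end x (map e w) = path_end x w"
  by (induction w arbitrary: x) (auto split: option.split)

definition pc :: "vertex \<Rightarrow> b_label list \<Rightarrow> 'l quiver_algebra" where
  "pc x w = path_class x (map e w)"

definition u :: "idx \<Rightarrow> 'l quiver_algebra" where
  "u i = label_sum (e (U i))"

lemma pc_append: "path_end x v = Some y \<Longrightarrow> pc x (v @ w) = pc x v * pc y w"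
  by (simp add: pc_def path_class_append)

lemma pc_Cons: "b_target l x = Some y \<Longrightarrow> pc x (l # w) = pc x [l] * pc y w"
  using path_class_Cons[of "e l" x y "map e w"] by (simp add: pc_def)

lemma pc_snoc_U: "pc x (w @ [U i]) = pc x w * u i"
  by (simp add: pc_def u_def path_class_times_label_sum)

lemma u_commute: "u i * pc y [l] = pc y [l] * u i"
  unfolding u_def pc_def list.map
proof (rule label_sum_commute)
  show "target (e (U i)) = Some" by (simp add: fun_eq_iff)
  show "target (e l) y \<noteq> None \<Longrightarrow> (y, [[e (U i), e l], [e l, e (U i)]]) \<in> relators"
    by (rule subsetD[OF common_relators]) (rule common_relatorsI)
qed

lemma u_power_commute: "u i ^ k * pc y [l] = pc y [l] * u i ^ k"
  by (rule power_commuting_commutes[OF u_commute])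

lemma u_u_commute: "u i * u j = u j * u i"
proof -
  have "u j = (\<Sum>x\<in>UNIV. pc x [U j])" by (simp add: u_def label_sum_def pc_def)
  then show ?thesis by (simp add: sum_distrib_left sum_distrib_right u_commute)
qed

lemma u_u_power_commute: "u i ^ m * u j = u j * u i ^ m"
  by (rule power_commuting_commutes[OF u_u_commute])

lemma pc_relator:
  assumes "(x, [map e w]) \<in> common_relators e target"
  shows "pc x w = 0"
  using path_class_relator[OF subsetD[OF common_relators assms]] by (simp add: pc_def)

lemma pc_U_eq_0: "x \<inter> {lo i, hi i} = {} \<Longrightarrow> pc x [U i] = 0"
  by (rule pc_relator) (simp add: common_relatorsI)

lemma pc_R1_R2: "pc x [R1, R2] = 0"
  by (rule pc_relator) (simp add: common_relatorsI)

lemma pc_L2_L1: "pc x [L2, L1] = 0"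
  by (rule pc_relator) (simp add: common_relatorsI)

lemma pc_R_L:
  assumes "b_target (R i) x = Some y"
  shows "pc x [R i, L i] = pc x [] * u i"
proof -
  have "(x, [[e (R i), e (L i)], [e (U i)]]) \<in> relators"
    using assms by (intro subsetD[OF common_relators] common_relatorsI) simp
  from path_class_relator[OF this] show ?thesis
    using pc_snoc_U[of x "[]" i] by - (rule f2_eqI, simp add: pc_def)
qed

lemma pc_L_R:
  assumes "b_target (L i) x = Some y"
  shows "pc x [L i, R i] = pc x [] * u i"
proof -
  have "(x, [[e (L i), e (R i)], [e (U i)]]) \<in> relators"
    using assms by (intro subsetD[OF common_relators] common_relatorsI) simp
  from path_class_relator[OF this] show ?thesis
    using pc_snoc_U[of x "[]" i] by - (rule f2_eqI, simp add: pc_def)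
qed

definition nf :: "vertex \<Rightarrow> nat \<Rightarrow> nat \<Rightarrow> 'l quiver_algebra" where
  "nf x m n = pc x (core x (odd m) (odd n)) * u One ^ (m div 2) * u Two ^ (n div 2)"

lemma pc_Nil_u: "x \<inter> {lo i, hi i} = {} \<Longrightarrow> pc x [] * u i = 0"
  using pc_U_eq_0[of x i] pc_snoc_U[of x "[]" i] by simp

text \<open>Since \<open>u i\<close> commutes with arrows, it can be evaluated at the start of the
  arrow; \<open>pc_single_u'\<close> evaluates it at the end.\<close>

lemma pc_single_u:
  assumes "pc x [] * u i = 0"
  shows "pc x [l] * u i = 0"
proof -
  have "pc x [l] * u i = pc x [] * (pc x [l] * u i)"
    using pc_append[of x "[]" x "[l]"] by (simp flip: mult.assoc)
  also have "\<dots> = pc x [] * u i * pc x [l]"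
    by (simp add: mult.assoc flip: u_commute)
  finally show ?thesis using assms by simp
qed

lemma pc_single_u':
  assumes "b_target l x = Some y" "pc y [] * u i = 0"
  shows "pc x [l] * u i = 0"
proof -
  have "pc x [l] * u i = pc x [l] * (pc y [] * u i)"
    using pc_append[of x "[l]" y "[]"] assms(1) by (simp flip: mult.assoc)
  then show ?thesis using assms(2) by simp
qed

text \<open>Neither loop alone is zero at \<open>vB\<close>. Writing the first as
  \<open>L1 R1\<close> routes the path through \<open>vA\<close>, where the second one dies.\<close>

lemma pc_vB_u_u: "pc vB [] * u One * u Two = 0"
proof -
  have "pc vB [] * u One = pc vB [L1, R1]" by (rule pc_L_R[symmetric]) simp
  also have "\<dots> = pc vB [L1] * pc vA [R1]" by (rule pc_Cons) simp
  finally have "pc vB [] * u One * u Two = pc vB [L1] * (pc vA [R1] * u Two)" by (simp add: mult.assoc)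
  also have "pc vA [R1] * u Two = 0" by (intro pc_single_u pc_Nil_u) simp
  finally show ?thesis by simp
qed

lemma u_powers_eq_0:
  "p * u One = 0 \<Longrightarrow> i > 0 \<Longrightarrow> p * u One ^ i * u Two ^ j = 0"
  "p * u Two = 0 \<Longrightarrow> j > 0 \<Longrightarrow> p * u One ^ i * u Two ^ j = 0"
  "p * u One * u Two = 0 \<Longrightarrow> i > 0 \<Longrightarrow> j > 0 \<Longrightarrow> p * u One ^ i * u Two ^ j = 0"
proof -
  assume "p * u One = 0" "i > 0"
  then show "p * u One ^ i * u Two ^ j = 0" by (cases i) (simp_all flip: mult.assoc)
next
  assume *: "p * u Two = 0" "j > 0"
  then obtain k where "j = Suc k" by (cases j) simp_all
  then have "p * u One ^ i * u Two ^ j = p * (u One ^ i * u Two) * u Two ^ k"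
    by (simp add: mult.assoc)
  also have "\<dots> = p * u Two * u One ^ i * u Two ^ k"
    unfolding u_u_power_commute by (simp add: mult.assoc)
  finally show "p * u One ^ i * u Two ^ j = 0" using * by simp
next
  assume *: "p * u One * u Two = 0" "i > 0" "j > 0"
  then obtain h k where hk: "i = Suc h" "j = Suc k" by (cases i; cases j) simp_all
  then have "p * u One ^ i * u Two ^ j = p * u One * (u One ^ h * u Two) * u Two ^ k"
    by (simp add: mult.assoc)
  also have "\<dots> = p * u One * u Two * u One ^ h * u Two ^ k"
    unfolding u_u_power_commute by (simp add: mult.assoc)
  finally show "p * u One ^ i * u Two ^ j = 0" using * by simp
qed

end

section \<open>Reduction of paths to normal form\<close>

context b_embedding begin

text \<open>That the core is a path restricts the parities. At \<open>vA\<close> no such core has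
  odd second weight, so a positive second weight leaves a whole factor \<open>u Two\<close>. At
  \<open>vB\<close> an odd weight makes the core end at \<open>vA\<close> or \<open>vC\<close>,
  where the other loop is zero; if both weights are even, \<open>pc_vB_u_u\<close> applies.\<close>

lemma nf_vanishing:
  assumes "path_end x (core x (odd m) (odd n)) \<noteq> None" "vanishing x m n"
  shows "nf x m n = 0"
proof -
  have div: "k div 2 > 0" if "k > 0" "even k" for k :: nat using that by auto
  have vC: "pc vC [] * u One = 0" and vA: "pc vA [] * u Two = 0" and e: "pc {} [] * u i = 0" for i
    by (rule pc_Nil_u, simp)+
  have *: "pc x (core x (odd m) (odd n)) * u One = 0 \<and> m div 2 > 0 \<or>
    pc x (core x (odd m) (odd n)) * u Two = 0 \<and> n div 2 > 0 \<or>
    pc x (core x (odd m) (odd n)) * u One * u Two = 0 \<and> m div 2 > 0 \<and> n div 2 > 0"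
    using assms div[of m] div[of n]
    by (cases x rule: vertex_cases; cases "odd m"; cases "odd n")
       (auto simp: core_def vA vC e pc_single_u[OF vC] pc_single_u[OF vA] pc_single_u'[OF _ vC]
          pc_single_u'[OF _ vA] pc_vB_u_u)
  then show ?thesis
    unfolding nf_def by (elim disjE conjE) (simp_all add: u_powers_eq_0)
qed

text \<open>An arrow flips one parity. If that parity was odd, the arrow undoes the last arrow of
  the core and leaves a factor \<open>u i\<close>. If it was even, the core grows, or the path runs
  into \<open>R1 R2 = 0\<close> or \<open>L2 L1 = 0\<close>; the vanishing weights in that case are
  stated as lower bounds, to be raised by \<open>vanishing_mono\<close>.\<close>

lemma core_step:
  assumes "path_end x (core x a b @ [l]) \<noteq> None" "l = R i \<or> l = L i"
  shows "path_end x (core x (a \<noteq> (i = One)) (b \<noteq> (i = Two))) = path_end x (core x a b @ [l]) \<and>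
      pc x (core x a b @ [l]) = pc x (core x (a \<noteq> (i = One)) (b \<noteq> (i = Two))) *
        (if a \<and> i = One \<or> b \<and> i = Two then u i else 1) \<or>
    vanishing x (of_bool (a \<or> i = One)) (of_bool (b \<or> i = Two)) \<and> pc x (core x a b @ [l]) = 0"
proof -
  have 1: "pc vAB [R2, R1, L1] = pc vAB [R2] * u One"
    using pc_append[of vAB "[R2]" vAC "[]", symmetric]
    by (simp add: pc_Cons[of R2 vAB vAC "[R1, L1]"] pc_R_L flip: mult.assoc)
  have 2: "pc vBC [L1, L2, R2] = pc vBC [L1] * u Two"
    using pc_append[of vBC "[L1]" vAC "[]", symmetric]
    by (simp add: pc_Cons[of L1 vBC vAC "[L2, R2]"] pc_L_R flip: mult.assoc)
  note r = pc_R_L[of One vA] pc_R_L[of One vAC] pc_R_L[of Two vB] pc_R_L[of Two vAB]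
    pc_L_R[of One vB] pc_L_R[of One vBC] pc_L_R[of Two vC] pc_L_R[of Two vAC]
  consider "l = R1" "i = One" | "l = R2" "i = Two" | "l = L1" "i = One" | "l = L2" "i = Two"
    using assms(2) by (cases i) auto
  then show ?thesis
    using assms(1)
    by cases (cases x rule: vertex_cases; cases a; cases b; simp add: core_def pc_R1_R2 pc_L2_L1 r 1 2)+
qed

lemma nf_times_u: "nf x m n * u i = nf x (m + label_weight One (U i)) (n + label_weight Two (U i))"
proof (cases i)
  case One
  have "p * u One ^ h * u Two ^ k * u One = p * u One ^ Suc h * u Two ^ k" for p h k
  proof -
    have "p * u One ^ h * u Two ^ k * u One = p * u One ^ h * (u Two ^ k * u One)"
      by (simp add: mult.assoc)
    then show ?thesis
      unfolding u_u_power_commute by (simp add: power_Suc2 del: power_Suc flip: mult.assoc)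
  qed
  then show ?thesis by (simp add: nf_def One)
next
  case Two
  then show ?thesis by (simp add: nf_def mult.assoc power_Suc2 del: power_Suc)
qed

lemma nf_times_arrow:
  assumes "path_end x (core x (odd m) (odd n)) = Some y"
  shows "nf x m n * pc y [l] = pc x (core x (odd m) (odd n) @ [l]) * u One ^ (m div 2) * u Two ^ (n div 2)"
  unfolding nf_def pc_append[OF assms] mult.assoc u_power_commute
  by (simp add: u_power_commute flip: mult.assoc)

lemma nf_step:
  assumes "path_end x (core x (odd m) (odd n)) = Some y" "b_target l y = Some z" "l = R i \<or> l = L i"
  defines "m' \<equiv> m + label_weight One l" and "n' \<equiv> n + label_weight Two l"
  shows "path_end x (core x (odd m') (odd n')) = Some z \<and> nf x m n * pc y [l] = nf x m' n' \<or>
    vanishing x m' n' \<and> nf x m n * pc y [l] = 0"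
proof -
  have end_z: "path_end x (core x (odd m) (odd n) @ [l]) = Some z"
    using assms(1,2) by (simp add: path_end_append)
  have odd: "odd m' \<longleftrightarrow> odd m \<noteq> (i = One)" "odd n' \<longleftrightarrow> odd n \<noteq> (i = Two)"
    and le: "of_bool (odd m \<or> i = One) \<le> m'" "of_bool (odd n \<or> i = Two) \<le> n'"
    using assms(3) by (auto simp: m'_def n'_def odd_pos Suc_le_eq split: if_splits)
  \<comment> \<open>The extra factor matches the rounding: adding one to an odd weight raises its
    half by one, adding one to an even weight does not.\<close>
  have step: "p * (if odd m \<and> i = One \<or> odd n \<and> i = Two then u i else 1) * u One ^ (m div 2) * u Two ^ (n div 2) =
      p * u One ^ (m' div 2) * u Two ^ (n' div 2)" for p
  proof (cases i)
    case One
    then show ?thesis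
      using assms(3) by (auto simp: m'_def n'_def mult.assoc)
  next
    case Two
    have "p * u Two * u One ^ h * u Two ^ k = p * u One ^ h * u Two ^ Suc k" for h k
      using u_u_power_commute[of One h Two] by (simp add: mult.assoc) (simp flip: mult.assoc)
    with Two show ?thesis
      using assms(3) by (auto simp: m'_def n'_def)
  qed
  from core_step[of x "odd m" "odd n" l i] end_z assms(3)
  consider "path_end x (core x (odd m') (odd n')) = Some z"
      "pc x (core x (odd m) (odd n) @ [l]) = pc x (core x (odd m') (odd n')) *
        (if odd m \<and> i = One \<or> odd n \<and> i = Two then u i else 1)"
    | "vanishing x (of_bool (odd m \<or> i = One)) (of_bool (odd n \<or> i = Two))"
      "pc x (core x (odd m) (odd n) @ [l]) = 0"
    unfolding odd by force
  then show ?thesis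
  proof cases
    case 1
    then show ?thesis
      unfolding nf_times_arrow[OF assms(1)] by (simp add: step nf_def)
  next
    case 2
    then show ?thesis
      unfolding nf_times_arrow[OF assms(1)] using vanishing_mono[OF _ le] by simp
  qed
qed

text \<open>The word is read letter by letter: a loop raises an exponent, an arrow is handled by
  \<open>nf_step\<close>, and weights that vanish once vanish forever. This is the upper bound only;
  that the remaining normal forms in B(2) are non-zero and distinct is shown with
  \<open>model\<close>.\<close>

lemma pc_normal_form:
  assumes "path_end x w = Some y"
  shows "if vanishing x (weight One w) (weight Two w) then pc x w = 0
    else path_end x (core x (odd (weight One w)) (odd (weight Two w))) = Some y \<and>
      pc x w = nf x (weight One w) (weight Two w)"
  using assms
proof (induction w arbitrary: y rule: rev_induct)
  case Nil
  then show ?case by (auto simp: core_def nf_def vanishing_def)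
next
  case (snoc l w)
  let ?m = "weight One w" and ?n = "weight Two w"
  let ?m' = "weight One (w @ [l])" and ?n' = "weight Two (w @ [l])"
  from snoc.prems obtain z where z: "path_end x w = Some z" "b_target l z = Some y"
    by (auto simp: path_end_append split: option.splits)
  have pc: "pc x (w @ [l]) = pc x w * pc z [l]" by (rule pc_append[OF z(1)])
  show ?case
  proof (cases "vanishing x ?m ?n")
    case True
    then have "vanishing x ?m' ?n'" by (rule vanishing_mono) simp_all
    with True snoc.IH[OF z(1)] show ?thesis by (simp add: pc)
  next
    case False
    then have IH: "path_end x (core x (odd ?m) (odd ?n)) = Some z" "pc x w = nf x ?m ?n"
      using snoc.IH[OF z(1)] by simp_all
    have "path_end x (core x (odd ?m') (odd ?n')) = Some y \<and> pc x (w @ [l]) = nf x ?m' ?n' \<or>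
      vanishing x ?m' ?n' \<and> pc x (w @ [l]) = 0"
    proof (cases "\<exists>i. l = U i")
      case True
      then obtain i where l: "l = U i" by blast
      have "pc x (w @ [l]) = nf x ?m' ?n'"
        unfolding l pc_snoc_U IH(2) nf_times_u by simp
      moreover have "path_end x (core x (odd ?m') (odd ?n')) = Some y"
        using IH(1) z(2) by (simp add: l)
      ultimately show ?thesis by simp
    next
      case False
      then obtain i where "l = R i \<or> l = L i" by (cases l) auto
      from nf_step[OF IH(1) z(2) this] show ?thesis
        unfolding pc IH(2) by simp
    qed
    then show ?thesis using nf_vanishing[of x ?m' ?n'] by auto
  qed
qed

lemma pc_cong:
  assumes "path_end x w = Some y" "path_end x w' = Some y'"
    "weight One w = weight One w'" "weight Two w = weight Two w'"
  shows "pc x w = pc x w'"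
  using pc_normal_form[OF assms(1)] pc_normal_form[OF assms(2)] assms(3,4) by (simp split: if_splits)

lemma pc_vanishing:
  assumes "vanishing x (weight One w) (weight Two w)"
  shows "pc x w = 0"
proof (cases "path_end x w")
  case None
  then show ?thesis by (simp add: pc_def path_class_undefined)
next
  case (Some y)
  from pc_normal_form[OF this] assms show ?thesis by simp
qed

end

interpretation B: b_embedding "\<lambda>l :: b_label. l"
  by standard (simp_all add: relators_b_label_def target_b_label_def)

interpretation S: b_embedding Old
  by standard (auto simp: relators_s_label_def target_s_label_def s_relators_def)

section \<open>The basis of \<open>B(2)\<close>\<close>

text \<open>The model separates the elements of the basis, since it remembers the weights.\<close>

definition path_model :: "b_label path_algebra \<Rightarrow> (vertex \<times> nat \<times> nat \<Rightarrow>\<^sub>0 bit)" where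
  "path_model = lin (\<lambda>s. case path_data s of (x, w) \<Rightarrow>
     if vanishing x (weight One w) (weight Two w) then 0 else gen (x, weight One w, weight Two w))"

lemma path_model_simps [simp]:
  "path_model 0 = 0" "path_model (p + q) = path_model p + path_model q"
  by (simp_all add: path_model_def lin_add)

lemma path_model_path:
  "path_model (path x w) =
    (if path_end x w = None \<or> vanishing x (weight One w) (weight Two w) then 0
     else gen (x, weight One w, weight Two w))"
  by (cases "path_end x w") (simp_all add: path_model_def path_def path_data_Path)

lemma path_model_path_mult:
  "path_model (path_mult (path_mult (path x v) (path y w)) (path z u)) =
    (if path_end x v = Some y \<and> path_end y w = Some z \<and> path_end z u \<noteq> None \<and>
        \<not> vanishing x (weight One (v @ w @ u)) (weight Two (v @ w @ u))
     then gen (x, weight One (v @ w @ u), weight Two (v @ w @ u)) else 0)"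
  by (auto simp: path_mult_path path_model_path path_end_append split: option.splits)

lemma path_model_eq_0:
  assumes "path_end y w = None \<or> vanishing y (weight One w) (weight Two w)"
  shows "path_model (path_mult (path_mult (path x v) (path y w)) (path z u)) = 0"
proof (cases "path_end x v = Some y \<and> path_end y w \<noteq> None")
  case True
  with assms have "vanishing x (weight One v + weight One w) (weight Two v + weight Two w)"
    by (intro path_end_vanishing) auto
  then have "vanishing x (weight One (v @ w @ u)) (weight Two (v @ w @ u))"
    by (rule vanishing_mono) simp_all
  then show ?thesis by (simp only: path_model_path_mult) simp
next
  case False
  then show ?thesis by (auto simp: path_model_path_mult)
qed

lemma path_model_cancel:
  assumes "path_end y w = path_end y w'" "weight One w = weight One w'" "weight Two w = weight Two w'"
  shows "path_model (path_mult (path_mult (path x v) (path y w)) (path z u)) +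
    path_model (path_mult (path_mult (path x v) (path y w')) (path z u)) = 0"
  by (simp only: path_model_path_mult weight_simps assms f2_add_self)

lemma b_target_R_L:
  "b_target (R i) x = Some y \<Longrightarrow> b_target (L i) y = Some x"
  "b_target (L i) x = Some y \<Longrightarrow> b_target (R i) y = Some x"
  by (cases x rule: vertex_cases; cases i; auto)+

text \<open>A binomial relation equates two paths with the same end and weights, so their images
  cancel modulo two in every context. A monomial relation is either not a path or has vanishing
  weights, and both properties persist under prepending and appending. Hence
  \<open>path_model\<close> descends to B(2).\<close>

lemma path_model_relation:
  assumes "r \<in> relations"
  shows "path_model (path_mult (path_mult p r) q) = 0"
proof -
  from assms obtain y ws where ws: "(y, ws) \<in> common_relators (\<lambda>l. l) b_target"
    and r: "r = (\<Sum>w\<leftarrow>ws. path y w)"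
    by (auto simp: relations_def relators_b_label_def)
  have "path_model (path_mult (path_mult (path x v) r) (path z u)) = 0" for x v z u
  proof -
    consider i l where "ws = [[U i, l], [l, U i]]"
      | i z where "ws = [[R i, L i], [U i]]" "b_target (R i) y = Some z"
      | i z where "ws = [[L i, R i], [U i]]" "b_target (L i) y = Some z"
      | "ws = [[R1, R2]]" | "ws = [[L2, L1]]" | i where "ws = [[U i]]" "y \<inter> {lo i, hi i} = {}"
      using ws unfolding common_relators_def by (simp only: Un_iff) auto
    then show ?thesis
    proof cases
      case 1
      then show ?thesis
        by (simp add: r path_mult_add_left path_mult_add_right path_model_cancel split: option.split)
    next
      case 2
      with b_target_R_L[of i y] show ?thesis
        by (simp add: r path_mult_add_left path_mult_add_right path_model_cancel)
    next
      case 3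
      with b_target_R_L[of i y] show ?thesis
        by (simp add: r path_mult_add_left path_mult_add_right path_model_cancel)
    next
      case 4
      have "path_end y [R1, R2] = None \<or> vanishing y (weight One [R1, R2]) (weight Two [R1, R2])"
        by (cases y rule: vertex_cases) simp_all
      with 4 show ?thesis by (simp add: r path_model_eq_0)
    next
      case 5
      have "path_end y [L2, L1] = None \<or> vanishing y (weight One [L2, L1]) (weight Two [L2, L1])"
        by (cases y rule: vertex_cases) simp_all
      with 5 show ?thesis by (simp add: r path_model_eq_0)
    next
      case 6
      then have "vanishing y (weight One [U i]) (weight Two [U i])"
        by (cases y rule: vertex_cases; cases i) simp_all
      with 6 show ?thesis by (simp add: r path_model_eq_0)
    qed
  qed
  then show ?thesis
  proof (induction p rule: path_induct)
    case (path x v y)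
    then show ?case
      by (induction q rule: path_induct) (simp_all add: path_mult_add_right)
  qed (simp_all add: path_mult_add_left)
qed

lemma path_model_ideal:
  assumes "p \<in> relation_ideal"
  shows "path_model p = 0"
  using assms[unfolded relation_ideal_def]
proof (induction p rule: F2.span_induct_alt)
  case (step c x y)
  then show ?case by (auto simp: f2_scale_def path_model_relation)
qed simp

lift_definition model :: "B2 \<Rightarrow> (vertex \<times> nat \<times> nat \<Rightarrow>\<^sub>0 bit)" is path_model
  by (rule f2_eqI) (metis path_model_ideal path_model_simps(2) quotient_eqD)

lemma model_zero [simp]: "model 0 = 0"
  by transfer simp

lemma model_add [simp]: "model (a + b) = model a + model b"
  by transfer simp

lemma model_path_class:
  "model (path_class x w) =
    (if path_end x w = None \<or> vanishing x (weight One w) (weight Two w) then 0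
     else gen (x, weight One w, weight Two w))"
  by transfer (rule path_model_path)

text \<open>By \<open>path_class_eq_0\<close> and \<open>model_nonzero_path\<close> these are
  exactly the label sequences with non-zero class in B(2).\<close>

definition nonzero_path :: "vertex \<Rightarrow> b_label list \<Rightarrow> bool" where
  "nonzero_path x w \<longleftrightarrow> path_end x w \<noteq> None \<and> \<not> vanishing x (weight One w) (weight Two w)"

lemma model_nonzero_path: "nonzero_path x w \<Longrightarrow> model (path_class x w) = gen (x, weight One w, weight Two w)"
  by (auto simp: model_path_class nonzero_path_def)

lemma path_class_B_cong:
  assumes "path_end x w \<noteq> None" "path_end x w' \<noteq> None"
    "weight One w = weight One w'" "weight Two w = weight Two w'"
  shows "path_class x w = path_class x w'"
  using B.pc_cong[of x w _ w'] assms by (auto simp: B.pc_def)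

lemma path_class_eq_0: "\<not> nonzero_path x w \<Longrightarrow> path_class x w = 0"
  using B.pc_vanishing[of x w] path_class_undefined[of x w]
  by (auto simp: nonzero_path_def B.pc_def)

lemma path_class_eq_iff:
  assumes "nonzero_path x w"
  shows "path_class y v = path_class x w \<longleftrightarrow>
    path_end y v \<noteq> None \<and> y = x \<and> weight One v = weight One w \<and> weight Two v = weight Two w"
proof
  assume *: "path_class y v = path_class x w"
  then have "model (path_class y v) = gen (x, weight One w, weight Two w)"
    by (simp add: model_nonzero_path[OF assms])
  then show "path_end y v \<noteq> None \<and> y = x \<and> weight One v = weight One w \<and> weight Two v = weight Two w"
    by (auto simp: model_path_class poly_mapping_eq_iff lookup_single fun_eq_iff when_def split: if_splits)
next
  assume "path_end y v \<noteq> None \<and> y = x \<and> weight One v = weight One w \<and> weight Two v = weight Two w"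
  then show "path_class y v = path_class x w"
    using assms path_class_B_cong[of x v w] by (auto simp: nonzero_path_def)
qed

lemma path_end_replicate_U [simp]: "path_end x (replicate k (U i)) = Some x"
  by (induction k) simp_all

lemma nf_eq_path_class:
  "B.nf x m n =
    path_class x (core x (odd m) (odd n) @ replicate (m div 2) U1 @ replicate (n div 2) U2)"
proof -
  have "B.pc x w * B.u i ^ k = B.pc x (w @ replicate k (U i))" for w i k
  proof (induction k)
    case (Suc k)
    then have "B.pc x w * B.u i ^ Suc k = B.pc x ((w @ replicate k (U i)) @ [U i])"
      unfolding B.pc_snoc_U by (simp add: power_Suc2 del: power_Suc flip: mult.assoc)
    then show ?case by (simp add: replicate_append_same)
  qed simp
  then show ?thesis by (simp add: B.nf_def B.pc_def)
qed

section \<open>The listed basis consists of the non-zero paths\<close>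

lemma B2_basis_memI:
  "idem {} \<in> B2_basis"
  "path_class vA (replicate i U1) \<in> B2_basis" "path_class vA (R1 # replicate i U1) \<in> B2_basis"
  "path_class vB (L1 # replicate i U1) \<in> B2_basis" "path_class vB (R2 # replicate i U2) \<in> B2_basis"
  "idem vB \<in> B2_basis"
  "path_class vB (U1 # replicate i U1) \<in> B2_basis" "path_class vB (U2 # replicate i U2) \<in> B2_basis"
  "path_class vC (L2 # replicate i U2) \<in> B2_basis" "path_class vC (replicate i U2) \<in> B2_basis"
  "path_class vABC (replicate i U1 @ replicate j U2) \<in> B2_basis"
  unfolding B2_basis_def Un_iff mem_Collect_eq Suc_eq_plus1[symmetric] replicate_Suc by blast+

lemma B2_basis_memI2:
  assumes "(x, p) \<in> {(vAB, []), (vAC, []), (vBC, []), (vAB, [R2]), (vAB, [R2, R1]), (vAC, [L2]),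
                  (vAC, [R1]), (vBC, [L1, L2]), (vBC, [L1])}"
  shows "path_class x (p @ replicate i U1 @ replicate j U2) \<in> B2_basis"
  unfolding B2_basis_def
  by (rule UnI1, rule UnI2, rule CollectI, rule exI[of _ x], rule exI[of _ p], rule exI[of _ i],
      rule exI[of _ j], rule conjI[OF refl assms])

lemma B2_basis_cases:
  assumes "b \<in> B2_basis"
  obtains x w where "b = path_class x w" "nonzero_path x w"
proof -
  have "nonzero_path {} []"
    "\<And>i. nonzero_path vA (replicate i U1)" "\<And>i. nonzero_path vA (R1 # replicate i U1)"
    "\<And>i. nonzero_path vB (L1 # replicate i U1)" "nonzero_path vB []"
    "\<And>i. nonzero_path vB (replicate (i + 1) U1)" "\<And>i. nonzero_path vB (replicate (i + 1) U2)"
    "\<And>i. nonzero_path vB (R2 # replicate i U2)" "\<And>i. nonzero_path vC (L2 # replicate i U2)"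
    "\<And>i. nonzero_path vC (replicate i U2)"
    "\<And>x p i j. (x, p) \<in> {(vAB, []), (vAC, []), (vBC, []), (vAB, [R2]), (vAB, [R2, R1]), (vAC, [L2]),
                  (vAC, [R1]), (vBC, [L1, L2]), (vBC, [L1])} \<Longrightarrow>
        nonzero_path x (p @ replicate i U1 @ replicate j U2)"
    "\<And>i j. nonzero_path vABC (replicate i U1 @ replicate j U2)"
    by (auto simp: nonzero_path_def path_end_append)
  note np = this
  have "\<exists>x w. b = path_class x w \<and> nonzero_path x w"
    using assms unfolding B2_basis_def
    by (elim UnE CollectE exE conjE singletonE)
       (rule exI, rule exI, rule conjI, assumption, (rule np(1-10,12) | rule np(11), assumption))+
  then show ?thesis using that by blast
qed

text \<open>Written out as a core followed by loops, the normal form is literally one of the listed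
  words. At \<open>vB\<close> only one kind of loop can be left, since non-vanishing forces one
  weight to be zero.\<close>

lemma nonzero_path_in_B2_basis:
  assumes "nonzero_path x w"
  shows "path_class x w \<in> B2_basis"
proof -
  define m n where "m = weight One w" and "n = weight Two w"
  from assms obtain y where y: "path_end x w = Some y" and nv: "\<not> vanishing x m n"
    by (auto simp: nonzero_path_def m_def n_def)
  from B.pc_normal_form[OF y] nv
  have eq: "path_class x w = path_class x (core x (odd m) (odd n) @ replicate (m div 2) U1 @ replicate (n div 2) U2)"
    and core: "path_end x (core x (odd m) (odd n)) \<noteq> None"
    by (simp_all add: m_def n_def nf_eq_path_class[symmetric] B.pc_def)
  have vB: "path_class vB (replicate k U1) \<in> B2_basis" "path_class vB (replicate k U2) \<in> B2_basis" for k
    by (cases k; simp add: B2_basis_memI)+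
  note mem2 = B2_basis_memI2[of x "core x (odd m) (odd n)" "m div 2" "n div 2"]
  show ?thesis
    unfolding eq using core nv mem2
    by (cases x rule: vertex_cases; cases "odd m"; cases "odd n") (auto simp: core_def B2_basis_memI vB)
qed

lemma B2_basis_eq: "B2_basis = {path_class x w |x w. nonzero_path x w}"
proof (intro equalityI subsetI)
  fix b assume "b \<in> B2_basis"
  then obtain x w where "b = path_class x w" "nonzero_path x w" by (rule B2_basis_cases)
  then show "b \<in> {path_class x w |x w. nonzero_path x w}" by blast
qed (auto simp: nonzero_path_in_B2_basis)

text \<open>Distinct basis elements have distinct generators as models, so reading the model of a
  linear relation at the generator of \<open>b\<close> isolates the coefficient of
  \<open>b\<close>.\<close>

lemma independent_B2_basis: "\<not> F2.dependent B2_basis"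
proof
  assume "F2.dependent B2_basis"
  then obtain S c b where S: "finite S" "S \<subseteq> B2_basis" "b \<in> S" "c b \<noteq> 0"
    and sum: "(\<Sum>a\<in>S. f2_scale (c a) a) = 0"
    unfolding F2.dependent_explicit by blast
  have "model (\<Sum>a\<in>T. f2_scale (c a) a) = (\<Sum>a\<in>T. f2_scale (c a) (model a))" if "finite T" for T
    using that by (induction T) (simp_all add: f2_scale_def)
  from this[OF S(1)] have sum: "(\<Sum>a\<in>S. f2_scale (c a) (model a)) = 0" by (simp add: sum)
  from S obtain x w where b: "b = path_class x w" "nonzero_path x w" by (auto simp: B2_basis_eq)
  have "Poly_Mapping.lookup (f2_scale (c a) (model a)) (x, weight One w, weight Two w) = (if a = b then 1 else 0)"
    if "a \<in> S" for a
  proof -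
    from that S obtain y v where a: "a = path_class y v" "nonzero_path y v" by (auto simp: B2_basis_eq)
    show ?thesis
    proof (cases "a = b")
      case True
      with S(4) have "c a = 1" by simp
      with True show ?thesis
        by (simp add: f2_scale_def b(1) model_nonzero_path[OF b(2)])
    next
      case False
      then have "(y, weight One v, weight Two v) \<noteq> (x, weight One w, weight Two w)"
        using a b path_class_eq_iff[OF b(2), of y v] by (auto simp: nonzero_path_def)
      with False show ?thesis
        by (auto simp: f2_scale_def a(1) model_nonzero_path[OF a(2)] lookup_single when_def)
    qed
  qed
  then have "(\<Sum>a\<in>S. Poly_Mapping.lookup (f2_scale (c a) (model a)) (x, weight One w, weight Two w)) = 1"
    using S(1,3) by simp
  moreover have "Poly_Mapping.lookup (\<Sum>a\<in>S. f2_scale (c a) (model a)) (x, weight One w, weight Two w) = 0"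
    by (simp add: sum)
  ultimately show False by (simp add: lookup_sum)
qed

lemma span_B2_basis: "a \<in> F2.span B2_basis"
proof -
  have "abs_quiver_algebra p \<in> F2.span B2_basis" for p :: "b_label path_algebra"
  proof (induction p rule: path_induct)
    case (path x ls y)
    have "path_class x ls \<in> F2.span B2_basis"
    proof (cases "nonzero_path x ls")
      case True
      then show ?thesis by (intro F2.span_base) (auto simp: B2_basis_eq)
    qed (simp add: path_class_eq_0 F2.span_zero)
    then show ?case by (simp add: path_class.abs_eq)
  qed (simp_all add: F2.span_zero F2.span_add zero_quiver_algebra.abs_eq[symmetric] plus_quiver_algebra.abs_eq[symmetric])
  from this[of "rep_quiver_algebra a"] show ?thesis
    by (simp add: Quotient3_abs_rep[OF Quotient3_quiver_algebra])
qed

text \<open>Independence and spanning enter here: they turn \<open>representation\<close> into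
  genuine linear coordinates.\<close>

lemma B2_coef_add: "B2_coef b (a + a') = B2_coef b a + B2_coef b a'"
  by (simp add: B2_coef_def F2.representation_add independent_B2_basis span_B2_basis)

lemma B2_coef_zero [simp]: "B2_coef b 0 = 0"
  by (simp add: B2_coef_def F2.representation_zero)

lemma B2_coef_path_class:
  assumes "nonzero_path x w"
  shows "B2_coef (path_class x w) (path_class y v) =
    (if path_end y v \<noteq> None \<and> y = x \<and> weight One v = weight One w \<and> weight Two v = weight Two w
     then 1 else 0)"
proof (cases "nonzero_path y v")
  case True
  then have "path_class y v \<in> B2_basis" by (auto simp: B2_basis_eq)
  then show ?thesis
    unfolding path_class_eq_iff[OF assms, symmetric]
    by (auto simp: B2_coef_def F2.representation_basis independent_B2_basis)
next
  case False
  with assms have "\<not> (path_end y v \<noteq> None \<and> y = x \<and> weight One v = weight One w \<and> weight Two v = weight Two w)"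
    by (auto simp: nonzero_path_def)
  with False show ?thesis by (simp add: path_class_eq_0)
qed

section \<open>Contraction against iterates of \<open>\<delta>\<^sup>1\<close>\<close>

lemma tens_zero [simp]: "0 \<otimes> b = 0" "a \<otimes> 0 = 0"
  using tens_add_left[of 0 0 b] tens_add_right[of a 0 0] by (simp_all add: f2_add_self)

definition biadditive :: "('a::f2_space \<Rightarrow> 'b::f2_space \<Rightarrow> 'c::f2_space) \<Rightarrow> bool" where
  "biadditive f \<longleftrightarrow> (\<forall>a a' b. f (a + a') b = f a b + f a' b) \<and> (\<forall>a b b'. f a (b + b') = f a b + f a b')"

text \<open>A biadditive \<open>f\<close> kills the span of \<open>tensor_rels\<close>, so the
  representative chosen by \<open>rep_tensor\<close> may be replaced by any other.\<close>

lemma tensor_lift_abs: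
  assumes "biadditive f"
  shows "tensor_lift f (abs_tensor p) = lin (\<lambda>(a, b). f a b) p"
proof -
  have "lin (\<lambda>(a, b). f a b) r = 0" if "r \<in> F2.span tensor_rels" for r
    using that
  proof (induction r rule: F2.span_induct_alt)
    case (step c x y)
    have "p + q + p + q = 0" for p q :: 'c
      using f2_add_self[of "p + q"] by (simp add: add.assoc)
    with step(1) have "lin (\<lambda>(a, b). f a b) x = 0"
      using assms by (cases rule: tensor_rels_cases) (simp_all add: lin_add biadditive_def)
    with step(2) show ?case by (simp add: f2_scale_def lin_add)
  qed simp
  moreover have "rep_tensor (abs_tensor p) + p \<in> F2.span tensor_rels"
    using Quotient3_rel_rep[OF Quotient3_tensor, of "abs_tensor p"]
      rep_abs_rsp_left[OF Quotient3_tensor, of p p] equivp_reflp[OF tensor_equivp, of p]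
    by (simp add: tensor_eq_def f2_diff)
  ultimately have "lin (\<lambda>(a, b). f a b) (rep_tensor (abs_tensor p)) + lin (\<lambda>(a, b). f a b) p = 0"
    by (simp flip: lin_add)
  then show ?thesis
    unfolding tensor_lift_def by (rule f2_eqI)
qed

lemma tensor_lift_tens: "biadditive f \<Longrightarrow> tensor_lift f (a \<otimes> b) = f a b"
  by (simp add: tens.abs_eq tensor_lift_abs)

lemma tensor_lift_add:
  assumes "biadditive f"
  shows "tensor_lift f (s + t) = tensor_lift f s + tensor_lift f t"
proof -
  have "tensor_lift f (abs_tensor p + abs_tensor q) = tensor_lift f (abs_tensor p) + tensor_lift f (abs_tensor q)" for p q
    by (simp add: plus_tensor.abs_eq tensor_lift_abs[OF assms] lin_add)
  from this[of "rep_tensor s" "rep_tensor t"] show ?thesis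
    by (simp add: Quotient3_abs_rep[OF Quotient3_tensor])
qed

lemma tensor_lift_zero [simp]:
  assumes "biadditive f"
  shows "tensor_lift f 0 = 0"
  using tensor_lift_add[OF assms, of 0 0] by (simp add: f2_add_self)

lemma tensor_lift_sum:
  assumes "biadditive f"
  shows "tensor_lift f (\<Sum>i\<in>I. t i) = (\<Sum>i\<in>I. tensor_lift f (t i))"
  by (induction I rule: infinite_finite_induct) (simp_all add: assms tensor_lift_add)

lemma tensor_lift_const_zero [simp]: "tensor_lift (\<lambda>a b. 0) t = 0"
  by (simp add: tensor_lift_def case_prod_unfold)

text \<open>Linearity in the function is immediate, as all three terms are evaluated on the same
  representative of \<open>t\<close>.\<close>

lemma tensor_lift_add_fun: "tensor_lift (\<lambda>a b. f a b + g a b) t = tensor_lift f t + tensor_lift g t"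
  by (simp add: tensor_lift_def case_prod_unfold lin_add_fun)

text \<open>Absorbing the collected inputs into the operation restores the empty accumulator, which
  lets inputs be stripped off one at a time.\<close>

lemma contract_shift: "contract f as b ts = contract (\<lambda>as'. f (as @ as')) [] b ts"
proof (induction ts arbitrary: f as b)
  case (Cons t ts)
  have "contract (\<lambda>as'. f (as @ as')) [a] b' ts = contract f (as @ [a]) b' ts" for a b'
    by (subst (1 2) Cons.IH) simp
  then show ?case by simp
qed simp

lemma contract_zero [simp]: "contract (\<lambda>as. 0) as b ts = 0"
  by (induction ts arbitrary: as b) simp_all

lemma contract_add: "contract (\<lambda>as. f as + g as) as b ts = contract f as b ts + contract g as b ts"
  by (induction ts arbitrary: as b) (simp_all add: tens_add_left tensor_lift_add_fun)

lemma contract_sum_list: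
  "contract (\<lambda>as. \<Sum>x\<leftarrow>xs. f x as) as b ts = (\<Sum>x\<leftarrow>xs. contract (f x) as b ts)"
  by (induction xs) (simp_all add: contract_add)

lemma contract_scale: "contract (\<lambda>as. f2_scale s (f as)) as b ts = f2_scale s (contract f as b ts)"
  by (cases s) (simp_all add: f2_scale_def)

lemma contract_add_right: "contract f as (b + b') ts = contract f as b ts + contract f as b' ts"
  by (induction ts arbitrary: as b b')
     (simp_all add: tens_add_right distrib_right tensor_lift_add_fun)

lemma contract_eq_0:
  "(\<And>as'. length as' = length as + length ts \<Longrightarrow> f as' = 0) \<Longrightarrow> contract f as b ts = 0"
proof (induction ts arbitrary: as b)
  case (Cons t ts)
  have "contract f (as @ [a]) b' ts = 0" for a b'
    by (rule Cons.IH) (simp add: Cons.prems)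
  then show ?case by simp
qed simp

section \<open>Dual labels and the differential of \<open>K_DD\<close>\<close>

primrec dual :: "b_label \<Rightarrow> s_label" where
  "dual (R i) = Old (L i)"
| "dual (L i) = Old (R i)"
| "dual (U i) = C i"

lemma compl_vertex:
  "- {} = vABC" "- vA = vBC" "- vB = vAC" "- vC = vAB" "- vAB = vC" "- vAC = vB" "- vBC = vA" "- vABC = {}"
  by (simp_all add: vertex_eq_iff)

text \<open>Moving an element of \<open>x\<close> one place to the right moves an element of the
  complement one place to the left, which is why R and L are exchanged.\<close>

lemma s_target_dual: "s_target (dual l) (- x) = map_option uminus (b_target l x)"
  by (cases x rule: vertex_cases; cases l rule: b_label_cases)
     (simp_all only: compl_vertex dual.simps s_target.simps b_target_table b_target.simps(3) option.map)

lemma UNIV_b_label: "UNIV = {R1, R2, L1, L2, U1, U2}"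
  using b_label_cases by blast

lemma dd_coef_K:
  "dd_coef K_DD x y =
    (\<Sum>l\<in>UNIV. if b_target l x = Some y then path_class x [l] \<otimes> path_class (- x) [dual l] else 0)"
proof -
  have "(idem x \<otimes> idem (- x)) * (label_sum l \<otimes> label_sum (dual l)) * (idem y \<otimes> idem (- y)) =
      (if b_target l x = Some y then path_class x [l] \<otimes> path_class (- x) [dual l] else 0)" for l
    by (auto simp: tens_mult path_class_times_label_sum path_class_times_idem s_target_dual split: option.split)
  from this[of "L i" for i] this[of "R i" for i] this[of "U i" for i] show ?thesis
    by (simp add: K_DD_def UNIV_idx UNIV_b_label distrib_left distrib_right ac_simps)
qed

text \<open>\<open>pairing v ps c ts b\<close> evaluates at \<open>ts\<close> an operation whose only nonzero term has inputs \<open>ps\<close>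
  (starting at \<open>v\<close>) and output \<open>c\<close>; \<open>total_pairing\<close> sums this over the terms of an iterate of the
  \<open>\<delta>\<^sup>1\<close> of \<open>K\<close>.\<close>

definition pairing :: "vertex \<Rightarrow> b_label list list \<Rightarrow> B2 \<Rightarrow> BB list \<Rightarrow> B2_dual \<Rightarrow> BB" where
  "pairing v ps c ts b = contract (\<lambda>as. f2_scale (input_coef v ps as) c) [] b ts"

lemma pairing_simps:
  "pairing v [] c [] b = c \<otimes> b"
  "pairing v (p # ps) c [] b = 0"
  by (simp_all add: pairing_def f2_scale_def)

lemma pairing_Nil_Cons: "pairing v [] c (t # ts) b = 0"
  unfolding pairing_def contract.simps by (subst contract_shift) (simp add: f2_scale_def)

lemma f2_scale_mult: "f2_scale (r * s) x = f2_scale r (f2_scale s x)"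
  by (simp add: f2_scale_def)

lemma pairing_Cons:
  "pairing v (p # ps) c (t # ts) b =
    tensor_lift (\<lambda>a b'. f2_scale (B2_coef (path_class v p) a)
      (pairing (the (path_end v p)) ps c ts (b * b'))) t"
  unfolding pairing_def contract.simps
  by (subst contract_shift) (simp only: append.simps input_coef.simps f2_scale_mult contract_scale)

lemma biadditive_pairing:
  "biadditive (\<lambda>a b'. f2_scale (B2_coef (path_class v p) a) (pairing v' ps c ts (b * b')))"
  unfolding biadditive_def B2_coef_add F2.scale_left_distrib pairing_def distrib_left
    contract_add_right F2.scale_right_distrib by blast

lemma pairing_K:
  "pairing v (p # ps) c (dd_coef K_DD x y # ts) b =
    (\<Sum>l\<in>UNIV. if b_target l x = Some y
       then f2_scale (B2_coef (path_class v p) (path_class x [l]))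
         (pairing (the (path_end v p)) ps c ts (b * path_class (- x) [dual l]))
       else 0)"
  unfolding pairing_Cons dd_coef_K tensor_lift_sum[OF biadditive_pairing]
  by (intro sum.cong refl) (simp add: biadditive_pairing tensor_lift_tens)

lemma K_gens [simp]: "dd_gens K_DD = UNIV" "dd_idem1 K_DD x = x" "dd_idem2 K_DD x = - x" "dd_degree K_DD x = 0"
  by (simp_all add: K_DD_def)

section \<open>Sums over chains in \<open>K_DD\<close>\<close>

lemma dd_chains_iff:
  "ks \<in> dd_chains K_DD n k k' \<longleftrightarrow> length ks = Suc n \<and> hd ks = k \<and> last ks = k'"
  by (simp add: dd_chains_def)

lemma dd_chains_0: "dd_chains K_DD 0 k k' = (if k = k' then {[k]} else {})"
proof -
  have "ks \<in> dd_chains K_DD 0 k k' \<longleftrightarrow> k = k' \<and> ks = [k]" for ks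
    unfolding dd_chains_iff by (cases ks rule: remdups_adj.cases) fastforce+
  then show ?thesis by simp blast
qed

lemma dd_chains_Suc: "dd_chains K_DD (Suc n) k k' = (\<Union>k1. (#) k ` dd_chains K_DD n k1 k')"
proof (intro equalityI subsetI)
  fix ks assume ks: "ks \<in> dd_chains K_DD (Suc n) k k'"
  then obtain ls where ls: "ks = k # ls" "length ls = Suc n"
    unfolding dd_chains_iff by (cases ks) simp_all
  then have "ls \<noteq> []" by auto
  with ks ls have "ls \<in> dd_chains K_DD n (hd ls) k'"
    unfolding dd_chains_iff by simp
  with ls(1) show "ks \<in> (\<Union>k1. (#) k ` dd_chains K_DD n k1 k')" by blast
next
  fix ks assume "ks \<in> (\<Union>k1. (#) k ` dd_chains K_DD n k1 k')"
  then obtain k1 ls where "ks = k # ls" "ls \<in> dd_chains K_DD n k1 k'" by blast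
  then show "ks \<in> dd_chains K_DD (Suc n) k k'"
    unfolding dd_chains_iff by auto
qed

lemma finite_dd_chains: "finite (dd_chains K_DD n k k')"
  by (induction n arbitrary: k) (simp_all add: dd_chains_0 dd_chains_Suc)

definition total_pairing where
  "total_pairing v ps c b n k k' =
    (\<Sum>ks\<in>dd_chains K_DD n k k'. pairing v ps c (chain_coefs K_DD ks) b)"

lemma total_pairing_Suc:
  "total_pairing v ps c b (Suc n) k k' =
    (\<Sum>k1\<in>UNIV. \<Sum>ks\<in>dd_chains K_DD n k1 k'. pairing v ps c (dd_coef K_DD k k1 # chain_coefs K_DD ks) b)"
proof -
  have "total_pairing v ps c b (Suc n) k k' =
      (\<Sum>k1\<in>UNIV. \<Sum>ks\<in>(#) k ` dd_chains K_DD n k1 k'. pairing v ps c (chain_coefs K_DD ks) b)"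
    unfolding total_pairing_def dd_chains_Suc
  proof (rule sum.UNION_disjoint)
    show "\<forall>k1\<in>UNIV. \<forall>k2\<in>UNIV. k1 \<noteq> k2 \<longrightarrow>
        (#) k ` dd_chains K_DD n k1 k' \<inter> (#) k ` dd_chains K_DD n k2 k' = {}"
      by (intro ballI impI equals0I) (elim IntE imageE, simp add: dd_chains_iff)
  qed (simp_all add: finite_dd_chains)
  also have "\<dots> = (\<Sum>k1\<in>UNIV. \<Sum>ks\<in>dd_chains K_DD n k1 k'. pairing v ps c (chain_coefs K_DD (k # ks)) b)"
    by (simp add: sum.reindex)
  also have "\<dots> = (\<Sum>k1\<in>UNIV. \<Sum>ks\<in>dd_chains K_DD n k1 k'. pairing v ps c (dd_coef K_DD k k1 # chain_coefs K_DD ks) b)"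
    by (intro sum.cong refl arg_cong[where f = "\<lambda>ts. pairing v ps c ts b"])
       (auto simp only: dd_chains_iff chain_coefs_def length_Suc_conv, simp)
  finally show ?thesis .
qed

lemma total_pairing_simps:
  "total_pairing v [] c b 0 k k' = (if k = k' then c \<otimes> b else 0)"
  "total_pairing v (p # ps) c b 0 k k' = 0"
  "total_pairing v [] c b (Suc n) k k' = 0"
  by (simp_all add: total_pairing_def[where n = 0] dd_chains_0 chain_coefs_def pairing_simps pairing_Nil_Cons total_pairing_Suc)

text \<open>The next vertex of a chain is determined by the label leading to it, so the sum over
  chains becomes a sum over label sequences.\<close>

lemma total_pairing_Cons:
  "total_pairing v (p # ps) c b (Suc n) k k' =
    (\<Sum>l\<in>UNIV. case b_target l k of None \<Rightarrow> 0 | Some k1 \<Rightarrow>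
       f2_scale (B2_coef (path_class v p) (path_class k [l]))
         (total_pairing (the (path_end v p)) ps c (b * path_class (- k) [dual l]) n k1 k'))"
proof -
  have "total_pairing v (p # ps) c b (Suc n) k k' =
    (\<Sum>k1\<in>UNIV. \<Sum>l\<in>UNIV. if b_target l k = Some k1
       then f2_scale (B2_coef (path_class v p) (path_class k [l]))
         (total_pairing (the (path_end v p)) ps c (b * path_class (- k) [dual l]) n k1 k')
       else 0)"
    unfolding total_pairing_Suc pairing_K
    by (subst sum.swap, intro sum.cong refl) (simp add: total_pairing_def F2.scale_sum_right)
  also have "\<dots> = (\<Sum>l\<in>UNIV. \<Sum>k1\<in>UNIV. if b_target l k = Some k1
       then f2_scale (B2_coef (path_class v p) (path_class k [l]))
         (total_pairing (the (path_end v p)) ps c (b * path_class (- k) [dual l]) n k1 k')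
       else 0)"
    by (rule sum.swap)
  also have "\<dots> = (\<Sum>l\<in>UNIV. case b_target l k of None \<Rightarrow> 0 | Some k1 \<Rightarrow>
       f2_scale (B2_coef (path_class v p) (path_class k [l]))
         (total_pairing (the (path_end v p)) ps c (b * path_class (- k) [dual l]) n k1 k'))"
    by (intro sum.cong refl) (simp split: option.split)
  finally show ?thesis .
qed

lemma total_pairing_length: "n \<noteq> length ps \<Longrightarrow> total_pairing v ps c b n k k' = 0"
proof (induction ps arbitrary: v b n k)
  case Nil
  then show ?case by (cases n) (simp_all add: total_pairing_simps)
next
  case (Cons p ps)
  show ?case
  proof (cases n)
    case (Suc m)
    with Cons show ?thesis by (auto simp: total_pairing_Cons split: option.split intro!: sum.neutral)
  qed (simp add: total_pairing_simps)
qed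

lemma B2_coef_0_left [simp]: "B2_coef 0 a = 0"
proof (rule ccontr)
  assume "B2_coef 0 a \<noteq> 0"
  then have "0 \<in> B2_basis" unfolding B2_coef_def by (rule F2.representation_ne_zero)
  with independent_B2_basis show False using F2.dependent_zero by blast
qed

definition label_weights :: "(nat \<times> nat) set" where
  "label_weights = {(1, 0), (0, 1), (2, 0), (0, 2)}"

lemma label_weights: "(label_weight One l, label_weight Two l) \<in> label_weights"
  by (cases l rule: b_label_cases) (simp_all add: label_weights_def)

lemma B2_coef_not_label:
  assumes "(weight One p, weight Two p) \<notin> label_weights"
  shows "B2_coef (path_class v p) (path_class k [l]) = 0"
proof (cases "nonzero_path v p")
  case True
  then show ?thesis
    using assms label_weights[of l] by (auto simp: B2_coef_path_class)
qed (simp add: path_class_eq_0)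

lemma total_pairing_not_label:
  assumes "p \<in> set ps" "(weight One p, weight Two p) \<notin> label_weights"
  shows "total_pairing v ps c b n k k' = 0"
  using assms(1)
proof (induction ps arbitrary: v b n k)
  case (Cons q ps)
  show ?case
  proof (cases n)
    case (Suc m)
    from Cons have "q = p \<or> (\<forall>v b n k. total_pairing v ps c b n k k' = 0)" by auto
    then show ?thesis
      using B2_coef_not_label[OF assms(2)]
      by (auto simp: Suc total_pairing_Cons split: option.split intro!: sum.neutral)
  qed (simp add: total_pairing_simps)
qed simp

text \<open>Each label is tested separately because the inputs sit in different tensor factors: the
  input pair \<open>R1\<close>, \<open>R2\<close> from \<open>vA\<close> is allowed although the
  product is zero.\<close>

primrec nonzero_labels :: "vertex \<Rightarrow> b_label list \<Rightarrow> bool" where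
  "nonzero_labels x [] \<longleftrightarrow> True"
| "nonzero_labels x (l # ls) \<longleftrightarrow> nonzero_path x [l] \<and> nonzero_labels (the (b_target l x)) ls"

text \<open>Only \<open>R i\<close> and \<open>L i\<close> share their weights, and they never leave
  the same vertex.\<close>

lemma label_eqI:
  assumes "b_target l x \<noteq> None" "b_target l' x \<noteq> None"
    "label_weight One l = label_weight One l'" "label_weight Two l = label_weight Two l'"
  shows "l = l'"
  using assms
  by (cases l rule: b_label_cases; cases l' rule: b_label_cases; cases x rule: vertex_cases; simp)

text \<open>At each stage \<open>label_eqI\<close> leaves one summand, so a single chain survives
  and its dual labels accumulate in the second factor. The condition on \<open>b\<close> says that
  the product collected so far ends at the complement of the current vertex.\<close>

lemma total_pairing_labels:
  assumes "nonzero_labels k ls" "b * idem (- k) = b"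
  shows "total_pairing k (map (\<lambda>l. [l]) ls) c b (length ls) k k' =
    (if path_end k ls = Some k' then c \<otimes> (b * path_class (- k) (map dual ls)) else 0)"
  using assms
proof (induction ls arbitrary: k b)
  case Nil
  then show ?case by (auto simp: total_pairing_simps)
next
  case (Cons l ls)
  from Cons.prems obtain k1 where k1: "b_target l k = Some k1" and nz: "nonzero_path k [l]"
    by (auto simp: nonzero_path_def split: option.splits)
  let ?t = "\<lambda>l'. case b_target l' k of None \<Rightarrow> 0 | Some k2 \<Rightarrow>
       f2_scale (B2_coef (path_class k [l]) (path_class k [l']))
         (total_pairing k1 (map (\<lambda>l. [l]) ls) c (b * path_class (- k) [dual l']) (length ls) k2 k')"
  have zero: "?t l' = 0" if "l' \<noteq> l" for l'
    using label_eqI[of l' k l] k1 that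
    by (auto simp: B2_coef_path_class[OF nz] split: option.split)
  have "total_pairing k (map (\<lambda>l. [l]) (l # ls)) c b (length (l # ls)) k k' = (\<Sum>l'\<in>UNIV. ?t l')"
  proof -
    have "the (path_end k [l]) = k1" using k1 by simp
    then show ?thesis by (simp only: total_pairing_Cons list.map length_Cons)
  qed
  also have "\<dots> = (\<Sum>l'\<in>{l}. ?t l')"
    by (rule sum.mono_neutral_right) (simp_all add: zero UNIV_b_label[THEN arg_cong, of finite])
  also have "\<dots> = total_pairing k1 (map (\<lambda>l. [l]) ls) c (b * path_class (- k) [dual l]) (length ls) k1 k'"
    using k1 by (simp add: B2_coef_path_class[OF nz])
  also have "\<dots> = (if path_end k1 ls = Some k' then
      c \<otimes> (b * path_class (- k) [dual l] * path_class (- k1) (map dual ls)) else 0)"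
    using Cons.prems k1 s_target_dual[of l k]
    by (intro Cons.IH) (simp_all add: mult.assoc path_class_times_idem)
  also have "b * path_class (- k) [dual l] * path_class (- k1) (map dual ls) =
      b * path_class (- k) (map dual (l # ls))"
    using k1 s_target_dual[of l k] by (simp add: mult.assoc path_class_mult)
  finally show ?case using k1 by simp
qed

section \<open>Box products with \<open>K_DD\<close> in terms of tables\<close>

definition dd_term_coef :: "dd_term \<Rightarrow> xgen \<Rightarrow> xgen \<Rightarrow> BB" where
  "dd_term_coef = (\<lambda>(x, v, w, y) x' y'.
     if x' = x \<and> y' = y
     then (idem (xleft x) \<otimes> idem (- xright x)) * (word v \<otimes> word w) *
       (idem (xleft y) \<otimes> idem (- xright y))
     else 0)"

definition dual_terms :: "da_term list \<Rightarrow> dd_term list" where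
  "dual_terms ts =
     [(x, v, map (dual \<circ> hd) ps, y). (x, ps, v, y) \<leftarrow> ts, list_all (\<lambda>p. length p = 1) ps]"

text \<open>An input that is not a single label, such as \<open>L\<^sub>2 U\<^sub>1\<close> or an idempotent, is never produced by \<open>K\<close>.\<close>

definition regular_input :: "vertex \<Rightarrow> b_label list list \<Rightarrow> bool" where
  "regular_input x ps \<longleftrightarrow>
     (if list_all (\<lambda>p. length p = 1) ps then nonzero_labels x (map hd ps)
      else list_ex (\<lambda>p. (weight One p, weight Two p) \<notin> label_weights) ps)"

lemma path_end_dual: "path_end (- x) (map dual ls) = map_option uminus (path_end x ls)"
  by (induction ls arbitrary: x) (auto simp: s_target_dual split: option.splits)

lemma total_pairing_term:
  assumes "regular_input (xright x) ps"
  shows "total_pairing (xright x) ps (idem (xleft x) * word v * idem (xleft y)) (idem (- xright x))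
      (length ps) (xright x) (xright y) =
    (\<Sum>t\<leftarrow>dual_terms [(x, ps, v, y)]. dd_term_coef t x y)"
proof (cases "list_all (\<lambda>p. length p = 1) ps")
  case True
  define ls where "ls = map hd ps"
  from True have ps: "ps = map (\<lambda>l. [l]) ls"
    unfolding ls_def by (induction ps) (auto simp: length_Suc_conv)
  from assms True have "nonzero_labels (xright x) ls"
    by (simp add: regular_input_def ls_def)
  from total_pairing_labels[OF this, of "idem (- xright x)"]
  have "total_pairing (xright x) ps (idem (xleft x) * word v * idem (xleft y)) (idem (- xright x))
      (length ps) (xright x) (xright y) =
    (if path_end (xright x) ls = Some (xright y)
     then (idem (xleft x) * word v * idem (xleft y)) \<otimes> path_class (- xright x) (map dual ls) else 0)"
    by (simp add: ps path_class_mult)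
  also have "\<dots> = (idem (xleft x) * word v * idem (xleft y)) \<otimes>
      (idem (- xright x) * word (map dual ls) * idem (- xright y))"
    by (auto simp: idem_word_idem[of "- xright x"] path_end_dual)
  also have "\<dots> = (\<Sum>t\<leftarrow>dual_terms [(x, ps, v, y)]. dd_term_coef t x y)"
    using True by (simp add: dual_terms_def dd_term_coef_def tens_mult ls_def)
  finally show ?thesis .
next
  case False
  with assms obtain p where "p \<in> set ps" "(weight One p, weight Two p) \<notin> label_weights"
    by (auto simp: regular_input_def list_ex_iff)
  with False show ?thesis by (simp add: total_pairing_not_label dual_terms_def)
qed

lemma sum_list_sum_swap: "(\<Sum>x\<in>A. \<Sum>t\<leftarrow>ts. f x t) = (\<Sum>t\<leftarrow>ts. \<Sum>x\<in>A. f x t :: 'a::comm_monoid_add)"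
  by (induction ts) (simp_all add: sum.distrib)

lemma sum_list_nonzeroD: "(\<Sum>t\<leftarrow>ts. f t) \<noteq> (0 :: 'a::comm_monoid_add) \<Longrightarrow> \<exists>t\<in>set ts. f t \<noteq> 0"
  by (induction ts) auto

lemma dual_terms_simps: "dual_terms [] = []" "dual_terms (t # ts) = dual_terms [t] @ dual_terms ts"
  by (simp_all add: dual_terms_def split: prod.split)

text \<open>The sum over arities and chains is regrouped by table entries. For an entry with inputs
  \<open>ps\<close> only the arity \<open>length ps\<close> contributes, and
  \<open>total_pairing_term\<close> gives its value.\<close>

lemma dd_coef_box:
  assumes xy: "x \<in> G" "y \<in> G"
    and reg: "\<And>x ps v y. (x, ps, v, y) \<in> set ts \<Longrightarrow> regular_input (xright x) ps"
  shows "dd_coef (da_of_terms G ts \<boxtimes> K_DD) (x, xright x) (y, xright y) =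
    (\<Sum>t\<leftarrow>dual_terms ts. dd_term_coef t x y)"
proof -
  define X where "X = da_of_terms G ts"
  define ts' where "ts' = (x, [[]], [], x) # ts"
  \<comment> \<open>A finite upper bound for the arities; the 1 comes from the identity operation.
    Arities in \<open>A\<close> for which every operation is zero contribute nothing.\<close>
  define A where "A = insert 1 ((\<lambda>(x, ps, v, y). length ps) ` set ts)"
  define g where "g t n = (\<Sum>ks\<in>dd_chains K_DD n (xright x) (xright y).
    contract (\<lambda>as. term_op t x as y) [] (idem (- xright x)) (chain_coefs K_DD ks))" for t n
  have op: "da_op X x as y = (\<Sum>t\<leftarrow>ts'. term_op t x as y)" for as
    by (simp add: X_def da_of_terms_def ts'_def)
  have input_length: "input_coef v ps as = 0" if "length as \<noteq> length ps" for v ps as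
    using that by (induction v ps as rule: input_coef.induct) auto
  have "da_arities X \<subseteq> A"
  proof
    fix n assume "n \<in> da_arities X"
    then obtain x' y' as where as: "length as = n" "da_op X x' as y' \<noteq> 0"
      by (auto simp: da_arities_def)
    then have "(\<Sum>t\<leftarrow>(x', [[]], [], x') # ts. term_op t x' as y') \<noteq> 0"
      by (simp add: X_def da_of_terms_def)
    from sum_list_nonzeroD[OF this]
    obtain t where t: "t \<in> set ((x', [[]], [], x') # ts)" "term_op t x' as y' \<noteq> 0" by (rule bexE)
    obtain x0 ps v y0 where t_eq: "t = (x0, ps, v, y0)" by (metis prod_cases4)
    have "length ps = n"
    proof (rule ccontr)
      assume "length ps \<noteq> n"
      then have "input_coef (xright x0) ps as = 0" using as(1) by (intro input_length) simp
      with t(2) show False by (simp add: t_eq term_op_def split: if_splits)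
    qed
    with t(1) t_eq show "n \<in> A" unfolding A_def by force
  qed
  moreover have "finite A" by (simp add: A_def)
  moreover have "(\<Sum>ks\<in>dd_chains K_DD n (xright x) (xright y).
      contract (\<lambda>as. da_op X x as y) [] (idem (- xright x)) (chain_coefs K_DD ks)) = 0"
    if "n \<notin> da_arities X" for n
  proof (intro sum.neutral ballI contract_eq_0)
    fix ks and as :: "B2 list"
    assume "ks \<in> dd_chains K_DD n (xright x) (xright y)"
      and "length as = length ([] :: B2 list) + length (chain_coefs K_DD ks)"
    then have "length as = n" by (simp add: dd_chains_iff chain_coefs_def)
    with that xy show "da_op X x as y = 0"
      by (auto simp: da_arities_def X_def da_of_terms_def)
  qed
  ultimately have "dd_coef (X \<boxtimes> K_DD) (x, xright x) (y, xright y) =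
      (\<Sum>n\<in>A. \<Sum>ks\<in>dd_chains K_DD n (xright x) (xright y).
        contract (\<lambda>as. da_op X x as y) [] (idem (- xright x)) (chain_coefs K_DD ks))"
    unfolding box_def by simp (rule sum.mono_neutral_left; simp)
  also have "\<dots> = (\<Sum>t\<leftarrow>ts'. \<Sum>n\<in>A. g t n)"
    unfolding op contract_sum_list g_def sum_list_sum_swap ..
  also have "\<dots> = (\<Sum>t\<leftarrow>ts'. \<Sum>t'\<leftarrow>dual_terms [t]. dd_term_coef t' x y)"
  proof (intro arg_cong[where f = sum_list] map_cong refl)
    fix t assume t: "t \<in> set ts'"
    obtain x0 ps v y0 where t_eq: "t = (x0, ps, v, y0)" by (metis prod_cases4)
    show "(\<Sum>n\<in>A. g t n) = (\<Sum>t'\<leftarrow>dual_terms [t]. dd_term_coef t' x y)"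
    proof (cases "x = x0 \<and> y = y0")
      case True
      then have g: "g t n = total_pairing (xright x) ps (idem (xleft x) * word v * idem (xleft y))
          (idem (- xright x)) n (xright x) (xright y)" for n
        by (simp add: g_def total_pairing_def pairing_def t_eq term_op_def)
      from t have "length ps \<in> A" unfolding ts'_def A_def t_eq by force
      then have "(\<Sum>n\<in>A. g t n) = g t (length ps)"
        using \<open>finite A\<close> total_pairing_length
        by (subst sum.remove) (auto simp: g intro!: sum.neutral)
      also have "\<dots> = (\<Sum>t'\<leftarrow>dual_terms [t]. dd_term_coef t' x y)"
      proof -
        \<comment> \<open>The identity operation has an idempotent as input. Its weights are (0, 0),
          which no label has, so it leaves no trace in the box product.\<close>
        have "regular_input (xright x) [[]]" by (simp add: regular_input_def label_weights_def)
        then have "regular_input (xright x) ps"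
          using t reg True unfolding t_eq ts'_def by auto
        from total_pairing_term[OF this, of v y] True show ?thesis unfolding g by (simp add: t_eq)
      qed
      finally show ?thesis .
    next
      case False
      then have "g t n = 0" for n by (auto simp: g_def t_eq term_op_def)
      with False show ?thesis by (auto simp: t_eq dual_terms_def dd_term_coef_def)
    qed
  qed
  also have "\<dots> = (\<Sum>t\<leftarrow>ts. \<Sum>t'\<leftarrow>dual_terms [t]. dd_term_coef t' x y)"
    by (simp add: ts'_def dual_terms_def)
  also have "\<dots> = (\<Sum>t\<leftarrow>dual_terms ts. dd_term_coef t x y)"
    by (induction ts) (simp_all add: dual_terms_simps(1), subst (2) dual_terms_simps(2), simp)
  finally show ?thesis by (simp add: X_def)
qed

section \<open>Vanishing sums of terms\<close>

primrec b_part :: "s_label list \<Rightarrow> b_label list" where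
  "b_part [] = []"
| "b_part (l # w) = (case l of Old m \<Rightarrow> m # b_part w | C i \<Rightarrow> b_part w)"

lemma b_part_append [simp]: "b_part (v @ w) = b_part v @ b_part w"
  by (induction v) (simp_all split: s_label.split)

lemma path_end_b_part: "path_end x (b_part w) = path_end x w"
  by (induction w arbitrary: x) (simp_all split: s_label.split option.split)

abbreviation c_sum :: "idx \<Rightarrow> B2_dual" where
  "c_sum i \<equiv> label_sum (C i)"

lemma c_sum_commute: "c_sum i * label_sum l = label_sum l * c_sum i"
proof -
  have "c_sum i * path_class x [l] = path_class x [l] * c_sum i" for x
  proof (rule label_sum_commute)
    show "target (C i) = Some" by (simp add: fun_eq_iff)
    show "target l x \<noteq> None \<Longrightarrow> (x, [[C i, l], [l, C i]]) \<in> relators"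
      by (auto simp: relators_s_label_def s_relators_def)
  qed
  then show ?thesis
    by (simp add: label_sum_def[of l] sum_distrib_left sum_distrib_right)
qed

lemma c_sum_power_commute: "c_sum i ^ k * label_sum l = label_sum l * c_sum i ^ k"
  by (rule power_commuting_commutes[OF c_sum_commute])

lemma c_sum_power_eq_0:
  assumes "k \<ge> 2"
  shows "c_sum i ^ k = 0"
proof -
  have "path_class x [C i, C i] = 0" for x
    using path_class_relator[of x "[[C i, C i]]"]
    by (auto simp: relators_s_label_def s_relators_def)
  then have 0: "path_class x [C i] * c_sum i = 0" for x
    by (simp add: path_class_times_label_sum)
  have "c_sum i ^ 2 = (\<Sum>x\<in>UNIV. path_class x [C i]) * c_sum i"
    unfolding power2_eq_square by (simp only: label_sum_def)
  then have "c_sum i ^ 2 = 0" by (simp add: sum_distrib_right 0)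
  moreover have "c_sum i ^ k = c_sum i ^ 2 * c_sum i ^ (k - 2)"
    using le_add_diff_inverse[OF assms] by (simp only: flip: power_add)
  ultimately show ?thesis by simp
qed

text \<open>Each new letter is moved to the left past the powers of \<open>c_sum\<close> already
  collected at the end of the word.\<close>

lemma path_class_c_sum:
  "path_class x w = S.pc x (b_part w) * c_sum One ^ count_list w (C One) * c_sum Two ^ count_list w (C Two)"
proof (induction w rule: rev_induct)
  case Nil
  then show ?case by (simp add: S.pc_def)
next
  case (snoc l w)
  let ?p = "S.pc x (b_part w)" and ?h = "count_list w (C One)" and ?k = "count_list w (C Two)"
  have "path_class x (w @ [l]) = ?p * c_sum One ^ ?h * c_sum Two ^ ?k * label_sum l"
    by (simp add: snoc.IH flip: path_class_times_label_sum)
  also have "\<dots> = ?p * c_sum One ^ ?h * label_sum l * c_sum Two ^ ?k"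
    unfolding mult.assoc[of "?p * c_sum One ^ ?h"] c_sum_power_commute ..
  finally have 1: "path_class x (w @ [l]) = ?p * c_sum One ^ ?h * label_sum l * c_sum Two ^ ?k" .
  also have "?p * c_sum One ^ ?h * label_sum l = ?p * label_sum l * c_sum One ^ ?h"
    by (simp only: mult.assoc c_sum_power_commute)
  finally have 2: "path_class x (w @ [l]) = ?p * label_sum l * c_sum One ^ ?h * c_sum Two ^ ?k" .
  show ?case
  proof (cases l)
    case (Old m)
    have "S.pc x (b_part w @ [m]) = ?p * label_sum (Old m)"
      by (simp add: S.pc_def path_class_times_label_sum)
    with 2 Old show ?thesis by (simp add: count_list_append)
  next
    case (C i)
    show ?thesis
    proof (cases i)
      case One
      with 1 C show ?thesis by (simp add: count_list_append power_Suc2 mult.assoc del: power_Suc)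
    next
      case Two
      with 1 C show ?thesis by (simp add: count_list_append mult.assoc)
    qed
  qed
qed

definition well_formed :: "dd_term \<Rightarrow> bool" where
  "well_formed = (\<lambda>(x, v, w, y). path_end (xleft x) v = Some (xleft y) \<and>
     path_end (- xright x) w = Some (- xright y))"

type_synonym key = "xgen \<times> xgen \<times> nat \<times> nat \<times> nat \<times> nat \<times> nat \<times> nat"

text \<open>An invariant that determines the coefficient of a well-formed term, with
  \<open>None\<close> for terms known to be zero. The end points of both words are encoded in
  \<open>x\<close> and \<open>y\<close>.\<close>

definition dd_key :: "dd_term \<Rightarrow> key option" where
  "dd_key = (\<lambda>(x, v, w, y).
     if vanishing (xleft x) (weight One v) (weight Two v) \<or>
       vanishing (- xright x) (weight One (b_part w)) (weight Two (b_part w)) \<or>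
       count_list w C1 \<ge> 2 \<or> count_list w C2 \<ge> 2
     then None
     else Some (x, y, weight One v, weight Two v, weight One (b_part w), weight Two (b_part w),
       count_list w C1, count_list w C2))"

lemma dd_term_coef_well_formed:
  "well_formed (x, v, w, y) \<Longrightarrow> dd_term_coef (x, v, w, y) x' y' =
    (if x' = x \<and> y' = y then path_class (xleft x) v \<otimes> path_class (- xright x) w else 0)"
  by (simp add: well_formed_def dd_term_coef_def tens_mult idem_word_idem)

lemma dd_term_coef_key_None:
  assumes "well_formed t" "dd_key t = None"
  shows "dd_term_coef t x' y' = 0"
proof -
  obtain x v w y where t: "t = (x, v, w, y)" by (metis prod_cases4)
  have "path_class (xleft x) v = 0 \<or> path_class (- xright x) w = 0"
    using assms(2) B.pc_vanishing[of "xleft x" v] S.pc_vanishing[of "- xright x" "b_part w"]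
      c_sum_power_eq_0[of "count_list w C1" One] c_sum_power_eq_0[of "count_list w C2" Two]
      path_class_c_sum[of "- xright x" w]
    by (auto simp: dd_key_def t B.pc_def split: if_splits)
  then show ?thesis
    using dd_term_coef_well_formed[of x v w y x' y'] assms(1) by (auto simp: t)
qed

lemma dd_term_coef_key_eq:
  assumes "well_formed t" "well_formed t'" "dd_key t = dd_key t'"
  shows "dd_term_coef t x' y' = dd_term_coef t' x' y'"
proof (cases "dd_key t")
  case None
  with assms show ?thesis by (simp add: dd_term_coef_key_None)
next
  case (Some k)
  obtain x v w y where t: "t = (x, v, w, y)" by (metis prod_cases4)
  obtain x2 v' w' y2 where t': "t' = (x2, v', w', y2)" by (metis prod_cases4)
  from Some assms(3) have eq: "x2 = x" "y2 = y" "weight One v = weight One v'" "weight Two v = weight Two v'"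
    "weight One (b_part w) = weight One (b_part w')" "weight Two (b_part w) = weight Two (b_part w')"
    "count_list w C1 = count_list w' C1" "count_list w C2 = count_list w' C2"
    by (auto simp: dd_key_def t t' split: if_splits)
  have "path_class (xleft x) v = path_class (xleft x) v'"
    by (rule path_class_B_cong) (use assms(1,2) eq in \<open>auto simp: well_formed_def t t'\<close>)
  moreover have "S.pc (- xright x) (b_part w) = S.pc (- xright x) (b_part w')"
    by (rule S.pc_cong) (use assms(1,2) eq in \<open>auto simp: well_formed_def t t' path_end_b_part\<close>)
  then have "path_class (- xright x) w = path_class (- xright x) w'"
    by (simp add: path_class_c_sum[of _ w] path_class_c_sum[of _ w'] eq)
  ultimately show ?thesis
    using assms(1,2) by (simp add: t t' eq(1,2) dd_term_coef_well_formed)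
qed

text \<open>Equal summands cancel in pairs. The index set \<open>A\<close> stays fixed while the
  induction shortens the list.\<close>

lemma sum_list_parity:
  fixes f :: "'k \<Rightarrow> 'v::f2_space"
  assumes "finite A" "set ks \<subseteq> A"
  shows "(\<Sum>k\<leftarrow>ks. f k) = (\<Sum>k\<in>A. if odd (count_list ks k) then f k else 0)"
  using assms(2)
proof (induction ks)
  case (Cons k ks)
  let ?g = "\<lambda>ks k. if odd (count_list ks k) then f k else 0"
  have k: "k \<in> A" using Cons.prems by simp
  have "(\<Sum>j\<in>A. ?g (k # ks) j) = ?g (k # ks) k + (\<Sum>j\<in>A - {k}. ?g ks j)"
    unfolding sum.remove[OF assms(1) k] by (intro arg_cong2[where f = plus] sum.cong) auto
  also have "?g (k # ks) k = f k + ?g ks k" by (simp add: f2_add_self)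
  also have "f k + ?g ks k + (\<Sum>j\<in>A - {k}. ?g ks j) = f k + (\<Sum>j\<in>A. ?g ks j)"
    unfolding sum.remove[OF assms(1) k, of "?g ks"] by (simp add: add.assoc)
  finally show ?case using Cons by simp
qed simp

text \<open>An executable sufficient condition. Since keys contain source and target generator, one
  evaluation covers all matrix entries at once.\<close>

definition cancels :: "dd_term list \<Rightarrow> bool" where
  "cancels ts \<longleftrightarrow> (let ks = map dd_key ts in list_all (\<lambda>k. k = None \<or> even (count_list ks k)) ks)"

lemma sum_list_cancels:
  assumes "\<And>t. t \<in> set ts \<Longrightarrow> well_formed t" "cancels ts"
  shows "(\<Sum>t\<leftarrow>ts. dd_term_coef t x y) = 0"
proof -
  \<comment> \<open>The coefficient becomes a function of the key by choosing a representative term;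
    \<open>dd_term_coef_key_eq\<close> makes the choice irrelevant.\<close>
  define f where "f k = dd_term_coef (SOME t. t \<in> set ts \<and> dd_key t = k) x y" for k
  have f: "dd_term_coef t x y = f (dd_key t)" if "t \<in> set ts" for t
  proof -
    define s where "s = (SOME s. s \<in> set ts \<and> dd_key s = dd_key t)"
    have "s \<in> set ts \<and> dd_key s = dd_key t"
      unfolding s_def by (rule someI[of _ t]) (simp add: that)
    then show ?thesis
      unfolding f_def s_def[symmetric] using assms(1) that by (intro dd_term_coef_key_eq) auto
  qed
  have f0: "f (dd_key t) = 0" if "t \<in> set ts" "dd_key t = None" for t
    using f[OF that(1)] dd_term_coef_key_None[OF assms(1) that(2)] that(1) by simp
  have "(\<Sum>t\<leftarrow>ts. dd_term_coef t x y) = (\<Sum>k\<leftarrow>map dd_key ts. f k)"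
    by (simp add: o_def f cong: map_cong)
  also have "\<dots> = (\<Sum>k\<in>set (map dd_key ts). if odd (count_list (map dd_key ts) k) then f k else 0)"
    by (rule sum_list_parity) simp_all
  also have "\<dots> = 0"
    using assms(2) f0 unfolding cancels_def Let_def list_all_iff
    by (intro sum.neutral) auto
  finally show ?thesis .
qed

section \<open>The structure equation\<close>

primrec dif_words :: "s_label list \<Rightarrow> s_label list list" where
  "dif_words [] = []"
| "dif_words (l # w) = (case l of Old _ \<Rightarrow> [] | C i \<Rightarrow> [Old (U i) # w]) @ map ((#) l) (dif_words w)"

lemma path_end_dif_words: "w' \<in> set (dif_words w) \<Longrightarrow> path_end x w' = path_end x w"
  by (induction w arbitrary: x w') (auto split: s_label.splits option.splits)

lemma dif_label: "dif (path_class x [l]) =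
    (case label_dif l of None \<Rightarrow> 0 | Some l' \<Rightarrow> path_class x [l'])"
  by (cases "label_dif l"; simp; transfer) (simp_all add: path_dif_1 equivp_reflp[OF quiver_algebra_equivp])

lemma dif_path_class: "dif (path_class x w) = (\<Sum>w'\<leftarrow>dif_words w. path_class x w')"
proof (induction w arbitrary: x)
  case Nil
  have "dif (path_class x [] :: B2_dual) = 0"
    by transfer (simp add: path_dif_path equivp_reflp[OF quiver_algebra_equivp])
  then show ?case by simp
next
  case (Cons l w)
  show ?case
  proof (cases "s_target l x")
    case None
    \<comment> \<open>Every \<open>C i\<close> is a loop at each vertex, so a letter without an
      arrow at \<open>x\<close> is an old label and has zero differential.\<close>
    then obtain m where l: "l = Old m" by (cases l) auto
    have "(\<Sum>w'\<leftarrow>ws. path_class x (l # w')) = 0" for ws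
      using None by (induction ws) (simp_all add: path_class_undefined)
    with None show ?thesis by (simp add: path_class_undefined o_def l)
  next
    case (Some z)
    have 1: "path_class x (l # w') = path_class x [l] * path_class z w'" for w'
      using Some by (intro path_class_Cons) simp
    have "dif (path_class x (l # w)) = dif (path_class x [l]) * path_class z w +
        path_class x [l] * (\<Sum>w'\<leftarrow>dif_words w. path_class z w')"
      unfolding 1[of w] dif_mult Cons.IH ..
    also have "path_class x [l] * (\<Sum>w'\<leftarrow>dif_words w. path_class z w') =
        (\<Sum>w'\<leftarrow>dif_words w. path_class x (l # w'))"
      by (simp only: 1[symmetric] sum_list_const_mult[symmetric])
    also have "dif (path_class x [l]) * path_class z w =
        (\<Sum>w'\<leftarrow>(case l of Old _ \<Rightarrow> [] | C i \<Rightarrow> [Old (U i) # w]). path_class x w')"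
      using Some by (cases l) (simp_all add: dif_label label_dif_s_label_def path_class_mult)
    finally show ?thesis by (simp add: o_def)
  qed
qed

lemma dif_B2 [simp]: "dif (a :: B2) = 0"
proof -
  have "path_dif p = 0" for p :: "b_label path_algebra"
    by (induction p rule: path_induct) (simp_all add: path_dif_add path_dif_path label_dif_b_label_def)
  then show ?thesis
    by transfer (simp add: equivp_reflp[OF quiver_algebra_equivp])
qed

definition dif_terms :: "dd_term list \<Rightarrow> dd_term list" where
  "dif_terms ts = [(x, v, w', y). (x, v, w, y) \<leftarrow> ts, w' \<leftarrow> dif_words w]"

definition composite_terms :: "dd_term list \<Rightarrow> dd_term list \<Rightarrow> dd_term list" where
  "composite_terms ts us =
     [(x, v @ v', w @ w', y'). (x, v, w, y) \<leftarrow> ts, (x', v', w', y') \<leftarrow> us, x' = y]"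

lemma sum_list_concat: "(\<Sum>x\<leftarrow>concat xss. f x) = (\<Sum>xs\<leftarrow>xss. \<Sum>x\<leftarrow>xs. f x :: 'a::comm_monoid_add)"
  by (induction xss) simp_all

lemma dif_sum_list: "dif (\<Sum>t\<leftarrow>ts. f t) = (\<Sum>t\<leftarrow>ts. dif (f t) :: 'a::f2_dga)"
  by (induction ts) (simp_all add: dif_add)

lemma tens_sum_list: "a \<otimes> (\<Sum>t\<leftarrow>ts. f t) = (\<Sum>t\<leftarrow>ts. a \<otimes> f t)"
  by (induction ts) (simp_all add: tens_add_right)

lemma dif_terms_well_formed:
  "(\<And>t. t \<in> set ts \<Longrightarrow> well_formed t) \<Longrightarrow> t \<in> set (dif_terms ts) \<Longrightarrow> well_formed t"
  by (fastforce simp: dif_terms_def well_formed_def path_end_dif_words)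

lemma composite_terms_well_formed:
  "(\<And>t. t \<in> set ts \<Longrightarrow> well_formed t) \<Longrightarrow> (\<And>t. t \<in> set us \<Longrightarrow> well_formed t) \<Longrightarrow>
    t \<in> set (composite_terms ts us) \<Longrightarrow> well_formed t"
  by (fastforce simp: composite_terms_def well_formed_def path_end_append)

lemma dif_dd_terms:
  assumes "\<And>t. t \<in> set ts \<Longrightarrow> well_formed t"
  shows "dif (\<Sum>t\<leftarrow>ts. dd_term_coef t x y) = (\<Sum>t\<leftarrow>dif_terms ts. dd_term_coef t x y)"
proof -
  have "dif (dd_term_coef t x y) = (\<Sum>t\<leftarrow>dif_terms [t]. dd_term_coef t x y)" if "well_formed t" for t
  proof -
    obtain x0 v w y0 where t: "t = (x0, v, w, y0)" by (metis prod_cases4)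
    have wf: "well_formed (x0, v, w', y0)" if "w' \<in> set (dif_words w)" for w'
      using \<open>well_formed t\<close> path_end_dif_words[OF that] by (simp add: t well_formed_def)
    have "(\<Sum>t\<leftarrow>dif_terms [t]. dd_term_coef t x y) =
      (\<Sum>w'\<leftarrow>dif_words w. if x = x0 \<and> y = y0 then path_class (xleft x0) v \<otimes> path_class (- xright x0) w' else 0)"
      by (simp add: dif_terms_def t o_def dd_term_coef_well_formed[OF wf] cong: map_cong)
    also have "\<dots> = (if x = x0 \<and> y = y0 then path_class (xleft x0) v \<otimes> dif (path_class (- xright x0) w) else 0)"
      by (cases "x = x0 \<and> y = y0") (simp_all only: if_True if_False simp_thms dif_path_class tens_sum_list sum_list_0)
    also have "\<dots> = dif (dd_term_coef t x y)"
      using that by (simp add: t dd_term_coef_well_formed tens_dif)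
    finally show ?thesis ..
  qed
  with assms show ?thesis
    unfolding dif_sum_list
    by (induction ts) (simp_all add: dif_terms_def)
qed

lemma composite_dd_terms:
  assumes "finite G" "\<And>t. t \<in> set ts \<Longrightarrow> well_formed t" "\<And>t. t \<in> set us \<Longrightarrow> well_formed t"
    "\<And>x v w y. (x, v, w, y) \<in> set ts \<Longrightarrow> y \<in> G"
  shows "(\<Sum>z\<in>G. (\<Sum>t\<leftarrow>ts. dd_term_coef t x z) * (\<Sum>t\<leftarrow>us. dd_term_coef t z y)) =
    (\<Sum>t\<leftarrow>composite_terms ts us. dd_term_coef t x y)"
proof -
  have "(\<Sum>z\<in>G. dd_term_coef t x z * dd_term_coef t' z y) =
      (\<Sum>s\<leftarrow>composite_terms [t] [t']. dd_term_coef s x y)"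
    if t: "t \<in> set ts" and t': "t' \<in> set us" for t t'
  proof -
    obtain x1 v w y1 where t_eq: "t = (x1, v, w, y1)" by (metis prod_cases4)
    obtain x2 v' w' y2 where t'_eq: "t' = (x2, v', w', y2)" by (metis prod_cases4)
    from t t' assms have wf: "well_formed t" "well_formed t'" and "y1 \<in> G" by (auto simp: t_eq)
    have "(\<Sum>z\<in>G. dd_term_coef t x z * dd_term_coef t' z y) =
        (\<Sum>z\<in>{y1}. dd_term_coef t x z * dd_term_coef t' z y)"
      using assms(1) \<open>y1 \<in> G\<close> wf(1)
      by (intro sum.mono_neutral_right) (auto simp: t_eq dd_term_coef_well_formed)
    also have "\<dots> = (\<Sum>s\<leftarrow>composite_terms [t] [t']. dd_term_coef s x y)"
    proof (cases "x2 = y1")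
      case True
      with wf have "well_formed (x1, v @ v', w @ w', y2)"
        by (simp add: t_eq t'_eq well_formed_def path_end_append)
      with wf True show ?thesis
        by (simp add: t_eq t'_eq composite_terms_def dd_term_coef_well_formed tens_mult)
           (simp add: well_formed_def path_class_mult)
    next
      case False
      with wf show ?thesis
        by (simp add: t_eq t'_eq composite_terms_def dd_term_coef_well_formed)
    qed
    finally show ?thesis .
  qed
  then have "(\<Sum>t\<leftarrow>ts. \<Sum>t'\<leftarrow>us. \<Sum>z\<in>G. dd_term_coef t x z * dd_term_coef t' z y) =
      (\<Sum>t\<leftarrow>ts. \<Sum>t'\<leftarrow>us. \<Sum>s\<leftarrow>composite_terms [t] [t']. dd_term_coef s x y)"
    by (simp cong: map_cong)
  also have "\<dots> = (\<Sum>t\<leftarrow>composite_terms ts us. dd_term_coef t x y)"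
    by (simp add: composite_terms_def sum_list_concat o_def case_prod_unfold)
  finally show ?thesis
    unfolding sum_list_mult_const[symmetric] unfolding sum_list_const_mult[symmetric] sum_list_sum_swap .
qed

definition degree_compatible :: "dd_term \<Rightarrow> bool" where
  "degree_compatible = (\<lambda>(x, v, w, y).
     path_degree v + path_degree w = xdegree x + hdeg 1 - xdegree y)"

lemma dd_coef_of_terms: "dd_coef (dd_of_terms G ts) x y = (\<Sum>t\<leftarrow>ts. dd_term_coef t x y)"
  by (simp add: dd_of_terms_def dd_term_coef_def case_prod_unfold)

text \<open>Idempotents and degrees are checked entry by entry. The structure equation is the
  cancellation of one list, made of the differentials of the entries and their composable
  products.\<close>

lemma dd_bimodule_of_terms:
  assumes "finite G" and wf: "\<And>t. t \<in> set ts \<Longrightarrow> well_formed t"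
    and deg: "\<And>t. t \<in> set ts \<Longrightarrow> degree_compatible t"
    and G: "\<And>x v w y. (x, v, w, y) \<in> set ts \<Longrightarrow> y \<in> G"
    and cancels: "cancels (dif_terms ts @ composite_terms ts ts)"
  shows "dd_bimodule (dd_of_terms G ts)"
  unfolding dd_bimodule_def
proof (intro conjI ballI)
  let ?X = "dd_of_terms G ts"
  show "finite (dd_gens ?X)" using assms(1) by (simp add: dd_of_terms_def)
  fix x y
  let ?I = "\<lambda>x. idem (xleft x) \<otimes> idem (- xright x) :: BB"
  have idem: "?I x * dd_term_coef t x y * ?I y = dd_term_coef t x y" if "well_formed t" for t
  proof -
    obtain x' v w y' where t: "t = (x', v, w, y')" by (metis prod_cases4)
    show ?thesis
      using that by (simp add: t dd_term_coef_well_formed tens_mult path_class_mult)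
        (simp add: well_formed_def)
  qed
  have "?I x * (\<Sum>t\<leftarrow>ts. dd_term_coef t x y) * ?I y = (\<Sum>t\<leftarrow>ts. ?I x * dd_term_coef t x y * ?I y)"
    by (simp only: sum_list_const_mult sum_list_mult_const)
  also have "\<dots> = (\<Sum>t\<leftarrow>ts. dd_term_coef t x y)"
    by (simp add: idem wf cong: map_cong)
  finally show "dd_idem ?X x * dd_coef ?X x y * dd_idem ?X y = dd_coef ?X x y"
    unfolding dd_coef_of_terms by (simp add: dd_of_terms_def)
  have "dd_term_coef t x y \<in> homogeneous (xdegree x + hdeg 1 - xdegree y)" if t: "t \<in> set ts" for t
  proof -
    obtain x' v w y' where t_eq: "t = (x', v, w, y')" by (metis prod_cases4)
    show ?thesis
    proof (cases "x = x' \<and> y = y'")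
      case True
      with deg[OF t] have "path_class (xleft x') v \<otimes> path_class (- xright x') w
          \<in> homogeneous (xdegree x + hdeg 1 - xdegree y)"
        unfolding homogeneous_def t_eq degree_compatible_def by (intro F2.span_base) auto
      with True wf[OF t] show ?thesis by (simp add: t_eq dd_term_coef_well_formed)
    next
      case False
      then show ?thesis by (auto simp: t_eq dd_term_coef_def homogeneous_def F2.span_zero)
    qed
  qed
  then have "(\<Sum>t\<leftarrow>ts. dd_term_coef t x y) \<in> homogeneous (xdegree x + hdeg 1 - xdegree y)"
    by (induction ts) (simp_all add: homogeneous_def F2.span_zero F2.span_add)
  then show "dd_coef ?X x y \<in> homogeneous (dd_degree ?X x + hdeg 1 - dd_degree ?X y)"
    unfolding dd_coef_of_terms by (simp add: dd_of_terms_def)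
  have "dif (\<Sum>t\<leftarrow>ts. dd_term_coef t x y) +
      (\<Sum>z\<in>G. (\<Sum>t\<leftarrow>ts. dd_term_coef t x z) * (\<Sum>t\<leftarrow>ts. dd_term_coef t z y)) =
      (\<Sum>t\<leftarrow>dif_terms ts @ composite_terms ts ts. dd_term_coef t x y)"
    by (simp add: dif_dd_terms[OF wf] composite_dd_terms[OF assms(1) wf wf G])
  also have "\<dots> = 0"
  proof (rule sum_list_cancels[OF _ cancels])
    fix t assume "t \<in> set (dif_terms ts @ composite_terms ts ts)"
    then consider "t \<in> set (dif_terms ts)" | "t \<in> set (composite_terms ts ts)" by auto
    then show "well_formed t"
      by cases (erule dif_terms_well_formed[OF wf, rotated] composite_terms_well_formed[OF wf wf, rotated 2], assumption+)+
  qed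
  finally show "dif (dd_coef ?X x y) + (\<Sum>z\<in>dd_gens ?X. dd_coef ?X x z * dd_coef ?X z y) = 0"
    unfolding dd_coef_of_terms by (simp add: dd_of_terms_def)
qed

text \<open>All conditions on \<open>Y\<close> are transported from \<open>X\<close> along the
  bijection; in particular its structure equation is obtained by reindexing the sum over
  intermediate generators.\<close>

lemma dd_isomorphismI:
  assumes X: "dd_bimodule X" and bij: "bij_betw \<phi> (dd_gens X) (dd_gens Y)"
    and gens: "\<And>x. x \<in> dd_gens X \<Longrightarrow> dd_idem1 Y (\<phi> x) = dd_idem1 X x"
      "\<And>x. x \<in> dd_gens X \<Longrightarrow> dd_idem2 Y (\<phi> x) = dd_idem2 X x"
      "\<And>x. x \<in> dd_gens X \<Longrightarrow> dd_degree Y (\<phi> x) = dd_degree X x"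
    and coef: "\<And>x y. x \<in> dd_gens X \<Longrightarrow> y \<in> dd_gens X \<Longrightarrow> dd_coef Y (\<phi> x) (\<phi> y) = dd_coef X x y"
  shows "dd_isomorphism X Y \<phi>"
proof -
  have Y: "dd_gens Y = \<phi> ` dd_gens X" using bij by (simp add: bij_betw_def)
  have sum: "(\<Sum>z\<in>dd_gens Y. dd_coef Y (\<phi> x) z * dd_coef Y z (\<phi> y)) =
      (\<Sum>z\<in>dd_gens X. dd_coef X x z * dd_coef X z y)" if "x \<in> dd_gens X" "y \<in> dd_gens X" for x y
    using that by (subst sum.reindex_bij_betw[OF bij, symmetric]) (simp add: coef)
  have "finite (dd_gens Y)" using X by (simp add: Y dd_bimodule_def)
  moreover have "dd_idem Y (\<phi> x) * dd_coef Y (\<phi> x) (\<phi> y) * dd_idem Y (\<phi> y) = dd_coef Y (\<phi> x) (\<phi> y) \<and>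
      dd_coef Y (\<phi> x) (\<phi> y) \<in> homogeneous (dd_degree Y (\<phi> x) + hdeg 1 - dd_degree Y (\<phi> y)) \<and>
      dif (dd_coef Y (\<phi> x) (\<phi> y)) + (\<Sum>z\<in>dd_gens Y. dd_coef Y (\<phi> x) z * dd_coef Y z (\<phi> y)) = 0"
    if "x \<in> dd_gens X" "y \<in> dd_gens X" for x y
    using X that unfolding dd_bimodule_def sum[OF that] by (simp add: coef gens)
  ultimately have "dd_bimodule Y"
    unfolding dd_bimodule_def Y ball_simps(9) by blast
  with X bij gens coef show ?thesis by (simp add: dd_isomorphism_def)
qed

lemma dd_isomorphism_box:
  assumes "dd_bimodule (dd_of_terms G us)"
    and reg: "\<And>x ps v y. (x, ps, v, y) \<in> set ts \<Longrightarrow> regular_input (xright x) ps"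
    and wf: "\<And>t. t \<in> set (dual_terms ts) \<Longrightarrow> well_formed t" "\<And>t. t \<in> set us \<Longrightarrow> well_formed t"
    and cancels: "cancels (dual_terms ts @ us)"
  shows "dd_isomorphism (dd_of_terms G us) (da_of_terms G ts \<boxtimes> K_DD) natural_map"
proof (rule dd_isomorphismI[OF assms(1)])
  show "bij_betw natural_map (dd_gens (dd_of_terms G us)) (dd_gens (da_of_terms G ts \<boxtimes> K_DD))"
  proof (rule bij_betw_imageI)
    show "inj_on natural_map (dd_gens (dd_of_terms G us))"
      by (rule inj_onI) (simp add: natural_map_def)
    have "{(m, k). m \<in> G \<and> xright m = k} = natural_map ` G"
    proof (intro equalityI subsetI)
      fix p assume "p \<in> {(m, k). m \<in> G \<and> xright m = k}"
      then obtain m where "m \<in> G" "p = natural_map m"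
        by (cases p) (simp add: natural_map_def)
      then show "p \<in> natural_map ` G" by (rule rev_image_eqI)
    next
      fix p assume "p \<in> natural_map ` G"
      then obtain m where "m \<in> G" "p = natural_map m" by (rule imageE)
      then show "p \<in> {(m, k). m \<in> G \<and> xright m = k}" by (simp add: natural_map_def)
    qed
    then show "natural_map ` dd_gens (dd_of_terms G us) = dd_gens (da_of_terms G ts \<boxtimes> K_DD)"
      by (simp add: dd_of_terms_def da_of_terms_def box_def)
  qed
  fix x assume x: "x \<in> dd_gens (dd_of_terms G us)"
  show "dd_idem1 (da_of_terms G ts \<boxtimes> K_DD) (natural_map x) = dd_idem1 (dd_of_terms G us) x"
    "dd_idem2 (da_of_terms G ts \<boxtimes> K_DD) (natural_map x) = dd_idem2 (dd_of_terms G us) x"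
    "dd_degree (da_of_terms G ts \<boxtimes> K_DD) (natural_map x) = dd_degree (dd_of_terms G us) x"
    by (simp_all add: natural_map_def dd_of_terms_def da_of_terms_def box_def)
  fix y assume y: "y \<in> dd_gens (dd_of_terms G us)"
  have "(\<Sum>t\<leftarrow>dual_terms ts @ us. dd_term_coef t x y) = 0"
    by (rule sum_list_cancels[OF _ cancels]) (simp only: set_append Un_iff, elim disjE wf)
  then have "(\<Sum>t\<leftarrow>dual_terms ts. dd_term_coef t x y) = (\<Sum>t\<leftarrow>us. dd_term_coef t x y)"
    by - (rule f2_eqI, simp)
  with x y show "dd_coef (da_of_terms G ts \<boxtimes> K_DD) (natural_map x) (natural_map y) =
      dd_coef (dd_of_terms G us) x y"
    unfolding natural_map_def dd_coef_of_terms
    by (subst dd_coef_box[OF _ _ reg]) (simp_all add: dd_of_terms_def)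
qed

section \<open>Evaluation of the tables\<close>

text \<open>Membership tests, unlike equations between vertices, can be evaluated on complements.\<close>

lemma vanishing_code [code]:
  "vanishing x m n \<longleftrightarrow>
    (if P0 \<in> x then P1 \<notin> x \<and> P2 \<notin> x \<and> n > 0
     else if P1 \<in> x then P2 \<notin> x \<and> m > 0 \<and> n > 0
     else if P2 \<in> x then m > 0 else m > 0 \<or> n > 0)"
  by (cases x rule: vertex_cases) simp_all

lemma finite_xgen: "finite (G :: xgen set)"
proof (rule finite_subset)
  have "x \<in> set [Z1, Z2, Z3, Z4, X1, X2, X3, X4, X5, X6, X7, X8, X9, X10, X11, X12,
      Y1, Y2, Y3, Y4, Y5, Y6, Y7, Y8]" for x
    by (cases x) simp_all
  then show "G \<subseteq> set [Z1, Z2, Z3, Z4, X1, X2, X3, X4, X5, X6, X7, X8, X9, X10, X11, X12,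
      Y1, Y2, Y3, Y4, Y5, Y6, Y7, Y8]"
    by blast
qed simp

text \<open>With the additional entry of the simplified table in front, both versions are subtables
  of one list, and entrywise conditions are evaluated once for both.\<close>

lemma dd_terms_well_formed: "list_all well_formed ((Y5, [L1, L2], [], Y4) # dd_terms)"
  by (simp add: dd_terms_def well_formed_def xleft_def xright_def compl_vertex)

lemma dd_terms_degree: "list_all degree_compatible ((Y5, [L1, L2], [], Y4) # dd_terms)"
  by (simp add: dd_terms_def degree_compatible_def path_degree_def label_degree_b_label_def
      label_degree_s_label_def xdegree_def hdeg_def plus_prod_def minus_prod_def zero_prod_def)

lemma da_terms_regular:
  "list_all (\<lambda>(x, ps, v, y). regular_input (xright x) ps) ((Y5, [], [L1, L2], Y4) # da_terms)"
  by (simp add: da_terms_def pairs_P_def regular_input_def xright_def nonzero_path_def label_weights_def)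

lemma dual_terms_da_terms_well_formed:
  "list_all well_formed (dual_terms ((Y5, [], [L1, L2], Y4) # da_terms))"
  by (simp add: da_terms_def pairs_P_def dual_terms_def well_formed_def xleft_def xright_def compl_vertex)

lemma dual_terms_mono: "set ts \<subseteq> set us \<Longrightarrow> set (dual_terms ts) \<subseteq> set (dual_terms us)"
  unfolding dual_terms_def set_concat set_map by (intro UN_mono image_mono) simp_all

text \<open>A typical cancellation: the differential of \<open>C1 C2\<close> in the term from
  \<open>Y1\<close> to \<open>Y2\<close> has the two summands \<open>U1 C2\<close> and
  \<open>C1 U2\<close>, which are matched by the composites through \<open>Y5\<close> and
  \<open>Y7\<close>.\<close>

lemma cancels_DD: "cancels (dif_terms dd_terms @ composite_terms dd_terms dd_terms)"
  by code_simp

text \<open>The deleted generators are the ends of the four arrows with coefficient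
  \<open>1 \<otimes> 1\<close>: \<open>Z3\<close> to \<open>Z2\<close>, \<open>X8\<close> to
  \<open>X4\<close>, \<open>X9\<close> to \<open>X5\<close>, \<open>Y6\<close> to \<open>Y3\<close>.
  Cancelling these arrows creates one zigzag, from \<open>Y5\<close> to \<open>Y3\<close>, back to
  \<open>Y6\<close> and on to \<open>Y4\<close>, with coefficient \<open>L1 L2\<close>: the
  additional entry.\<close>

lemma cancels_DD_simplified:
  defines "us \<equiv> (Y5, [L1, L2], [], Y4) # [(x, v, w, y) \<leftarrow> dd_terms. x \<notin> deleted \<and> y \<notin> deleted]"
  shows "cancels (dif_terms us @ composite_terms us us)"
  unfolding us_def by code_simp

text \<open>Normal forms are really needed here: the inputs \<open>R1\<close>, \<open>U2\<close>,
  \<open>L1\<close> dualise to \<open>L1 C2 R1\<close>, listed as \<open>U1 C2\<close> in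
  \<open>dd_terms\<close>. The operation with four inputs leaves only \<open>C1 C2 C1 C2\<close>,
  which is zero and has no counterpart.\<close>

lemma cancels_box: "cancels (dual_terms da_terms @ dd_terms)"
  by code_simp

lemma cancels_box_simplified:
  "cancels (dual_terms ((Y5, [], [L1, L2], Y4) #
      [(x, ps, w, y) \<leftarrow> da_terms. x \<notin> deleted \<and> y \<notin> deleted]) @
    (Y5, [L1, L2], [], Y4) # [(x, v, w, y) \<leftarrow> dd_terms. x \<notin> deleted \<and> y \<notin> deleted])"
  by code_simp

text \<open>Entrywise conditions pass to subtables. Cancellation does not, since deleting entries
  changes multiplicities, so it is assumed for each pair of tables.\<close>

lemma dd_isomorphism_subtables:
  assumes us: "set us \<subseteq> set ((Y5, [L1, L2], [], Y4) # dd_terms)"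
    and ts: "set ts \<subseteq> set ((Y5, [], [L1, L2], Y4) # da_terms)"
    and G: "\<And>x v w y. (x, v, w, y) \<in> set us \<Longrightarrow> y \<in> G"
    and DD: "cancels (dif_terms us @ composite_terms us us)"
    and box: "cancels (dual_terms ts @ us)"
  shows "dd_isomorphism (dd_of_terms G us) (da_of_terms G ts \<boxtimes> K_DD) natural_map"
proof (rule dd_isomorphism_box)
  show wf: "well_formed t" if "t \<in> set us" for t
    using subsetD[OF us that] dd_terms_well_formed unfolding list_all_iff by (rule bspec[rotated])
  show "dd_bimodule (dd_of_terms G us)"
  proof (rule dd_bimodule_of_terms[OF finite_xgen wf _ G DD])
    show "degree_compatible t" if "t \<in> set us" for t
      using subsetD[OF us that] dd_terms_degree unfolding list_all_iff by (rule bspec[rotated])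
  qed
  show "regular_input (xright x) ps" if "(x, ps, v, y) \<in> set ts" for x ps v y
    using bspec[OF da_terms_regular[unfolded list_all_iff] subsetD[OF ts that]] by simp
  show "well_formed t" if "t \<in> set (dual_terms ts)" for t
    using bspec[OF dual_terms_da_terms_well_formed[unfolded list_all_iff]
      subsetD[OF dual_terms_mono[OF ts] that]] .
qed (fact box)

theorem proposition5p6:
  shows "dd_isomorphism X_DD (X_DA \<boxtimes> K_DD) natural_map \<and>
    dd_isomorphism X_DD_simplified (X_DA_simplified \<boxtimes> K_DD) natural_map"
proof
  show "dd_isomorphism X_DD (X_DA \<boxtimes> K_DD) natural_map"
    unfolding X_DD_def X_DA_def
    by (rule dd_isomorphism_subtables[OF _ _ _ cancels_DD cancels_box]) (rule set_subset_Cons, rule set_subset_Cons, rule UNIV_I)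
  show "dd_isomorphism X_DD_simplified (X_DA_simplified \<boxtimes> K_DD) natural_map"
    unfolding X_DD_simplified_def X_DA_simplified_def
  proof (rule dd_isomorphism_subtables[OF _ _ _ cancels_DD_simplified cancels_box_simplified])
    show "set ((Y5, [L1, L2], [], Y4) # [(x, v, w, y) \<leftarrow> dd_terms. x \<notin> deleted \<and> y \<notin> deleted])
        \<subseteq> set ((Y5, [L1, L2], [], Y4) # dd_terms)"
      unfolding list.set set_filter by blast
    show "set ((Y5, [], [L1, L2], Y4) # [(x, ps, w, y) \<leftarrow> da_terms. x \<notin> deleted \<and> y \<notin> deleted])
        \<subseteq> set ((Y5, [], [L1, L2], Y4) # da_terms)"
      unfolding list.set set_filter by blast
    show "y \<in> - deleted"
      if "(x, v, w, y) \<in> set ((Y5, [L1, L2], [], Y4) # [(x, v, w, y) \<leftarrow> dd_terms. x \<notin> deleted \<and> y \<notin> deleted])"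
      for x v w y
      using that unfolding list.set set_filter by (auto simp: deleted_def)
  qed
qed

end
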